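(* Let $F_1(x;\tau)$ be the limiting one-point distribution function of the periodic TASEP with flat initial condition, defined in the context, and let $F_{\rm GOE}$ be the GOE Tracy–Widom distribution. For every fixed $\tau>0$ there is a constant $c>0$ such that $$1-F_1(x;\tau)=\left(1-F_{\rm GOE}(2^{2/3}\tau^{-1/3}x)\right)\left(1+O(e^{-cx^{1/2}})\right),\qquad x\to\infty .$$
   Context: Roots and logarithms are principal. $F_{\rm GOE}(x)=\det(\mathbf I-\mathbf A_x)_{L^2(0,\infty)}$, where $\mathbf A_x$ has kernel $\mathrm{Ai}(s+x+t)$. $\mathrm{Li}_s(z)=\sum_{k\ge1}z^k/k^s$ for $|z|<1$, continued analytically to $\mathbb C\setminus[1,\infty)$. For $|z|<1$: $A_1(z)=-\frac1{\sqrt{2\pi}}\mathrm{Li}_{3/2}(z)$, $A_2(z)=-\frac1{\sqrt{2\pi}}\mathrm{Li}_{5/2}(z)$, $A_3(z)=-\frac14\log(1-z)$, $B(z)=\frac1{4\pi}\int_0^z\frac{(\mathrm{Li}_{1/2}(y))^2}{y}dy$. For $0<|z|<1$, $\mathcal S_-=\{\xi\in\mathbb C:e^{-\xi^2/2}=z,\ \mathrm{Re}\,\xi<0\}$, a subset of the sector $3\pi/4<\arg\xi<5\pi/4$; in that sector $Q(\xi)=\sqrt{2/\pi}\int_{-\infty}^\xi\mathrm{Li}_{1/2}(e^{-s^2/2})ds$ (path in the sector) and $\Psi(\xi)=\Psi(\xi;x,\tau)=-\frac13\tau\xi^3+x\xi-\frac12Q(\xi)$. $\mathbf K^{(1)}_z$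 is the operator on $\ell^2(\mathcal S_-)$ with kernel $$\mathbf K_z^{(1)}(\xi_1,\xi_2)=\frac{e^{\Psi(\xi_1)+\Psi(\xi_2)}}{\xi_1(\xi_1+\xi_2)}$$ (conjugate to the kernel $-\frac{e^{\Psi(\xi_1)+\Psi(\xi_2)}}{\sqrt{-\xi_1}\sqrt{-\xi_2}(\xi_1+\xi_2)}$, with the same Fredholm determinant). For $\tau>0$, $x\in\mathbb R$, $$F_1(x;\tau)=\oint_{|z|=R}e^{xA_1(z)+\tau A_2(z)+A_3(z)+B(z)}\det(\mathbf I-\mathbf K_z^{(1)})\frac{dz}{2\pi iz},$$ with any $0<R<1$, counterclockwise. *)

theory Defs
  imports
    "HOL-Complex_Analysis.Complex_Analysis"
    "HOL-Library.Landau_Symbols"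
    "Jordan_Normal_Form.Determinant"
begin

text \<open>
  The Fredholm determinant \<open>det(I - K)\<close> on \<open>L\<^sup>2(M)\<close>, given by Fredholm's series.
  \<open>\<ell>\<^sup>2(S)\<close> is the case \<open>M = count_space S\<close>, where the integrals are sums over \<open>S\<^sup>n\<close>.
\<close>

definition fredholm_det ::
    "'a measure \<Rightarrow> ('a \<Rightarrow> 'a \<Rightarrow> 'b::{real_normed_field,banach,second_countable_topology}) \<Rightarrow> 'b"
  where "fredholm_det M K =
    (\<Sum>n. (- 1) ^ n / fact n *
      (LINT v|Pi\<^sub>M {..<n} (\<lambda>_. M). Determinant.det (Matrix.mat n n (\<lambda>(i, j). K (v i) (v j)))))"

text \<open>
  The integral converges only conditionally. The gauge integral over the half-line is the limit
  of the integrals over \<open>[0,T]\<close> as \<open>T\<close> tends to infinity.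
\<close>

definition airy_Ai :: "real \<Rightarrow> real"
  where "airy_Ai x = integral {0..} (\<lambda>t. cos (t ^ 3 / 3 + x * t)) / pi"

definition F_GOE :: "real \<Rightarrow> real"
  where "F_GOE x = fredholm_det (restrict_space lborel {0<..}) (\<lambda>s t. airy_Ai (s + x + t))"

definition polylog_series :: "real \<Rightarrow> complex \<Rightarrow> complex"
  where "polylog_series s z = (\<Sum>k. z ^ Suc k / of_real (real (Suc k) powr s))"

text \<open>
  Outside the unit disc this is the analytic continuation to the plane cut along \<open>[1,\<infinity>)\<close>;
  it is unique on that domain, so the choice operator is harmless there. Values on the cut are
  meaningless.
\<close>

definition polylog :: "real \<Rightarrow> complex \<Rightarrow> complex"
  where "polylog s z =
    (if norm z < 1 then polylog_series s z
     else (SOME f. f holomorphic_on (- (complex_of_real ` {1..})) \<and>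
                   (\<forall>w\<in>ball 0 1. f w = polylog_series s w)) z)"

definition A1 :: "complex \<Rightarrow> complex"
  where "A1 z = - (1 / of_real (sqrt (2 * pi))) * polylog (3/2) z"

definition A2 :: "complex \<Rightarrow> complex"
  where "A2 z = - (1 / of_real (sqrt (2 * pi))) * polylog (5/2) z"

definition A3 :: "complex \<Rightarrow> complex"
  where "A3 z = - (1/4) * ln (1 - z)"

text \<open>The integrand has a removable singularity at the origin.\<close>

definition B :: "complex \<Rightarrow> complex"
  where "B z = 1 / (4 * of_real pi) *
    contour_integral (linepath 0 z) (\<lambda>y. (polylog (1/2) y)\<^sup>2 / y)"

definition S_minus :: "complex \<Rightarrow> complex set"
  where "S_minus z = {\<xi>. exp (- \<xi>\<^sup>2 / 2) = z \<and> Re \<xi> < 0}"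

text \<open>
  The path from \<open>-\<infinity>\<close> to \<open>\<xi>\<close> is the horizontal ray \<open>s = \<xi> - t\<close>, \<open>t \<ge> 0\<close>. It stays in
  the sector \<open>3\<pi>/4 < arg < 5\<pi>/4\<close> when \<open>\<xi>\<close> lies there.
\<close>

definition Q :: "complex \<Rightarrow> complex"
  where "Q \<xi> = of_real (sqrt (2 / pi)) *
    (LINT t:{0..}|lborel. polylog (1/2) (exp (- (\<xi> - of_real t)\<^sup>2 / 2)))"

definition Psi :: "real \<Rightarrow> real \<Rightarrow> complex \<Rightarrow> complex"
  where "Psi x \<tau> \<xi> = - (1/3) * of_real \<tau> * \<xi> ^ 3 + of_real x * \<xi> - (1/2) * Q \<xi>"

definition K1 :: "real \<Rightarrow> real \<Rightarrow> complex \<Rightarrow> complex \<Rightarrow> complex"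
  where "K1 x \<tau> \<xi>1 \<xi>2 = exp (Psi x \<tau> \<xi>1 + Psi x \<tau> \<xi>2) / (\<xi>1 * (\<xi>1 + \<xi>2))"

text \<open>
  The radius \<open>R\<close> of the contour is kept as a parameter; the value does not depend on it
  for \<open>0 < R < 1\<close>.
\<close>

definition F1 :: "real \<Rightarrow> real \<Rightarrow> real \<Rightarrow> complex"
  where "F1 R x \<tau> = contour_integral (circlepath 0 R)
    (\<lambda>z. exp (of_real x * A1 z + of_real \<tau> * A2 z + A3 z + B z) *
         fredholm_det (count_space (S_minus z)) (K1 x \<tau>) / (2 * of_real pi * \<i> * z))"

end

theory Submission
  imports Defs "HOL-Probability.Sinc_Integral" "HOL-Real_Asymp.Real_Asymp"
begin

text \<open>
  Both sides are compared with the trace \<open>Tr\<close> of the Airy kernel. On the GOE side, \<open>1 - F_GOE\<close> is \<open>Tr\<close> up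
  to the terms of order at least 2 of the Fredholm series, which are at most \<open>Tr\<^sup>2\<close> times a power of \<open>x\<close>.
  On the other side, the contour integral does not depend on the radius, and the radius
  \<open>exp (- x / (2 * \<tau>))\<close> puts \<open>S_minus z\<close> on the hyperbola through the saddle point \<open>- sqrt (x / \<tau>)\<close> of the
  phase. There the prefactor and \<open>exp (- Q)\<close> differ from 1 by \<open>O(x * exp (- x / (2 * \<tau>)))\<close>, and the higher
  Fredholm terms are again quadratically small. The constant term integrates to 1. In the trace term
  \<open>z = exp (- \<xi>\<^sup>2 / 2)\<close> turns the integral over the circle and the sum over \<open>S_minus z\<close> into one integral over
  the hyperbola, which can be moved to a vertical line, where it is exactly \<open>Tr\<close>. Laplace's method
  bounds \<open>Tr\<close> from below, so all errors are relative errors, and they are smaller than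
  \<open>exp (- sqrt x)\<close>.
\<close>

section \<open>Integrals, holomorphy and determinants\<close>

text \<open>With a = sqrt(x/\<tau>) the tail has size exp(-(4/3) \<tau> a^3) up to powers, while the
  prefactor deviates from 1 by about x exp(-a^2/2), which is far larger. So the constant term cannot
  be estimated; it has to be integrated exactly, by the mean value property. In the trace term the
  same deviation is only a relative error, and this is the rate that survives. Saddle point
  expansions of both tails would not do: when truncated they leave relative errors that are powers
  of 1/x. Hence both sides are tied to one exact quantity, and Laplace's method is used only for a
  lower bound of it. Changing the radius needs holomorphy of the Fredholm determinant, but the
  points of \<open>S_minus z\<close> are permuted when z turns around 0 and cannot be labelled
  continuously on a circle. This forces the passage to w = ln z, where the labels are integers. As
  the kernel need not be small on a general circle, convergence there requires a determinant bound
  without n!.\<close>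

lemma holomorphic_on_lebesgue_integral:
  fixes f :: "'a \<Rightarrow> complex \<Rightarrow> complex"
  assumes S: "open S"
    and holo: "\<And>x. x \<in> space M \<Longrightarrow> f x holomorphic_on S"
    and meas: "\<And>w. w \<in> S \<Longrightarrow> (\<lambda>x. f x w) \<in> borel_measurable M"
    and bound: "\<And>x w. x \<in> space M \<Longrightarrow> w \<in> S \<Longrightarrow> norm (f x w) \<le> g x"
    and g: "integrable M g"
  shows "(\<lambda>w. LINT x|M. f x w) holomorphic_on S"
proof -
  have int: "integrable M (\<lambda>x. f x w)" if "w \<in> S" for w
    by (rule Bochner_Integration.integrable_bound[OF g meas[OF that]])
      (use bound that in \<open>force intro!: AE_I2\<close>)
  have "(\<lambda>w. LINT x|M. f x w) field_differentiable at w0" if w0: "w0 \<in> S" for w0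
  proof -
    obtain r0 where r0: "r0 > 0" "cball w0 r0 \<subseteq> S"
      using S w0 open_contains_cball by blast
    \<comment> \<open>Halving the radius keeps the closed disc of radius r around every point of
      \<open>ball w0 r\<close> inside S, as Cauchy's inequality at these points requires.\<close>
    define r where "r = r0 / 2"
    have r: "r > 0" using r0 by (simp add: r_def)
    have sub: "cball u r \<subseteq> S" if "u \<in> ball w0 r" for u
    proof
      fix v assume "v \<in> cball u r"
      with that have "dist w0 v \<le> r + r"
        using dist_triangle[of w0 v u] by auto
      then show "v \<in> S" using r0 by (auto simp: r_def)
    qed
    have subS: "ball w0 r \<subseteq> S" using sub r by (meson centre_in_cball less_imp_le subset_iff)
    \<comment> \<open>Cauchy's inequality turns the majorant g of the values into the majorant g / r
      of the derivatives, so all difference quotients are dominated by one integrable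
      function.\<close>
    have dbound: "norm (deriv (f x) u) \<le> g x / r" if x: "x \<in> space M" and u: "u \<in> ball w0 r" for x u
    proof -
      have "norm ((deriv ^^ 1) (f x) u) \<le> fact 1 * g x / r ^ 1"
      proof (rule Cauchy_inequality)
        show "f x holomorphic_on ball u r"
          using holo[OF x] sub[OF u] by (meson ball_subset_cball holomorphic_on_subset subset_trans)
        show "continuous_on (cball u r) (f x)"
          using holo[OF x] sub[OF u] by (meson holomorphic_on_imp_continuous_on holomorphic_on_subset)
        show "norm (f x v) \<le> g x" if "norm (u - v) = r" for v
          using bound[OF x] sub[OF u] that by (auto simp: dist_norm subset_iff)
      qed fact
      then show ?thesis by simp
    qed
    have lip: "norm (f x u - f x w0) \<le> g x / r * norm (u - w0)"
      if x: "x \<in> space M" and u: "u \<in> ball w0 r" for x u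
    proof (rule field_differentiable_bound[of "ball w0 r"])
      fix z assume z: "z \<in> ball w0 r"
      show "(f x has_field_derivative deriv (f x) z) (at z within ball w0 r)"
        using holo[OF x] z subS S
        by (meson DERIV_subset holomorphic_derivI subset_UNIV subsetD)
      show "norm (deriv (f x) z) \<le> g x / r" using dbound x z by auto
    qed (use r u in auto)
    define D where "D = (LINT x|M. deriv (f x) w0)"
    have "((\<lambda>u. ((LINT x|M. f x u) - (LINT x|M. f x w0)) / (u - w0)) \<longlongrightarrow> D) (at w0 within ball w0 r)"
      unfolding tendsto_at_iff_sequentially
    proof (intro allI impI)
      fix X :: "nat \<Rightarrow> complex"
      assume X: "\<forall>i. X i \<in> ball w0 r - {w0}" and lim: "X \<longlonglongrightarrow> w0"
      have XS: "X i \<in> S" "X i \<noteq> w0" "X i \<in> ball w0 r" for i using X subS by auto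
      let ?q = "\<lambda>i x. (f x (X i) - f x w0) / (X i - w0)"
      have lim': "(\<lambda>i. ?q i x) \<longlonglongrightarrow> deriv (f x) w0" if x: "x \<in> space M" for x
      proof -
        have "(f x has_field_derivative deriv (f x) w0) (at w0 within ball w0 r)"
          using holo[OF x] w0 S by (meson DERIV_subset holomorphic_derivI subset_UNIV)
        then have "((\<lambda>u. (f x u - f x w0) / (u - w0)) \<longlongrightarrow> deriv (f x) w0) (at w0 within ball w0 r)"
          by (simp add: has_field_derivative_iff)
        then show ?thesis using X lim
          unfolding tendsto_at_iff_sequentially by (auto simp: comp_def)
      qed
      have meas': "?q i \<in> borel_measurable M" for i
        using meas[OF XS(1)] meas[OF w0] by (intro borel_measurable_divide borel_measurable_diff) auto
      have measD: "(\<lambda>x. deriv (f x) w0) \<in> borel_measurable M"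
        by (rule borel_measurable_LIMSEQ_metric[OF meas' lim'])
      have "(\<lambda>i. LINT x|M. ?q i x) \<longlonglongrightarrow> D"
        unfolding D_def
      proof (rule integral_dominated_convergence[where w = "\<lambda>x. g x / r"])
        show "integrable M (\<lambda>x. g x / r)" using g by auto
        show "AE x in M. norm (?q i x) \<le> g x / r" for i
          using lip XS by (intro AE_I2) (auto simp: norm_divide divide_simps)
      qed (use measD meas' lim' in auto)
      moreover have "(LINT x|M. ?q i x) = ((LINT x|M. f x (X i)) - (LINT x|M. f x w0)) / (X i - w0)" for i
        by (simp add: Bochner_Integration.integral_diff[OF int[OF XS(1)] int[OF w0]])
      ultimately show "((\<lambda>u. ((LINT x|M. f x u) - (LINT x|M. f x w0)) / (u - w0)) \<circ> X) \<longlonglongrightarrow> D"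
        by (simp only: comp_def)
    qed
    then have "((\<lambda>w. LINT x|M. f x w) has_field_derivative D) (at w0)"
      using r by (simp add: has_field_derivative_iff at_within_open[of w0 "ball w0 r"])
    then show ?thesis by (auto simp: field_differentiable_def)
  qed
  then show ?thesis
    using field_differentiable_at_within unfolding holomorphic_on_def by blast
qed

text \<open>No measurability is assumed: the Bochner integral of a non-integrable function is \<open>0\<close>.\<close>

lemma norm_LINT_le:
  fixes f :: "'a \<Rightarrow> 'b::{banach, second_countable_topology}" and g :: "'a \<Rightarrow> real"
  assumes g: "integrable M g" and f: "\<And>x. x \<in> space M \<Longrightarrow> norm (f x) \<le> g x"
  shows "norm (LINT x|M. f x) \<le> (LINT x|M. g x)"
proof (cases "integrable M f")
  case True
  have "norm (integral\<^sup>L M f) \<le> (LINT x|M. norm (f x))" by (rule integral_norm_bound)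
  also have "\<dots> \<le> (LINT x|M. g x)"
    using True g f by (intro integral_mono) auto
  finally show ?thesis .
next
  case False
  have "0 \<le> (LINT x|M. g x)"
    by (intro Bochner_Integration.integral_nonneg) (use f order_trans[OF norm_ge_zero] in blast)
  then show ?thesis by (simp only: not_integrable_integral_eq[OF False] norm_zero)
qed

lemma norm_LINT_PiM_le:
  fixes F :: "(nat \<Rightarrow> 'a) \<Rightarrow> 'b::{banach, second_countable_topology}" and g :: "'a \<Rightarrow> real"
  assumes "sigma_finite_measure M" and g: "integrable M g"
    and F: "\<And>v. v \<in> space (Pi\<^sub>M {..<n} (\<lambda>_. M)) \<Longrightarrow> norm (F v) \<le> C * (\<Prod>i<n. g (v i))"
  shows "norm (LINT v|Pi\<^sub>M {..<n} (\<lambda>_. M). F v) \<le> C * (integral\<^sup>L M g) ^ n"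
proof -
  interpret sigma_finite_measure M by fact
  interpret product_sigma_finite "\<lambda>_. M" by standard
  have int: "integrable (Pi\<^sub>M {..<n} (\<lambda>_. M)) (\<lambda>v. C * (\<Prod>i<n. g (v i)))"
    using product_integrable_prod[of "{..<n}" "\<lambda>_. g"] g by auto
  have "(LINT v|Pi\<^sub>M {..<n} (\<lambda>_. M). C * (\<Prod>i<n. g (v i))) = C * (integral\<^sup>L M g) ^ n"
    using product_integral_prod[of "{..<n}" "\<lambda>_. g"] g by simp
  then show ?thesis using norm_LINT_le[OF int F] by metis
qed

text \<open>The set \<open>S_minus z\<close> moves with z. A parametrisation by a fixed countable
  type removes this dependence from the measure and puts it into the kernel, where holomorphy can be
  studied.\<close>

lemma fredholm_det_count_space_reindex:
  fixes \<phi> :: "'i::countable \<Rightarrow> 'a"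
    and K :: "'a \<Rightarrow> 'a \<Rightarrow> 'b::{real_normed_field,banach,second_countable_topology}"
  assumes "inj \<phi>"
  shows "fredholm_det (count_space (range \<phi>)) K = fredholm_det (count_space UNIV) (\<lambda>k l. K (\<phi> k) (\<phi> l))"
proof -
  have "(LINT v|Pi\<^sub>M {..<n} (\<lambda>_. count_space (range \<phi>)). Determinant.det (Matrix.mat n n (\<lambda>(i, j). K (v i) (v j)))) =
        (LINT \<kappa>|Pi\<^sub>M {..<n} (\<lambda>_. count_space (UNIV :: 'i set)).
          Determinant.det (Matrix.mat n n (\<lambda>(i, j). K (\<phi> (\<kappa> i)) (\<phi> (\<kappa> j)))))" for n
  proof -
    have eq: "Pi\<^sub>M {..<n} (\<lambda>_. count_space (range \<phi>)) = count_space (Pi\<^sub>E {..<n} (\<lambda>_. range \<phi>))"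
      by (rule count_space_PiM_finite) auto
    have eq': "Pi\<^sub>M {..<n} (\<lambda>_. count_space (UNIV :: 'i set)) = count_space (Pi\<^sub>E {..<n} (\<lambda>_. UNIV))"
      by (rule count_space_PiM_finite) auto
    have bij: "bij_betw (\<lambda>\<kappa>. \<lambda>i\<in>{..<n}. \<phi> (\<kappa> i)) (Pi\<^sub>E {..<n} (\<lambda>_. UNIV)) (Pi\<^sub>E {..<n} (\<lambda>_. range \<phi>))"
      unfolding bij_betw_def
    proof
      show "inj_on (\<lambda>\<kappa>. \<lambda>i\<in>{..<n}. \<phi> (\<kappa> i)) (Pi\<^sub>E {..<n} (\<lambda>_. UNIV))"
      proof (rule inj_onI)
        fix \<kappa> \<mu> assume \<kappa>: "\<kappa> \<in> Pi\<^sub>E {..<n} (\<lambda>_. UNIV)" and \<mu>: "\<mu> \<in> Pi\<^sub>E {..<n} (\<lambda>_. UNIV)"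
          and e: "(\<lambda>i\<in>{..<n}. \<phi> (\<kappa> i)) = (\<lambda>i\<in>{..<n}. \<phi> (\<mu> i))"
        show "\<kappa> = \<mu>"
        proof (rule PiE_ext[OF \<kappa> \<mu>])
          fix i assume "i \<in> {..<n}"
          then have "\<phi> (\<kappa> i) = \<phi> (\<mu> i)" using fun_cong[OF e, of i] by simp
          then show "\<kappa> i = \<mu> i" using assms by (simp add: inj_eq)
        qed
      qed
      show "(\<lambda>\<kappa>. \<lambda>i\<in>{..<n}. \<phi> (\<kappa> i)) ` (Pi\<^sub>E {..<n} (\<lambda>_. UNIV)) = Pi\<^sub>E {..<n} (\<lambda>_. range \<phi>)"
      proof (intro equalityI subsetI)
        fix v assume v: "v \<in> Pi\<^sub>E {..<n} (\<lambda>_. range \<phi>)"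
        define \<kappa> where "\<kappa> = (\<lambda>i\<in>{..<n}. inv_into UNIV \<phi> (v i))"
        have "\<kappa> \<in> Pi\<^sub>E {..<n} (\<lambda>_. UNIV)" by (simp add: \<kappa>_def)
        moreover have "v = (\<lambda>i\<in>{..<n}. \<phi> (\<kappa> i))"
        proof
          fix i
          show "v i = (\<lambda>i\<in>{..<n}. \<phi> (\<kappa> i)) i"
          proof (cases "i < n")
            case True
            then have "v i \<in> range \<phi>" using v by (auto simp: PiE_iff)
            then show ?thesis using True by (simp add: \<kappa>_def f_inv_into_f)
          next
            case False
            then show ?thesis using v by (auto simp: PiE_iff extensional_def)
          qed
        qed
        ultimately show "v \<in> (\<lambda>\<kappa>. \<lambda>i\<in>{..<n}. \<phi> (\<kappa> i)) ` (Pi\<^sub>E {..<n} (\<lambda>_. UNIV))"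
          by (simp only: image_eqI)
      qed auto
    qed
    show ?thesis unfolding eq eq'
      by (subst integral_bij_count_space[OF bij, symmetric])
        (auto intro!: Bochner_Integration.integral_cong arg_cong[where f = Determinant.det] cong_mat)
  qed
  then show ?thesis unfolding fredholm_det_def by simp
qed

section \<open>Determinant identities and bounds\<close>

lemma det_mat_scale:
  fixes f :: "nat \<Rightarrow> nat \<Rightarrow> 'a::comm_ring_1"
  shows "Determinant.det (Matrix.mat n n (\<lambda>(i, j). a i * f i j * b j)) =
    (\<Prod>i<n. a i) * (\<Prod>i<n. b i) * Determinant.det (Matrix.mat n n (\<lambda>(i, j). f i j))"
proof -
  have "(\<Prod>i<n. a i * f i (p i) * b (p i)) = (\<Prod>i<n. a i) * (\<Prod>i<n. b i) * (\<Prod>i<n. f i (p i))"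
    if p: "p permutes {..<n}" for p
  proof -
    have "(\<Prod>i<n. b (p i)) = (\<Prod>i<n. b i)"
      using prod.permute[OF p, of b] by (simp add: comp_def)
    then show ?thesis by (simp add: prod.distrib mult_ac)
  qed
  moreover have "(\<Prod>i<n. Matrix.mat n n (\<lambda>(i, j). g i j) $$ (i, p i)) = (\<Prod>i<n. g i (p i))"
    if p: "p permutes {..<n}" for p and g :: "nat \<Rightarrow> nat \<Rightarrow> 'a"
    using permutes_in_image[OF p] by (intro prod.cong) auto
  ultimately show ?thesis
    by (simp add: Determinant.det_def atLeast0LessThan sum_distrib_left mult_ac)
qed

text \<open>Every permutation contributes at most the same product of row and column factors, and
  there are n! of them. The n! cancels the denominator of the Fredholm series, which is good enough
  for the Airy kernel because that kernel is small.\<close>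

lemma norm_det_mat_le:
  fixes f :: "nat \<Rightarrow> nat \<Rightarrow> 'a::real_normed_field"
  assumes "\<And>i j. i < n \<Longrightarrow> j < n \<Longrightarrow> norm (f i j) \<le> a i * b j"
  shows "norm (Determinant.det (Matrix.mat n n (\<lambda>(i, j). f i j))) \<le> fact n * ((\<Prod>i<n. a i) * (\<Prod>i<n. b i))"
proof -
  have "norm (signof p * (\<Prod>i<n. Matrix.mat n n (\<lambda>(i, j). f i j) $$ (i, p i))) \<le> (\<Prod>i<n. a i) * (\<Prod>i<n. b i)"
    if p: "p permutes {..<n}" for p
  proof -
    have pin: "i < n \<Longrightarrow> p i < n" for i using permutes_in_image[OF p] by auto
    have "norm (signof p * (\<Prod>i<n. Matrix.mat n n (\<lambda>(i, j). f i j) $$ (i, p i))) = (\<Prod>i<n. norm (f i (p i)))"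
      using pin by (auto simp: norm_mult prod_norm sign_def intro!: prod.cong)
    also have "\<dots> \<le> (\<Prod>i<n. a i * b (p i))"
      using pin assms by (intro prod_mono) auto
    also have "\<dots> = (\<Prod>i<n. a i) * (\<Prod>i<n. b i)"
      using prod.permute[OF p, of b] by (simp add: comp_def prod.distrib)
    finally show ?thesis .
  qed
  then have "norm (\<Sum>p | p permutes {..<n}. signof p * (\<Prod>i<n. Matrix.mat n n (\<lambda>(i, j). f i j) $$ (i, p i)))
      \<le> of_nat (card {p. p permutes {..<n}}) * ((\<Prod>i<n. a i) * (\<Prod>i<n. b i))"
    by (intro sum_norm_bound) auto
  then show ?thesis by (simp add: Determinant.det_def atLeast0LessThan card_permutations[of "{..<n}" n])
qed

lemma det_mat_Suc_Schur:
  fixes f :: "nat \<Rightarrow> nat \<Rightarrow> 'a::field"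
  assumes "f 0 0 \<noteq> 0"
  shows "Determinant.det (Matrix.mat (Suc n) (Suc n) (\<lambda>(i, j). f i j)) =
    f 0 0 * Determinant.det (Matrix.mat n n (\<lambda>(i, j). f (Suc i) (Suc j) - f (Suc i) 0 * f 0 (Suc j) / f 0 0))"
proof -
  define L :: "'a mat" where "L = four_block_mat (1\<^sub>m 1) (0\<^sub>m 1 n) (Matrix.mat n 1 (\<lambda>(i, j). f (Suc i) 0 / f 0 0)) (1\<^sub>m n)"
  define U :: "'a mat" where "U = four_block_mat (Matrix.mat 1 1 (\<lambda>_. f 0 0)) (Matrix.mat 1 n (\<lambda>(i, j). f 0 (Suc j))) (0\<^sub>m n 1)
    (Matrix.mat n n (\<lambda>(i, j). f (Suc i) (Suc j) - f (Suc i) 0 * f 0 (Suc j) / f 0 0))"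
  have L: "L \<in> carrier_mat (Suc n) (Suc n)" and U: "U \<in> carrier_mat (Suc n) (Suc n)"
    by (auto simp: L_def U_def)
  have "L * U = Matrix.mat (Suc n) (Suc n) (\<lambda>(i, j). f i j)"
    unfolding L_def U_def
    by (subst mult_four_block_mat[where ?nr1.0=1 and ?n1.0=1 and ?n2.0=n and ?nr2.0=n and ?nc1.0=1 and ?nc2.0=n])
      (use assms in \<open>auto simp: scalar_prod_def not_less Suc_le_eq gr0_conv_Suc intro!: eq_matI\<close>)
  moreover have "Determinant.det L = 1"
    unfolding L_def by (subst det_four_block_mat_upper_right_zero[where n=1 and m=n]) auto
  moreover have "Determinant.det U = f 0 0 * Determinant.det (Matrix.mat n n (\<lambda>(i, j). f (Suc i) (Suc j) - f (Suc i) 0 * f 0 (Suc j) / f 0 0))"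
    unfolding U_def by (subst det_four_block_mat_lower_left_zero_col[where n=n]) (auto simp: det_single)
  ultimately show ?thesis using Determinant.det_mult[OF L U] by simp
qed

text \<open>
  The Schur complement of a Cauchy matrix is a diagonal rescaling of a smaller Cauchy matrix by
  the factors \<open>(x\<^sub>i - x\<^sub>0) / (x\<^sub>i + x\<^sub>0)\<close>, all of modulus at most 1. Unlike Leibniz' formula this gives
  no factor \<open>n!\<close>, so the Fredholm series of \<^const>\<open>K1\<close> converges on every circle, however large the kernel.
\<close>

lemma norm_det_Cauchy_le:
  fixes x :: "nat \<Rightarrow> 'a::real_normed_field"
  assumes "\<And>i j. i < n \<Longrightarrow> j < n \<Longrightarrow> x i + x j \<noteq> 0"
    and "\<And>i j. i < n \<Longrightarrow> j < n \<Longrightarrow> norm (x i - x j) \<le> norm (x i + x j)"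
  shows "norm (Determinant.det (Matrix.mat n n (\<lambda>(i, j). 1 / (x i + x j)))) \<le> (\<Prod>i<n. 1 / norm (2 * x i))"
  using assms
proof (induction n arbitrary: x)
  case 0
  then show ?case by (simp add: det_dim_zero)
next
  case (Suc n)
  let ?y = "\<lambda>i. x (Suc i)"
  let ?s = "\<lambda>i. (?y i - x 0) / (?y i + x 0)"
  have n0: "x i + x j \<noteq> 0" if "i < Suc n" "j < Suc n" for i j using Suc.prems(1) that by auto
  have x00: "x 0 + x 0 \<noteq> 0" using n0[of 0 0] by simp
  have e: "1 / (?y i + ?y j) - 1 / (?y i + x 0) * (1 / (x 0 + ?y j)) / (1 / (x 0 + x 0)) =
       ?s i * (1 / (?y i + ?y j)) * ?s j" if "i < n" "j < n" for i j
    using n0[of "Suc i" "Suc j"] n0[of "Suc i" 0] n0[of 0 "Suc j"] n0[of "Suc j" 0] that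
    by (simp add: divide_simps) (simp add: algebra_simps)
  have "Determinant.det (Matrix.mat (Suc n) (Suc n) (\<lambda>(i, j). 1 / (x i + x j))) =
     1 / (x 0 + x 0) * Determinant.det (Matrix.mat n n (\<lambda>(i, j). ?s i * (1 / (?y i + ?y j)) * ?s j))"
    using x00 e by (subst det_mat_Suc_Schur) (auto intro!: arg_cong[where f = Determinant.det] cong_mat)
  also have "\<dots> = 1 / (x 0 + x 0) * ((\<Prod>i<n. ?s i) * (\<Prod>i<n. ?s i) *
      Determinant.det (Matrix.mat n n (\<lambda>(i, j). 1 / (?y i + ?y j))))"
    by (subst det_mat_scale) simp
  also have "norm \<dots> \<le> 1 / norm (x 0 + x 0) * (1 * 1 * (\<Prod>i<n. 1 / norm (2 * ?y i)))"
  proof -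
    have s: "norm (\<Prod>i<n. ?s i) \<le> 1"
      unfolding prod_norm[symmetric]
      using Suc.prems by (intro prod_le_1) (auto simp: norm_divide divide_le_eq)
    have IH: "norm (Determinant.det (Matrix.mat n n (\<lambda>(i, j). 1 / (?y i + ?y j)))) \<le> (\<Prod>i<n. 1 / norm (2 * ?y i))"
      using Suc.prems by (intro Suc.IH) auto
    show ?thesis unfolding norm_mult norm_divide norm_one
      by (intro mult_mono s IH[unfolded norm_mult norm_divide norm_one]) simp_all
  qed
  also have "\<dots> = (\<Prod>i<Suc n. 1 / norm (2 * x i))"
    by (subst prod.lessThan_Suc_shift) (simp flip: mult_2 add: norm_mult)
  finally show ?case .
qed

section \<open>Polylogarithms and the function Q\<close>

lemma has_bochner_integral_gaussian:
  fixes a :: real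
  assumes "a > 0"
  shows "has_bochner_integral lborel (\<lambda>t. exp (- a * t\<^sup>2)) (sqrt (pi / a))"
proof -
  define \<sigma> where "\<sigma> = sqrt (1 / (2 * a))"
  have \<sigma>: "\<sigma> > 0" "\<sigma>\<^sup>2 = 1 / (2 * a)" using assms by (auto simp: \<sigma>_def)
  have "(\<lambda>t. exp (- a * t\<^sup>2)) = (\<lambda>t. sqrt (pi / a) * normal_density 0 \<sigma> t)"
    using assms by (auto simp: normal_density_def \<sigma>(2) fun_eq_iff field_simps)
  moreover have "has_bochner_integral lborel (\<lambda>t. sqrt (pi / a) * normal_density 0 \<sigma> t) (sqrt (pi / a) * 1)"
    using \<sigma> by (intro has_bochner_integral_mult_right) (auto simp: has_bochner_integral_iff)
  ultimately show ?thesis by simp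
qed

lemma polylog_series_sums:
  assumes "s \<ge> 0" "norm z < 1"
  shows "(\<lambda>k. z ^ Suc k / of_real (real (Suc k) powr s)) sums polylog s z"
    and "norm (polylog s z) \<le> norm z / (1 - norm z)"
proof -
  have b: "norm (z ^ Suc k / of_real (real (Suc k) powr s)) \<le> norm z * norm z ^ k" for k
  proof -
    have "1 \<le> real (Suc k) powr s" using assms by (intro ge_one_powr_ge_zero) auto
    then have "norm z ^ Suc k / (real (Suc k) powr s) \<le> norm z ^ Suc k / 1"
      by (intro divide_left_mono) auto
    then show ?thesis by (simp add: norm_divide norm_power norm_mult)
  qed
  have g: "(\<lambda>k. norm z * norm z ^ k) sums (norm z * (1 / (1 - norm z)))"
    using assms by (intro sums_mult geometric_sums) auto
  have s: "summable (\<lambda>k. z ^ Suc k / of_real (real (Suc k) powr s))"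
    by (rule summable_comparison_test'[OF sums_summable[OF g]]) (use b in auto)
  show "(\<lambda>k. z ^ Suc k / of_real (real (Suc k) powr s)) sums polylog s z"
    using s assms by (simp add: polylog_def polylog_series_def summable_sums)
  have "norm (polylog s z) \<le> (\<Sum>k. norm z * norm z ^ k)"
    unfolding polylog_def polylog_series_def using assms b
    by (auto intro!: norm_suminf_le sums_summable[OF g] simp: norm_mult norm_power)
  then show "norm (polylog s z) \<le> norm z / (1 - norm z)"
    using sums_unique[OF g] by simp
qed

lemma polylog_0: "s \<ge> 0 \<Longrightarrow> polylog s 0 = 0"
  using polylog_series_sums(2)[of s 0] by simp

lemma holomorphic_polylog:
  assumes "s \<ge> 0"
  shows "polylog s holomorphic_on ball 0 1"
proof (rule power_series_holomorphic)
  fix w :: complex assume w: "w \<in> ball 0 1"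
  let ?a = "\<lambda>n. if n = 0 then 0 else 1 / complex_of_real (real n powr s)"
  have "(\<lambda>k. ?a (Suc k) * w ^ Suc k) sums polylog s w"
    using polylog_series_sums(1)[OF assms, of w] w by simp
  then have "(\<lambda>k. ?a k * w ^ k) sums (polylog s w + ?a 0 * w ^ 0)"
    by (subst (asm) sums_Suc_iff) simp
  then show "(\<lambda>k. ?a k * (w - 0) ^ k) sums polylog s w" by simp
qed

lemma holomorphic_A1: "A1 holomorphic_on ball 0 1"
  unfolding A1_def by (intro holomorphic_intros holomorphic_polylog) auto

lemma holomorphic_A2: "A2 holomorphic_on ball 0 1"
  unfolding A2_def by (intro holomorphic_intros holomorphic_polylog) auto

lemma holomorphic_A3: "A3 holomorphic_on ball 0 1"
proof -
  have "1 - z \<notin> \<real>\<^sub>\<le>\<^sub>0" if "norm z < 1" for z :: complex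
    using that complex_Re_le_cmod[of z] by (auto simp: complex_nonpos_Reals_iff)
  then show ?thesis unfolding A3_def by (intro holomorphic_intros) auto
qed

text \<open>The quotient in the integrand is literally 0 at y = 0, because division by 0 gives 0.
  This is also the value there of the continuation \<open>?k y * polylog (1/2) y\<close>, so the
  integrand is holomorphic at the origin exactly as written.\<close>

lemma holomorphic_B: "B holomorphic_on ball 0 1"
proof -
  let ?h = "\<lambda>y. (polylog (1/2) y)\<^sup>2 / y"
  let ?k = "\<lambda>y. if y = 0 then deriv (polylog (1/2)) 0 else (polylog (1/2) y - polylog (1/2) 0) / (y - 0)"
  have k: "?k holomorphic_on ball 0 1"
    by (rule pole_theorem_open_0[where g = "polylog (1/2)" and a = 0])
      (auto intro!: holomorphic_polylog simp: polylog_0)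
  have "(\<lambda>y. ?k y * polylog (1/2) y) holomorphic_on ball 0 1"
    using k by (intro holomorphic_on_mult holomorphic_polylog) auto
  then have h: "?h holomorphic_on ball 0 1"
    by (rule holomorphic_transform) (auto simp: polylog_0 power2_eq_square)
  then obtain H where H: "\<And>y. y \<in> ball 0 1 \<Longrightarrow> (H has_field_derivative ?h y) (at y within ball 0 1)"
    using holomorphic_convex_primitive'[of "ball 0 1" ?h] by auto
  have "B z = 1 / (4 * of_real pi) * (H z - H 0)" if z: "z \<in> ball 0 1" for z
  proof -
    have "(?h has_contour_integral H z - H 0) (linepath 0 z)"
      using contour_integral_primitive[OF H, of "linepath 0 z"] z
      by (simp add: closed_segment_subset)
    then show ?thesis unfolding B_def by (simp add: contour_integral_unique)
  qed
  moreover have "H holomorphic_on ball 0 1"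
    using H unfolding holomorphic_on_def field_differentiable_def by blast
  then have "(\<lambda>z. 1 / (4 * of_real pi) * (H z - H 0)) holomorphic_on ball 0 1"
    by (intro holomorphic_intros) auto
  ultimately show ?thesis by (intro holomorphic_transform[of "\<lambda>z. 1 / (4 * of_real pi) * (H z - H 0)" "ball 0 1" B]) simp_all
qed

lemma A_B_0: "A1 0 = 0" "A2 0 = 0" "A3 0 = 0" "B 0 = 0"
  by (simp_all add: A1_def A2_def A3_def B_def polylog_0)

text \<open>The mean value inequality, with the derivative bounded on the compact disc of radius
  1/2. This is what makes the prefactor exponentially close to 1 on a small circle.\<close>

lemma holomorphic_linear_bound:
  assumes "f holomorphic_on ball 0 1" "f 0 = 0"
  shows "\<exists>C\<ge>0. \<forall>z. norm z \<le> 1/2 \<longrightarrow> norm (f z) \<le> C * norm z"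
proof -
  have "deriv f holomorphic_on ball 0 1" using assms by (intro holomorphic_deriv) auto
  then have "continuous_on (cball 0 (1/2)) (deriv f)"
    by (intro holomorphic_on_imp_continuous_on) (auto elim!: holomorphic_on_subset)
  then have "bounded (deriv f ` cball 0 (1/2))"
    by (intro compact_imp_bounded compact_continuous_image) auto
  then obtain C where "C > 0" "\<forall>y\<in>deriv f ` cball 0 (1/2). norm y \<le> C"
    using bounded_pos by blast
  then have C: "\<And>z. z \<in> cball 0 (1/2) \<Longrightarrow> norm (deriv f z) \<le> C" "C > 0" by auto
  have "norm (f z) \<le> C * norm z" if "norm z \<le> 1/2" for z
  proof -
    have "norm (f z - f 0) \<le> C * norm (z - 0)"
    proof (rule field_differentiable_bound[of "cball 0 (1/2)"])
      fix u :: complex assume u: "u \<in> cball 0 (1/2)"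
      then show "(f has_field_derivative deriv f u) (at u within cball 0 (1/2))"
        by (intro DERIV_subset[OF holomorphic_derivI[OF assms(1)]]) auto
    qed (use C that in auto)
    then show ?thesis using assms by simp
  qed
  then show ?thesis using C by (intro exI[of _ C]) auto
qed

section \<open>The function Q on the sector\<close>

lemma norm_exp_neg_half_square: "norm (exp (- \<xi>\<^sup>2 / 2)) = exp (- Re (\<xi>\<^sup>2) / 2)"
  by (simp add: norm_exp_eq_Re)

text \<open>Re ((\<xi> - t)^2) = Re (\<xi>^2) + t^2 - 2 t Re \<xi>, and Re \<xi> < 0 makes the mixed
  term nonnegative. So moving left along the ray gains a Gaussian factor in t on top of r.\<close>

lemma norm_polylog_shifted_le:
  assumes \<xi>: "Re \<xi> < 0" "Re (\<xi>\<^sup>2) > 0" and t: "t \<ge> 0"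
  defines "r \<equiv> norm (exp (- \<xi>\<^sup>2 / 2))"
  shows "norm (exp (- (\<xi> - of_real t)\<^sup>2 / 2)) < 1"
    and "norm (polylog (1/2) (exp (- (\<xi> - of_real t)\<^sup>2 / 2))) \<le> r / (1 - r) * exp (- t\<^sup>2 / 2)"
proof -
  let ?y = "exp (- (\<xi> - of_real t)\<^sup>2 / 2)"
  have e: "Re ((\<xi> - of_real t)\<^sup>2) = Re (\<xi>\<^sup>2) + t\<^sup>2 - 2 * t * Re \<xi>"
    by (simp add: power2_eq_square algebra_simps)
  have tr: "t * Re \<xi> \<le> 0" using t \<xi> by (simp add: mult_nonneg_nonpos)
  have r: "0 < r" "r < 1" using \<xi> by (auto simp: r_def norm_exp_eq_Re)
  have "norm ?y \<le> exp (- Re (\<xi>\<^sup>2) / 2 - t\<^sup>2 / 2)"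
    unfolding norm_exp_neg_half_square e using tr by simp
  also have "\<dots> = r * exp (- t\<^sup>2 / 2)"
    unfolding r_def norm_exp_neg_half_square by (simp add: exp_add[symmetric])
  finally have y: "norm ?y \<le> r * exp (- t\<^sup>2 / 2)" .
  also have "\<dots> \<le> r * 1" using r by (intro mult_left_mono) auto
  finally have y': "norm ?y \<le> r" by simp
  then show y1: "norm ?y < 1" using r by linarith
  have "norm (polylog (1/2) ?y) \<le> norm ?y / (1 - norm ?y)"
    by (rule polylog_series_sums(2)) (use y1 in auto)
  also have "\<dots> \<le> (r * exp (- t\<^sup>2 / 2)) / (1 - r)"
    using y y' r by (intro frac_le) auto
  finally show "norm (polylog (1/2) ?y) \<le> r / (1 - r) * exp (- t\<^sup>2 / 2)" by simp
qed

text \<open>The sector 3 pi/4 < arg \<xi> < 5 pi/4 in algebraic form: the part of the left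
  half-plane where |exp(-\<xi>^2/2)| < 1.\<close>

definition Q_domain :: "complex set"
  where "Q_domain = {\<xi>. Re \<xi> < 0 \<and> Re (\<xi>\<^sup>2) > 0}"

lemma measurable_Q_integrand:
  assumes "\<xi> \<in> Q_domain"
  shows "(\<lambda>t. indicat_real {0..} t *\<^sub>R polylog (1/2) (exp (- (\<xi> - of_real t)\<^sup>2 / 2))) \<in> borel_measurable borel"
proof (rule borel_measurable_continuous_on_indicator)
  have "continuous_on (ball 0 1) (polylog (1/2))"
    by (intro holomorphic_on_imp_continuous_on holomorphic_polylog) auto
  then show "continuous_on {0..} (\<lambda>t. polylog (1/2) (exp (- (\<xi> - of_real t)\<^sup>2 / 2)))"
    by (rule continuous_on_compose2)
      (use norm_polylog_shifted_le(1) assms in \<open>auto simp: Q_domain_def intro!: continuous_intros\<close>)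
qed auto

text \<open>The factor 2 is sqrt(2/pi) times the Gaussian integral sqrt(2 pi).\<close>

lemma norm_Q_le:
  assumes "\<xi> \<in> Q_domain"
  defines "r \<equiv> norm (exp (- \<xi>\<^sup>2 / 2))"
  shows "norm (Q \<xi>) \<le> 2 * (r / (1 - r))"
proof -
  have r: "0 < r" "r < 1" using assms by (auto simp: r_def norm_exp_eq_Re Q_domain_def)
  let ?f = "\<lambda>t. indicat_real {0..} t *\<^sub>R polylog (1/2) (exp (- (\<xi> - of_real t)\<^sup>2 / 2))"
  have g: "has_bochner_integral lborel (\<lambda>t. r / (1 - r) * exp (- (1/2) * t\<^sup>2)) (r / (1 - r) * sqrt (pi / (1/2)))"
    using r by (intro has_bochner_integral_mult_right has_bochner_integral_gaussian) auto
  have gi: "integrable lborel (\<lambda>t. r / (1 - r) * exp (- (1/2) * t\<^sup>2))"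
    using g has_bochner_integral_iff by blast
  have b: "norm (?f t) \<le> r / (1 - r) * exp (- (1/2) * t\<^sup>2)" for t
    using norm_polylog_shifted_le(2)[of \<xi> t] assms r by (cases "t \<ge> 0") (auto simp: Q_domain_def)
  have "norm (integral\<^sup>L lborel ?f) \<le> (LINT t|lborel. r / (1 - r) * exp (- (1/2) * t\<^sup>2))"
    by (rule norm_LINT_le[OF gi]) (use b in auto)
  also have "\<dots> = r / (1 - r) * sqrt (pi / (1/2))" using g by (rule has_bochner_integral_integral_eq)
  finally have "norm (Q \<xi>) \<le> sqrt (2 / pi) * (r / (1 - r) * sqrt (pi / (1/2)))"
    unfolding Q_def set_lebesgue_integral_def norm_mult by (intro mult_mono) auto
  also have "\<dots> = 2 * (r / (1 - r))" 
    by (simp add: real_sqrt_divide real_sqrt_mult field_simps)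
  finally show ?thesis .
qed

text \<open>The Gaussian majorant carries r/(1 - r), which is unbounded at the edges of the sector.
  Hence the exhaustion by the sets Re (\<xi>^2) > d, on each of which the modulus stays below
  exp(-d/2).\<close>

lemma holomorphic_Q: "Q holomorphic_on Q_domain"
proof -
  have "Q holomorphic_on {\<xi>. Re \<xi> < 0 \<and> Re (\<xi>\<^sup>2) > d}" if d: "d > 0" for d
  proof -
    let ?S = "{\<xi>. Re \<xi> < 0 \<and> Re (\<xi>\<^sup>2) > d}"
    define r where "r = exp (- d / 2)"
    have r: "0 \<le> r" "r < 1" using d by (simp_all add: r_def)
    have "(\<lambda>\<xi>. LINT t|lborel. indicat_real {0..} t *\<^sub>R polylog (1/2) (exp (- (\<xi> - of_real t)\<^sup>2 / 2))) holomorphic_on ?S"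
    proof (rule holomorphic_on_lebesgue_integral)
      show "open ?S"
        by (intro open_Collect_conj open_Collect_less continuous_intros)
      show "integrable lborel (\<lambda>t. r / (1 - r) * exp (- (1/2) * t\<^sup>2))"
        using has_bochner_integral_gaussian[of "1/2"]
        by (intro integrable_mult_right) (auto simp: has_bochner_integral_iff)
      show "(\<lambda>t. indicat_real {0..} t *\<^sub>R polylog (1/2) (exp (- (\<xi> - of_real t)\<^sup>2 / 2))) \<in> borel_measurable lborel"
        if "\<xi> \<in> ?S" for \<xi> using measurable_Q_integrand[of \<xi>] that d by (simp add: Q_domain_def)
    next
      fix t :: real
      show "(\<lambda>\<xi>. indicat_real {0..} t *\<^sub>R polylog (1/2) (exp (- (\<xi> - of_real t)\<^sup>2 / 2))) holomorphic_on ?S"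
      proof (cases "t \<ge> 0")
        case True
        have "(polylog (1/2) \<circ> (\<lambda>\<xi>. exp (- (\<xi> - of_real t)\<^sup>2 / 2))) holomorphic_on ?S"
        proof (rule holomorphic_on_compose_gen[where t = "ball 0 1"])
          show "(\<lambda>\<xi>. exp (- (\<xi> - of_real t)\<^sup>2 / 2)) holomorphic_on ?S"
            by (intro holomorphic_intros) auto
          show "(\<lambda>\<xi>. exp (- (\<xi> - of_real t)\<^sup>2 / 2)) ` ?S \<subseteq> ball 0 1"
            using norm_polylog_shifted_le(1)[OF _ _ True] d by (fastforce simp: image_subset_iff)
        qed (auto intro: holomorphic_polylog)
        then show ?thesis using True by (simp add: comp_def)
      qed auto
    next
      fix t :: real and \<xi> :: complex assume \<xi>: "\<xi> \<in> ?S"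
      let ?r = "norm (exp (- \<xi>\<^sup>2 / 2))"
      have "?r \<le> r" using \<xi> by (simp add: r_def norm_exp_eq_Re)
      then have "?r / (1 - ?r) \<le> r / (1 - r)" using r by (intro frac_le) auto
      then have "?r / (1 - ?r) * exp (- t\<^sup>2 / 2) \<le> r / (1 - r) * exp (- t\<^sup>2 / 2)"
        by (intro mult_right_mono) auto
      then show "norm (indicat_real {0..} t *\<^sub>R polylog (1/2) (exp (- (\<xi> - of_real t)\<^sup>2 / 2)))
          \<le> r / (1 - r) * exp (- (1/2) * t\<^sup>2)"
        using norm_polylog_shifted_le(2)[of \<xi> t] \<xi> d r
        by (cases "t \<ge> 0") (auto intro!: divide_nonneg_nonneg mult_nonneg_nonneg)
    qed
    then show ?thesis
      unfolding Q_def set_lebesgue_integral_def by (intro holomorphic_intros)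
  qed
  note * = this
  have op: "open {\<xi>. Re \<xi> < 0 \<and> Re (\<xi>\<^sup>2) > d}" for d
    by (intro open_Collect_conj open_Collect_less continuous_intros)
  have "Q field_differentiable (at \<xi>)" if "\<xi> \<in> Q_domain" for \<xi>
    using holomorphic_on_imp_differentiable_at[OF *[of "Re (\<xi>\<^sup>2) / 2"] op] that
    by (auto simp: Q_domain_def)
  then show ?thesis
    by (simp add: holomorphic_on_def field_differentiable_at_within)
qed

section \<open>The Airy function and the GOE distribution\<close>

lemma set_integral_tendsto_integral:
  fixes f :: "real \<Rightarrow> 'b::{banach,second_countable_topology}"
  assumes f: "integrable lborel f"
    and u: "filterlim u at_bot sequentially" and v: "filterlim v at_top sequentially"
  shows "(\<lambda>n. LINT t:{u n..v n}|lborel. f t) \<longlonglongrightarrow> integral\<^sup>L lborel f"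
  unfolding set_lebesgue_integral_def
proof (rule integral_dominated_convergence[where w = "\<lambda>t. norm (f t)"])
  have "(\<lambda>n. indicat_real {u n..v n} t *\<^sub>R f t) \<longlonglongrightarrow> f t" for t
  proof (rule tendsto_eventually)
    have "eventually (\<lambda>n. u n \<le> t) sequentially" "eventually (\<lambda>n. v n \<ge> t) sequentially"
      using u v by (auto simp: filterlim_at_bot filterlim_at_top)
    then show "eventually (\<lambda>n. indicat_real {u n..v n} t *\<^sub>R f t = f t) sequentially"
      by eventually_elim auto
  qed
  then show "AE t in lborel. (\<lambda>n. indicat_real {u n..v n} t *\<^sub>R f t) \<longlonglongrightarrow> f t" by simp
qed (use f in \<open>auto simp: indicator_def\<close>)

lemma has_vector_derivative_Complex:
  "((\<lambda>y. Complex c y) has_vector_derivative \<i>) (at y within S)"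
proof -
  have "((\<lambda>y. of_real c + \<i> * of_real y) has_vector_derivative 0 + \<i> * 1) (at y within S)"
    by (intro derivative_intros) (simp add: has_vector_derivative_def scaleR_conv_of_real has_derivative_of_real)
  then show ?thesis by (simp add: Complex_eq)
qed

lemma continuous_on_Complex [continuous_intros]:
  "continuous_on S f \<Longrightarrow> continuous_on S g \<Longrightarrow> continuous_on S (\<lambda>x. Complex (f x) (g x))"
  unfolding Complex_eq by (intro continuous_intros)

text \<open>Arbitrary sequences of end points are allowed because for the trace term the ends are
  the heights at which the hyperbola is cut.\<close>

lemma vertical_integral_primitive:
  fixes g G :: "complex \<Rightarrow> complex"
  assumes G: "\<And>y. (G has_field_derivative g (Complex c y)) (at (Complex c y))"
    and int: "integrable lborel (\<lambda>y. g (Complex c y))"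
    and u: "filterlim u at_bot sequentially" and v: "filterlim v at_top sequentially"
  shows "(\<lambda>n. - \<i> * (G (Complex c (v n)) - G (Complex c (u n)))) \<longlonglongrightarrow> (LINT y|lborel. g (Complex c y))"
proof (rule Lim_transform_eventually[OF set_integral_tendsto_integral[OF int u v]])
  have "eventually (\<lambda>n. u n \<le> 0) sequentially" "eventually (\<lambda>n. v n \<ge> 0) sequentially"
    using u v by (auto simp: filterlim_at_bot filterlim_at_top)
  then show "eventually (\<lambda>n. (LINT y:{u n..v n}|lborel. g (Complex c y)) =
      - \<i> * (G (Complex c (v n)) - G (Complex c (u n)))) sequentially"
  proof eventually_elim
    case (elim n)
    have "((\<lambda>y. g (Complex c y)) has_integral (- \<i> * G (Complex c (v n)) - (- \<i> * G (Complex c (u n))))) {u n..v n}"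
    proof (rule fundamental_theorem_of_calculus)
      fix y assume "y \<in> {u n..v n}"
      have "(G \<circ> (\<lambda>y. Complex c y) has_vector_derivative \<i> * g (Complex c y)) (at y within {u n..v n})"
        by (rule field_vector_diff_chain_within[OF has_vector_derivative_Complex has_field_derivative_at_within[OF G]])
      from has_vector_derivative_mult_right[OF this, of "- \<i>"]
      show "((\<lambda>y. - \<i> * G (Complex c y)) has_vector_derivative g (Complex c y)) (at y within {u n..v n})"
        by (simp add: comp_def mult.assoc[symmetric])
    qed (use elim in auto)
    moreover have "set_integrable lborel {u n..v n} (\<lambda>y. g (Complex c y))"
      unfolding set_integrable_def by (rule integrable_mult_indicator[OF _ int]) auto
    ultimately show ?case
      by (simp add: set_borel_integral_eq_integral(2) integral_unique algebra_simps)
  qed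
qed

text \<open>The gauge integral on a half-line already includes the improper one, so convergence of
  the truncations suffices. The Airy integrand is not absolutely integrable.\<close>

lemma has_integral_atLeast_limit:
  fixes f :: "real \<Rightarrow> real"
  assumes f: "continuous_on {a..} f" and lim: "((\<lambda>T. integral {a..T} f) \<longlongrightarrow> l) at_top"
  shows "(f has_integral l) {a..}"
  unfolding has_integral_alt'
proof (intro conjI allI impI)
  fix c d :: real
  have "f integrable_on {max a c..d}"
    by (rule integrable_continuous_real) (auto intro: continuous_on_subset[OF f])
  moreover have "{a..} \<inter> cbox c d = {max a c..d}" by auto
  ultimately show "(\<lambda>x. if x \<in> {a..} then f x else 0) integrable_on cbox c d"
    by (simp only: integrable_restrict_Int)
next
  fix e :: real assume "e > 0"
  then have "eventually (\<lambda>T. dist (integral {a..T} f) l < e) at_top"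
    using lim by (auto simp: tendsto_iff)
  then obtain T0 where T0: "\<And>T. T \<ge> T0 \<Longrightarrow> dist (integral {a..T} f) l < e"
    by (auto simp: eventually_at_top_linorder)
  define R where "R = max 1 (max (\<bar>a\<bar>) T0) + 1"
  show "\<exists>B>0. \<forall>c d. ball 0 B \<subseteq> cbox c d \<longrightarrow>
      norm (integral (cbox c d) (\<lambda>x. if x \<in> {a..} then f x else 0) - l) < e"
  proof (intro exI[of _ R] conjI allI impI)
    fix c d :: real assume sub: "ball 0 R \<subseteq> cbox c d"
    have "max (\<bar>a\<bar>) T0 \<in> ball 0 R" "- \<bar>a\<bar> \<in> ball 0 R" by (auto simp: R_def)
    then have "max \<bar>a\<bar> T0 \<in> cbox c d" "- \<bar>a\<bar> \<in> cbox c d" using sub by blast+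
    then have "T0 \<le> d" "c \<le> a" by auto
    then have "{a..} \<inter> cbox c d = {a..d}" by auto
    then show "norm (integral (cbox c d) (\<lambda>x. if x \<in> {a..} then f x else 0) - l) < e"
      using T0[OF \<open>T0 \<le> d\<close>] by (simp only: integral_restrict_Int) (simp add: dist_norm Int_commute)
  qed (auto simp: R_def)
qed

text \<open>The usual Airy integrand exp(\<zeta>^3/3 - s \<zeta>) at \<zeta> = -z. The sign moves
  the contour into the left half-plane, where the points of \<open>S_minus z\<close> lie; at z = i t
  the value is exp(i (t^3/3 + s t)).\<close>

definition airy_kernel :: "real \<Rightarrow> complex \<Rightarrow> complex"
  where "airy_kernel s z = exp (- (z ^ 3) / 3 + of_real s * z)"

lemma holomorphic_airy_kernel [holomorphic_intros]:
  "f holomorphic_on A \<Longrightarrow> (\<lambda>z. airy_kernel s (f z)) holomorphic_on A"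
  unfolding airy_kernel_def by (intro holomorphic_intros) auto

lemma continuous_on_airy_kernel [continuous_intros]:
  "continuous_on A f \<Longrightarrow> continuous_on A (\<lambda>z. airy_kernel s (f z))"
  unfolding airy_kernel_def by (intro continuous_intros) auto

lemma airy_kernel_add: "airy_kernel (s + t) z = airy_kernel s z * exp (of_real t * z)"
  by (simp add: airy_kernel_def exp_add[symmetric] algebra_simps)

lemma norm_airy_kernel:
  "norm (airy_kernel s (Complex (- \<sigma>) y)) = exp (\<sigma> ^ 3 / 3 - s * \<sigma>) * exp (- \<sigma> * y\<^sup>2)"
proof -
  have "Re (- (Complex (- \<sigma>) y ^ 3) / 3 + of_real s * Complex (- \<sigma>) y) = \<sigma> ^ 3 / 3 - s * \<sigma> + - \<sigma> * y\<^sup>2"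
    by (simp add: power3_eq_cube power2_eq_square field_simps)
  then show ?thesis unfolding airy_kernel_def norm_exp_eq_Re exp_add[symmetric] by simp
qed

lemma integrable_airy_kernel:
  assumes "\<sigma> > 0"
  shows "integrable lborel (\<lambda>y. airy_kernel s (Complex (- \<sigma>) y))"
proof (rule Bochner_Integration.integrable_bound)
  show "integrable lborel (\<lambda>y. exp (\<sigma> ^ 3 / 3 - s * \<sigma>) * exp (- \<sigma> * y\<^sup>2))"
    using has_bochner_integral_gaussian[OF assms] by (intro integrable_mult_right) (auto simp: has_bochner_integral_iff)
  have "continuous_on UNIV (\<lambda>y. airy_kernel s (Complex (- \<sigma>) y))" by (intro continuous_intros)
  then show "(\<lambda>y. airy_kernel s (Complex (- \<sigma>) y)) \<in> borel_measurable lborel"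
    by (simp add: borel_measurable_continuous_onI)
qed (simp add: norm_airy_kernel)

text \<open>
  Near the imaginary axis the kernel has modulus close to 1, so the segment is cut at distance
  \<open>1 / |T|\<close> from the axis: the short piece is estimated by its length, the long one by the decay.
\<close>

lemma airy_kernel_horizontal_bound:
  assumes G: "\<And>z. (G has_field_derivative airy_kernel s z) (at z)"
    and \<sigma>: "\<sigma> > 0" and T: "\<bar>T\<bar> \<ge> 1"
  shows "norm (G (Complex (- \<sigma>) T) - G (Complex 0 T)) \<le> exp (\<sigma> ^ 3 / 3 + \<bar>s\<bar> * \<sigma>) * (1 / \<bar>T\<bar> + \<sigma> * exp (- \<bar>T\<bar>))"
proof -
  define d where "d = min \<sigma> (1 / \<bar>T\<bar>)"
  let ?C = "exp (\<sigma> ^ 3 / 3 + \<bar>s\<bar> * \<sigma>)"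
  have d: "0 \<le> d" "d \<le> \<sigma>" "d \<le> 1 / \<bar>T\<bar>" using \<sigma> by (auto simp: d_def)
  have seg: "\<exists>c\<in>{a..b}. z = Complex (- c) T" if "z \<in> closed_segment (Complex (- b) T) (Complex (- a) T)" "a \<le> b" for a b z
    using that by (intro bexI[of _ "- Re z"]) (auto simp: closed_segment_same_Im closed_segment_eq_real_ivl complex_eq_iff)
  have K: "norm (airy_kernel s (Complex (- c) T)) \<le> ?C * exp (- c * T\<^sup>2)" if c: "c \<in> {0..\<sigma>}" for c
  proof -
    have "c ^ 3 \<le> \<sigma> ^ 3" using c by (intro power_mono) auto
    moreover have "- s * c \<le> \<bar>s\<bar> * \<sigma>" using c by (intro mult_mono) auto
    ultimately show ?thesis unfolding norm_airy_kernel by (intro mult_right_mono) auto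
  qed
  have "norm (G (Complex (- \<sigma>) T) - G (Complex (- d) T)) \<le> ?C * exp (- \<bar>T\<bar>) * norm (Complex (- \<sigma>) T - Complex (- d) T)"
  proof (cases "d = \<sigma>")
    case False
    show ?thesis
    proof (rule field_differentiable_bound[OF convex_closed_segment has_field_derivative_at_within[OF G]])
      fix z assume "z \<in> closed_segment (Complex (- \<sigma>) T) (Complex (- d) T)"
      then obtain c where c: "c \<in> {d..\<sigma>}" "z = Complex (- c) T" using seg d by blast
      have "c \<ge> 1 / \<bar>T\<bar>" using c False by (auto simp: d_def min_def split: if_splits)
      then have "c * T\<^sup>2 \<ge> 1 / \<bar>T\<bar> * T\<^sup>2" by (intro mult_right_mono) auto
      moreover have "1 / r * r\<^sup>2 = r" if "r \<ge> 1" for r :: real using that by (simp add: power2_eq_square)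
      from this[OF T] have "1 / \<bar>T\<bar> * T\<^sup>2 = \<bar>T\<bar>" by (simp only: power2_abs)
      ultimately have "c * T\<^sup>2 \<ge> \<bar>T\<bar>" by simp
      then have "?C * exp (- c * T\<^sup>2) \<le> ?C * exp (- \<bar>T\<bar>)" by (intro mult_left_mono) auto
      moreover have "c \<in> {0..\<sigma>}" using c d by auto
      ultimately show "norm (airy_kernel s z) \<le> ?C * exp (- \<bar>T\<bar>)"
        unfolding c(2) using order_trans[OF K] by blast
    qed auto
  qed auto
  also have "\<dots> \<le> ?C * exp (- \<bar>T\<bar>) * \<sigma>"
    using d \<sigma> by (intro mult_left_mono) (auto simp: cmod_def)
  finally have 1: "norm (G (Complex (- \<sigma>) T) - G (Complex (- d) T)) \<le> ?C * exp (- \<bar>T\<bar>) * \<sigma>" .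
  have "norm (G (Complex (- d) T) - G (Complex (- 0) T)) \<le> ?C * norm (Complex (- d) T - Complex (- 0) T)"
  proof (rule field_differentiable_bound[OF convex_closed_segment has_field_derivative_at_within[OF G]])
    fix z assume "z \<in> closed_segment (Complex (- d) T) (Complex (- 0) T)"
    then obtain c where c: "c \<in> {0..d}" "z = Complex (- c) T" using seg d by blast
    have "?C * exp (- c * T\<^sup>2) \<le> ?C * 1" using c by (intro mult_left_mono) auto
    moreover have "c \<in> {0..\<sigma>}" using c d by auto
    ultimately show "norm (airy_kernel s z) \<le> ?C"
      unfolding c(2) mult_1_right using order_trans[OF K] by blast
  qed auto
  also have "\<dots> \<le> ?C * (1 / \<bar>T\<bar>)"
    using d by (intro mult_left_mono) (auto simp: cmod_def)
  finally have 2: "norm (G (Complex (- d) T) - G (Complex 0 T)) \<le> ?C * (1 / \<bar>T\<bar>)" by simp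
  show ?thesis
    using norm_triangle_ineq[of "G (Complex (- \<sigma>) T) - G (Complex (- d) T)" "G (Complex (- d) T) - G (Complex 0 T)"] 1 2
    by (simp add: algebra_simps)
qed

lemma airy_kernel_horizontal_limit:
  assumes G: "\<And>z. (G has_field_derivative airy_kernel s z) (at z)"
    and \<sigma>: "\<sigma> > 0" and X: "filterlim (\<lambda>n. \<bar>X n\<bar>) at_top F"
  shows "((\<lambda>n. G (Complex (- \<sigma>) (X n)) - G (Complex 0 (X n))) \<longlongrightarrow> 0) F"
proof (rule Lim_null_comparison)
  have "((\<lambda>t::real. exp (\<sigma> ^ 3 / 3 + \<bar>s\<bar> * \<sigma>) * (1 / t + \<sigma> * exp (- t))) \<longlongrightarrow> 0) at_top"
    by real_asymp
  from filterlim_compose[OF this X]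
  show "((\<lambda>n. exp (\<sigma> ^ 3 / 3 + \<bar>s\<bar> * \<sigma>) * (1 / \<bar>X n\<bar> + \<sigma> * exp (- \<bar>X n\<bar>))) \<longlongrightarrow> 0) F" .
  have "eventually (\<lambda>n. \<bar>X n\<bar> \<ge> 1) F" using X by (auto simp: filterlim_at_top)
  then show "eventually (\<lambda>n. norm (G (Complex (- \<sigma>) (X n)) - G (Complex 0 (X n))) \<le>
      exp (\<sigma> ^ 3 / 3 + \<bar>s\<bar> * \<sigma>) * (1 / \<bar>X n\<bar> + \<sigma> * exp (- \<bar>X n\<bar>))) F"
    by eventually_elim (use airy_kernel_horizontal_bound[OF G \<sigma>] in auto)
qed

text \<open>
  Pairing \<open>t\<close> with \<open>- t\<close> turns \<open>2 * cos (t\<^sup>3 / 3 + x * t)\<close> into the derivative of a difference of two values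
  of one primitive, which makes the conditionally convergent integral a limit along the imaginary axis.
\<close>

lemma airy_Ai_eq:
  assumes \<sigma>: "\<sigma> > 0"
  shows "of_real (airy_Ai x) = (LINT y|lborel. airy_kernel x (Complex (- \<sigma>) y)) / (2 * of_real pi)"
proof -
  have "airy_kernel x holomorphic_on UNIV"
    using holomorphic_airy_kernel[OF holomorphic_on_ident, of x UNIV] by simp
  then obtain G where G: "\<And>z. (G has_field_derivative airy_kernel x z) (at z)"
    using holomorphic_convex_primitive'[of UNIV "airy_kernel x"] by auto
  define I where "I = (LINT y|lborel. airy_kernel x (Complex (- \<sigma>) y))"
  define H where "H = (\<lambda>T. - \<i> * (G (Complex 0 T) - G (Complex 0 (- T))))"
  let ?f = "\<lambda>t. cos (t ^ 3 / 3 + x * t)"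
  have H: "((\<lambda>t. of_real (2 * ?f t)) has_integral H T - H 0) {0..T}" if "T \<ge> 0" for T
  proof (rule fundamental_theorem_of_calculus)
    fix t assume t: "t \<in> {0..T}"
    have e: "airy_kernel x (Complex 0 t) + airy_kernel x (Complex 0 (- t)) = of_real (2 * ?f t)"
    proof -
      have "airy_kernel x (Complex 0 r) = cis (r ^ 3 / 3 + x * r)" for r
        unfolding airy_kernel_def cis_conv_exp
        by (rule arg_cong[where f = exp]) (simp add: complex_eq_iff power3_eq_cube)
      moreover have "(- t) ^ 3 / 3 + x * (- t) = - (t ^ 3 / 3 + x * t)" by (simp add: power3_eq_cube)
      ultimately show ?thesis using cos_minus[of "t ^ 3 / 3 + x * t"] sin_minus[of "t ^ 3 / 3 + x * t"] by (simp add: complex_eq_iff)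
    qed
    have "((\<lambda>y. Complex 0 (- y)) has_vector_derivative - \<i>) (at t within {0..T})"
      using has_vector_derivative_minus[OF has_vector_derivative_Complex[of 0 t]] by (simp add: complex_minus)
    then have "(H has_vector_derivative - \<i> * (\<i> * airy_kernel x (Complex 0 t) - (- \<i>) * airy_kernel x (Complex 0 (- t)))) (at t within {0..T})"
      unfolding H_def
      using field_vector_diff_chain_within[OF has_vector_derivative_Complex has_field_derivative_at_within[OF G], of 0 t "{0..T}"]
         field_vector_diff_chain_within[OF _ has_field_derivative_at_within[OF G], of "\<lambda>y. Complex 0 (- y)" "- \<i>" t "{0..T}"]
      by (intro has_vector_derivative_mult_right has_vector_derivative_diff) (simp_all add: comp_def)
    then show "(H has_vector_derivative of_real (2 * ?f t)) (at t within {0..T})"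
      unfolding e[symmetric] by (simp add: algebra_simps)
  qed (use that in auto)
  have H0: "H 0 = 0" by (simp add: H_def)
  have cosint: "?f integrable_on {0..T}" for T
    by (intro integrable_continuous_real continuous_intros) auto
  have Hcos: "H T = of_real (2 * integral {0..T} ?f)" if "T \<ge> 0" for T
  proof -
    have "((\<lambda>t. complex_of_real (2 * ?f t)) has_integral of_real (2 * integral {0..T} ?f)) {0..T}"
      by (intro has_integral_of_real has_integral_mult_right integrable_integral cosint)
    then show ?thesis using has_integral_unique[OF H[OF that]] H0 by auto
  qed
  have "(H \<longlongrightarrow> I) at_top"
  proof (rule tendsto_at_topI_sequentially)
    fix X :: "nat \<Rightarrow> real" assume X: "filterlim X at_top sequentially"
    have X': "filterlim (\<lambda>n. - X n) at_bot sequentially"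
      using X by (simp add: filterlim_uminus_at_top)
    have aX: "filterlim (\<lambda>n. \<bar>X n\<bar>) at_top sequentially" "filterlim (\<lambda>n. \<bar>- X n\<bar>) at_top sequentially"
      using filterlim_compose[OF filterlim_abs_real X] by simp_all
    \<comment> \<open>The segment from -i X to i X is replaced by the parallel one on Re z =
      -\<sigma> and two horizontal connections, whose contributions tend to 0.\<close>
    have "(\<lambda>n. - \<i> * (G (Complex (- \<sigma>) (X n)) - G (Complex (- \<sigma>) (- X n)))
        + \<i> * ((G (Complex (- \<sigma>) (X n)) - G (Complex 0 (X n))) - (G (Complex (- \<sigma>) (- X n)) - G (Complex 0 (- X n))))) \<longlonglongrightarrow> I + \<i> * (0 - 0)"
      unfolding I_def
      by (intro tendsto_intros vertical_integral_primitive[OF G integrable_airy_kernel[OF \<sigma>] X' X]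
          airy_kernel_horizontal_limit[OF G \<sigma>] aX)
    then show "(\<lambda>n. H (X n)) \<longlonglongrightarrow> I" by (simp add: H_def algebra_simps)
  qed
  then have lim: "((\<lambda>T. complex_of_real (2 * integral {0..T} ?f)) \<longlongrightarrow> I) at_top"
    by (rule Lim_transform_eventually) (use Hcos in \<open>auto intro!: eventually_at_top_linorderI[of 0]\<close>)
  from tendsto_Re[OF this] have "((\<lambda>T. 2 * integral {0..T} ?f) \<longlongrightarrow> Re I) at_top" by simp
  then have "((\<lambda>T. 2 * integral {0..T} ?f / 2) \<longlongrightarrow> Re I / 2) at_top" by (intro tendsto_intros) auto
  then have "(?f has_integral Re I / 2) {0..}"
    by (intro has_integral_atLeast_limit continuous_intros) simp_all
  then have "airy_Ai x = Re I / 2 / pi" unfolding airy_Ai_def by (simp add: integral_unique)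
  moreover from tendsto_Im[OF lim] have "Im I = 0"
    using tendsto_unique[of at_top "\<lambda>T. 0::real"] by (simp add: trivial_limit_at_top_linorder tendsto_const_iff)
  ultimately show ?thesis unfolding I_def[symmetric] by (simp add: complex_eq_iff)
qed

section \<open>The trace of the Airy kernel and the GOE tail\<close>

lemma exp_decay_half_line:
  assumes "a > (0::real)"
  shows "set_integrable lborel {0<..} (\<lambda>u. exp (- (a * u)))" "(LINT u:{0<..}|lborel. exp (- (a * u))) = 1 / a"
  using integrable_I0i_exp_mscale[OF assms] LBINT_I0i_exp_mscale[OF assms]
  by (simp_all add: interval_lebesgue_integral_0_infty mult.commute)

lemma LINT_half_line_cexp:
  assumes "Re z < 0"
  shows "(LINT u:{0<..}|lborel. exp (of_real u * z)) = - 1 / z"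
proof -
  have z: "z \<noteq> 0" using assms by auto
  have e: "einterval 0 \<infinity> = {0<..}" by (auto simp: einterval_def)
  have "(LBINT u=0..\<infinity>. exp (of_real u * z)) = 0 - 1 / z"
  proof (rule interval_integral_FTC_integrable)
    fix u :: real
    show "((\<lambda>u. exp (of_real u * z) / z) has_vector_derivative exp (of_real u * z)) (at u)"
      using z by (intro has_vector_derivative_real_field) (auto intro!: derivative_eq_intros)
    show "isCont (\<lambda>u. exp (of_real u * z)) u" by (intro continuous_intros)
  next
    show "set_integrable lborel (einterval 0 \<infinity>) (\<lambda>u. exp (of_real u * z))"
      unfolding e set_integrable_def
    proof (rule Bochner_Integration.integrable_bound)
      show "integrable lborel (\<lambda>u. indicat_real {0<..} u *\<^sub>R exp (- (- Re z * u)))"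
        using exp_decay_half_line(1)[of "- Re z"] assms by (simp add: set_integrable_def)
    qed (auto simp: indicator_def mult.commute)
    have "((\<lambda>u. exp (of_real u * z) / z) \<longlongrightarrow> exp (of_real 0 * z) / z) (at_right 0)"
      by (intro tendsto_intros) (use z in auto)
    then show "(((\<lambda>u. exp (of_real u * z) / z) \<circ> real_of_ereal) \<longlongrightarrow> 1 / z) (at_right 0)"
      by (simp add: ereal_tendsto_simps zero_ereal_def)
    have "((\<lambda>u. exp (of_real u * z) / z) \<longlongrightarrow> 0) at_top"
    proof (rule tendsto_norm_zero_cancel)
      have "((\<lambda>u. exp (u * Re z) / norm z) \<longlongrightarrow> 0) at_top"
        using assms z by real_asymp
      then show "((\<lambda>u. norm (exp (of_real u * z) / z)) \<longlongrightarrow> 0) at_top"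
        by (simp add: norm_divide)
    qed
    then show "(((\<lambda>u. exp (of_real u * z) / z) \<circ> real_of_ereal) \<longlongrightarrow> 0) (at_left \<infinity>)"
      by (simp add: ereal_tendsto_simps)
  qed auto
  then show ?thesis by (simp add: interval_lebesgue_integral_0_infty)
qed

lemma LINT_norm_airy_kernel:
  assumes "\<sigma> > 0"
  shows "(LINT y|lborel. norm (airy_kernel s (Complex (- \<sigma>) y))) = exp (\<sigma> ^ 3 / 3 - s * \<sigma>) * sqrt (pi / \<sigma>)"
  using has_bochner_integral_mult_right[OF has_bochner_integral_gaussian[OF assms], of "exp (\<sigma> ^ 3 / 3 - s * \<sigma>)"]
  by (simp add: norm_airy_kernel has_bochner_integral_iff)

lemma measurable_airy_kernel_Complex [measurable]:
  "(\<lambda>p. airy_kernel (s + 2 * fst p) (Complex (- \<sigma>) (snd p))) \<in> borel_measurable (lborel \<Otimes>\<^sub>M lborel)"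
  unfolding airy_kernel_def Complex_eq by measurable

text \<open>On Re z = -\<sigma> the shift by 2u multiplies the Airy integrand by exp(2 u z), of
  modulus exp(-2 \<sigma> u). This decay justifies Fubini, and the integral over u produces the
  factor -1/(2z).\<close>

lemma airy_trace_eq:
  assumes \<sigma>: "\<sigma> > 0"
  shows "of_real (LINT u:{0<..}|lborel. airy_Ai (s + 2 * u)) =
    (LINT y|lborel. airy_kernel s (Complex (- \<sigma>) y) / (- 2 * Complex (- \<sigma>) y)) / (2 * of_real pi)"
proof -
  define f where "f = (\<lambda>u y. indicat_real {0<..} u *\<^sub>R airy_kernel (s + 2 * u) (Complex (- \<sigma>) y))"
  have int: "integrable (lborel \<Otimes>\<^sub>M lborel) (case_prod f)"
  proof (rule lborel_pair.Fubini_integrable)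
    show "case_prod f \<in> borel_measurable (lborel \<Otimes>\<^sub>M lborel)"
      unfolding f_def case_prod_beta by measurable
    have "(LINT y|lborel. norm (case_prod f (u, y))) =
        (exp (\<sigma> ^ 3 / 3 - s * \<sigma>) * sqrt (pi / \<sigma>)) * (indicat_real {0<..} u *\<^sub>R exp (- (2 * \<sigma> * u)))" for u
      using LINT_norm_airy_kernel[OF \<sigma>, of "s + 2 * u"]
      by (cases "u > 0") (auto simp: f_def exp_add[symmetric] exp_diff field_simps exp_add)
    moreover have "integrable lborel (\<lambda>u. (exp (\<sigma> ^ 3 / 3 - s * \<sigma>) * sqrt (pi / \<sigma>)) * (indicat_real {0<..} u *\<^sub>R exp (- (2 * \<sigma> * u))))"
      using exp_decay_half_line(1)[of "2 * \<sigma>"] \<sigma> unfolding set_integrable_def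
      by (intro integrable_mult_right) auto
    ultimately show "integrable lborel (\<lambda>u. LINT y|lborel. norm (case_prod f (u, y)))" by simp
    show "AE u in lborel. integrable lborel (\<lambda>y. case_prod f (u, y))"
      unfolding f_def using integrable_airy_kernel[OF \<sigma>] by auto
  qed
  have inner: "(LINT u|lborel. f u y) = airy_kernel s (Complex (- \<sigma>) y) / (- 2 * Complex (- \<sigma>) y)" for y
  proof -
    let ?z = "Complex (- \<sigma>) y"
    have "f u y = airy_kernel s ?z * (indicat_real {0<..} u *\<^sub>R exp (of_real u * (2 * ?z)))" for u
      by (simp add: f_def airy_kernel_add mult_ac)
    then have "(LINT u|lborel. f u y) = airy_kernel s ?z * (LINT u:{0<..}|lborel. exp (of_real u * (2 * ?z)))"
      by (simp only: set_lebesgue_integral_def integral_mult_right_zero)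
    also have "\<dots> = airy_kernel s ?z * (- 1 / (2 * ?z))"
      by (subst LINT_half_line_cexp) (use \<sigma> in auto)
    finally show ?thesis by simp
  qed
  have "complex_of_real (LINT u:{0<..}|lborel. airy_Ai (s + 2 * u)) = (LINT u:{0<..}|lborel. complex_of_real (airy_Ai (s + 2 * u)))"
    unfolding set_lebesgue_integral_def
    by (subst integral_complex_of_real[symmetric]) (simp add: scaleR_conv_of_real)
  also have "\<dots> = (LINT u|lborel. (LINT y|lborel. f u y) / (2 * of_real pi))"
    unfolding set_lebesgue_integral_def airy_Ai_eq[OF \<sigma>] f_def
    by (intro Bochner_Integration.integral_cong) (auto simp: indicator_def)
  also have "\<dots> = (LINT u|lborel. (LINT y|lborel. f u y)) / (2 * of_real pi)" by simp
  also have "(LINT u|lborel. (LINT y|lborel. f u y)) = (LINT y|lborel. (LINT u|lborel. f u y))"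
    by (rule lborel_pair.Fubini_integral[OF int, symmetric])
  finally show ?thesis by (simp add: inner)
qed

text \<open>The line Re z = -\<sigma> passes through the saddle point for the parameter \<sigma>^2.
  It is kept for the larger parameter \<sigma>^2 + w: this is not optimal, but the dependence on w
  becomes exp(-w), which splits into row and column factors in the Fredholm determinant.\<close>

lemma abs_airy_Ai_le:
  assumes \<sigma>: "\<sigma> \<ge> 1" and w: "w \<ge> 0"
  shows "\<bar>airy_Ai (\<sigma>\<^sup>2 + w)\<bar> \<le> exp (- 2 / 3 * \<sigma> ^ 3) * exp (- w)"
proof -
  have s0: "\<sigma> > 0" using \<sigma> by simp
  have "\<bar>airy_Ai (\<sigma>\<^sup>2 + w)\<bar> = norm (complex_of_real (airy_Ai (\<sigma>\<^sup>2 + w)))" by simp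
  also have "\<dots> \<le> (LINT y|lborel. norm (airy_kernel (\<sigma>\<^sup>2 + w) (Complex (- \<sigma>) y))) / (2 * pi)"
    unfolding airy_Ai_eq[OF s0] by (simp add: norm_divide divide_right_mono)
  also have "\<dots> = exp (\<sigma> ^ 3 / 3 - (\<sigma>\<^sup>2 + w) * \<sigma>) * (sqrt (pi / \<sigma>) / (2 * pi))"
    by (simp add: LINT_norm_airy_kernel[OF s0])
  also have "\<dots> \<le> exp (- 2 / 3 * \<sigma> ^ 3 + - w) * 1"
  proof (intro mult_mono)
    have "w * 1 \<le> w * \<sigma>" using w \<sigma> by (intro mult_left_mono) auto
    then show "exp (\<sigma> ^ 3 / 3 - (\<sigma>\<^sup>2 + w) * \<sigma>) \<le> exp (- 2 / 3 * \<sigma> ^ 3 + - w)"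
      by (simp add: algebra_simps power2_eq_square power3_eq_cube)
    have "pi / \<sigma> \<le> pi / 1" using \<sigma> by (intro divide_left_mono) auto
    also have "\<dots> \<le> (2 * pi)\<^sup>2" using pi_gt3 by (auto simp: power2_eq_square)
    finally have "sqrt (pi / \<sigma>) \<le> 2 * pi" by (intro real_le_lsqrt) auto
    then show "sqrt (pi / \<sigma>) / (2 * pi) \<le> 1" by (simp add: divide_le_eq)
  qed (use s0 in auto)
  finally show ?thesis by (simp only: exp_add mult_1_right)
qed

lemma measurable_airy_Ai [measurable]: "airy_Ai \<in> borel_measurable borel"
proof -
  have "(\<lambda>p. airy_kernel (fst p) (Complex (- 1) (snd p))) \<in> borel_measurable (borel \<Otimes>\<^sub>M lborel)"
    unfolding airy_kernel_def Complex_eq by measurable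
  then have "(\<lambda>x. LINT y|lborel. airy_kernel x (Complex (- 1) y)) \<in> borel_measurable borel"
    by (intro lborel.borel_measurable_lebesgue_integral) (simp add: case_prod_beta)
  then have "(\<lambda>x. Re ((LINT y|lborel. airy_kernel x (Complex (- 1) y)) / (2 * of_real pi))) \<in> borel_measurable borel"
    by measurable
  moreover have "airy_Ai = (\<lambda>x. Re ((LINT y|lborel. airy_kernel x (Complex (- 1) y)) / (2 * of_real pi)))"
  proof
    have "(0::real) < 1" by simp
    from airy_Ai_eq[OF this] show "airy_Ai x = Re ((LINT y|lborel. airy_kernel x (Complex (- 1) y)) / (2 * of_real pi))" for x
      by (metis Re_complex_of_real)
  qed
  ultimately show ?thesis by (simp only:)
qed

text \<open>Division by n! leaves terms of size at most q^n, so those from n = 2 on sum to at most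
  q^2/(1 - q). Both determinants are compared with their traces in this way; only the origin of q
  differs.\<close>

lemma fredholm_det_approx:
  fixes K :: "'a \<Rightarrow> 'a \<Rightarrow> 'b::{real_normed_field,banach,second_countable_topology}"
  assumes "sigma_finite_measure M" and meas: "(\<lambda>x. K x x) \<in> borel_measurable M"
    and bound: "\<And>n. norm (LINT v|Pi\<^sub>M {..<n} (\<lambda>_. M). Determinant.det (Matrix.mat n n (\<lambda>(i, j). K (v i) (v j)))) \<le> fact n * q ^ n"
    and q: "0 \<le> q" "q \<le> 1 / 2"
  shows "norm (fredholm_det M K - (1 - (LINT x|M. K x x))) \<le> 2 * q\<^sup>2"
proof -
  interpret sigma_finite_measure M by fact
  interpret product_sigma_finite "\<lambda>_. M" by standard
  define T where "T n = (- 1) ^ n / fact n * (LINT v|Pi\<^sub>M {..<n} (\<lambda>_. M). Determinant.det (Matrix.mat n n (\<lambda>(i, j). K (v i) (v j))))" for n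
  have T: "norm (T n) \<le> q ^ n" for n
    using bound[of n] by (simp add: T_def norm_mult norm_divide norm_power divide_le_eq mult.commute)
  have g: "(\<lambda>n. q\<^sup>2 * q ^ n) sums (q\<^sup>2 * (1 / (1 - q)))"
    using q by (intro sums_mult geometric_sums) auto
  have T2: "norm (T (n + 2)) \<le> q\<^sup>2 * q ^ n" for n
    using T[of "n + 2"] by (simp add: power_add power2_eq_square mult_ac)
  have sT: "summable T"
    by (rule summable_comparison_test'[OF summable_geometric, of q _ T]) (use q T in auto)
  \<comment> \<open>The empty matrix has determinant 1 and the empty product measure has mass
    1.\<close>
  have "T 0 = 1" by (simp add: T_def PiM_empty det_dim_zero lebesgue_integral_count_space_finite)
  moreover have "T 1 = - (LINT x|M. K x x)"
  proof -
    have "{..<1::nat} = {0}" by auto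
    then show ?thesis using product_integral_singleton[of "\<lambda>x. K x x" 0] meas
      by (simp add: T_def det_single)
  qed
  moreover have "(\<Sum>n. T n) = (\<Sum>n. T (n + 2)) + (T 0 + T 1)"
    using suminf_split_initial_segment[OF sT, of 2] by (simp add: numeral_2_eq_2)
  ultimately have "fredholm_det M K - (1 - (LINT x|M. K x x)) = (\<Sum>n. T (n + 2))"
    unfolding fredholm_det_def T_def[symmetric] by simp
  also have "norm \<dots> \<le> (\<Sum>n. q\<^sup>2 * q ^ n)"
    by (rule norm_suminf_le[OF T2 sums_summable[OF g]])
  also have "\<dots> = q\<^sup>2 * (1 / (1 - q))" using sums_unique[OF g] by simp
  also have "\<dots> \<le> q\<^sup>2 * 2" using q by (intro mult_left_mono) (auto simp: divide_le_eq)
  finally show ?thesis by simp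
qed

text \<open>The pointwise bound of the kernel splits as m exp(-s) exp(-t), and exp(-2u) integrates
  to 1/2 over the half-line. So q = m/2, and the error 2 q^2 is half of m^2 = exp(-(4/3)
  \<sigma>^3).\<close>

lemma F_GOE_approx:
  assumes \<sigma>: "\<sigma> \<ge> 1"
  shows "\<bar>F_GOE (\<sigma>\<^sup>2) - (1 - (LINT u:{0<..}|lborel. airy_Ai (\<sigma>\<^sup>2 + 2 * u)))\<bar> \<le> exp (- 4 / 3 * \<sigma> ^ 3)"
proof -
  let ?M = "restrict_space lborel {0<..} :: real measure"
  let ?K = "\<lambda>s t. airy_Ai (s + \<sigma>\<^sup>2 + t)"
  define m where "m = exp (- 2 / 3 * \<sigma> ^ 3)"
  have m: "0 \<le> m" "m \<le> 1" using \<sigma> by (auto simp: m_def)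
  have sf: "sigma_finite_measure ?M"
    by (rule sigma_finite_measure_restrict_space) (auto intro: lborel.sigma_finite_measure_axioms)
  have gi: "integrable ?M (\<lambda>u. exp (- (2 * u)))" and ge: "integral\<^sup>L ?M (\<lambda>u. exp (- (2 * u))) = 1 / 2"
    using exp_decay_half_line[of 2]
    by (simp_all add: integrable_restrict_space set_integrable_def set_lebesgue_integral_def integral_restrict_space)
  have "norm (fredholm_det ?M ?K - (1 - (LINT x|?M. ?K x x))) \<le> 2 * (m / 2)\<^sup>2"
  proof (rule fredholm_det_approx[OF sf])
    show "(\<lambda>x. ?K x x) \<in> borel_measurable ?M"
      by (rule measurable_restrict_space1) measurable
    fix n
    have "norm (LINT v|Pi\<^sub>M {..<n} (\<lambda>_. ?M). Determinant.det (Matrix.mat n n (\<lambda>(i, j). ?K (v i) (v j))))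
        \<le> (fact n * m ^ n) * (integral\<^sup>L ?M (\<lambda>u. exp (- (2 * u)))) ^ n"
    proof (rule norm_LINT_PiM_le[OF sf gi])
      fix v assume v: "v \<in> space (Pi\<^sub>M {..<n} (\<lambda>_. ?M))"
      then have v: "v i > 0" if "i < n" for i using that by (auto simp: space_PiM PiE_iff space_restrict_space)
      have "norm (Determinant.det (Matrix.mat n n (\<lambda>(i, j). ?K (v i) (v j)))) \<le>
          fact n * ((\<Prod>i<n. m * exp (- v i)) * (\<Prod>i<n. exp (- v i)))"
      proof (rule norm_det_mat_le)
        fix i j assume "i < n" "j < n"
        then have "0 \<le> v i + v j" using v by (simp add: less_imp_le)
        moreover have "v i + \<sigma>\<^sup>2 + v j = \<sigma>\<^sup>2 + (v i + v j)" by simp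
        moreover have "m * exp (- v i) * exp (- v j) = exp (- 2 / 3 * \<sigma> ^ 3) * exp (- (v i + v j))"
          using exp_add[of "- v i" "- v j"] by (simp add: m_def)
        ultimately show "norm (?K (v i) (v j)) \<le> m * exp (- v i) * exp (- v j)"
          using abs_airy_Ai_le[OF \<sigma>, of "v i + v j"] by (simp only: real_norm_def)
      qed
      also have "(\<Prod>i<n. m * exp (- v i)) * (\<Prod>i<n. exp (- v i)) = (\<Prod>i<n. m * exp (- (2 * v i)))"
        unfolding prod.distrib[symmetric] by (intro prod.cong refl) (simp add: mult.assoc flip: exp_add)
      also have "\<dots> = m ^ n * (\<Prod>i<n. exp (- (2 * v i)))" by (simp add: prod.distrib)
      finally show "norm (Determinant.det (Matrix.mat n n (\<lambda>(i, j). ?K (v i) (v j)))) \<le>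
          fact n * m ^ n * (\<Prod>i<n. exp (- (2 * v i)))" by simp
    qed
    then show "norm (LINT v|Pi\<^sub>M {..<n} (\<lambda>_. ?M). Determinant.det (Matrix.mat n n (\<lambda>(i, j). ?K (v i) (v j))))
        \<le> fact n * (m / 2) ^ n"
      by (simp add: ge power_divide)
  qed (use m in auto)
  also have "\<dots> \<le> m\<^sup>2" by (simp add: power2_eq_square)
  also have "\<dots> = exp (- 4 / 3 * \<sigma> ^ 3)"
    by (simp add: m_def power2_eq_square exp_add[symmetric])
  finally have "\<bar>F_GOE (\<sigma>\<^sup>2) - (1 - (LINT x|?M. ?K x x))\<bar> \<le> exp (- 4 / 3 * \<sigma> ^ 3)"
    unfolding F_GOE_def real_norm_def .
  moreover have "(\<lambda>x. ?K x x) = (\<lambda>u. airy_Ai (\<sigma>\<^sup>2 + 2 * u))" by (auto simp: algebra_simps)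
  ultimately have "\<bar>F_GOE (\<sigma>\<^sup>2) - (1 - (LINT u|?M. airy_Ai (\<sigma>\<^sup>2 + 2 * u)))\<bar> \<le> exp (- 4 / 3 * \<sigma> ^ 3)"
    by (simp only:)
  then show ?thesis
    by (simp add: integral_restrict_space set_lebesgue_integral_def)
qed


text \<open>Laplace's method at the saddle -\<sigma>. With \<sigma> = r^2 and y = v/r only integral
  powers of r occur, and the rescaled integral J tends to the Gaussian value sqrt pi. As sqrt pi >
  1, eventually Re J > 1, which leaves a clean constant.\<close>

lemma airy_trace_lower_bound:
  "\<exists>\<sigma>0\<ge>1. \<forall>\<sigma>\<ge>\<sigma>0. exp (- 2 / 3 * \<sigma> ^ 3) / (4 * pi * \<sigma>\<^sup>2) \<le> (LINT u:{0<..}|lborel. airy_Ai (\<sigma>\<^sup>2 + 2 * u))"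
proof -
  define J where "J = (\<lambda>r. LINT v|lborel. exp (Complex (- v\<^sup>2) (v ^ 3 / (3 * r ^ 3))) / Complex 1 (- v / r ^ 3))"
  have trace: "of_real (LINT u:{0<..}|lborel. airy_Ai ((r\<^sup>2)\<^sup>2 + 2 * u)) =
      of_real (exp (- 2 / 3 * (r\<^sup>2) ^ 3) / (4 * pi * r ^ 3)) * J r" if r: "r > 0" for r
  proof -
    let ?\<sigma> = "r\<^sup>2"
    have \<sigma>: "?\<sigma> > 0" using r by simp
    have e: "airy_kernel (?\<sigma>\<^sup>2) (Complex (- ?\<sigma>) (v / r)) / (- 2 * Complex (- ?\<sigma>) (v / r)) =
      of_real (exp (- 2 / 3 * ?\<sigma> ^ 3) / (2 * r\<^sup>2)) * (exp (Complex (- v\<^sup>2) (v ^ 3 / (3 * r ^ 3))) / Complex 1 (- v / r ^ 3))" for v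
    proof -
      have "- (Complex (- ?\<sigma>) (v / r) ^ 3) / 3 + of_real (?\<sigma>\<^sup>2) * Complex (- ?\<sigma>) (v / r) =
          of_real (- 2 / 3 * ?\<sigma> ^ 3) + Complex (- v\<^sup>2) (v ^ 3 / (3 * r ^ 3))"
        using r by (simp add: complex_eq_iff power3_eq_cube power2_eq_square field_simps)
      then have "airy_kernel (?\<sigma>\<^sup>2) (Complex (- ?\<sigma>) (v / r)) = of_real (exp (- 2 / 3 * ?\<sigma> ^ 3)) * exp (Complex (- v\<^sup>2) (v ^ 3 / (3 * r ^ 3)))"
        unfolding airy_kernel_def by (simp only: exp_add exp_of_real)
      moreover have "- 2 * Complex (- ?\<sigma>) (v / r) = of_real (2 * r\<^sup>2) * Complex 1 (- v / r ^ 3)"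
        using r by (simp add: complex_eq_iff power3_eq_cube power2_eq_square field_simps)
      ultimately show ?thesis by (simp only: of_real_divide times_divide_times_eq)
    qed
    have "(LINT y|lborel. airy_kernel (?\<sigma>\<^sup>2) (Complex (- ?\<sigma>) y) / (- 2 * Complex (- ?\<sigma>) y)) =
       \<bar>1 / r\<bar> *\<^sub>R (LINT v|lborel. airy_kernel (?\<sigma>\<^sup>2) (Complex (- ?\<sigma>) (0 + 1 / r * v)) / (- 2 * Complex (- ?\<sigma>) (0 + 1 / r * v)))"
      using r by (intro lborel_integral_real_affine) auto
    also have "\<dots> = \<bar>1 / r\<bar> *\<^sub>R (of_real (exp (- 2 / 3 * ?\<sigma> ^ 3) / (2 * r\<^sup>2)) * J r)"
      unfolding J_def by (simp only: add_0 times_divide_eq_left mult_1_left e integral_mult_right_zero)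
    finally show ?thesis unfolding airy_trace_eq[OF \<sigma>]
      using r by (simp add: scaleR_conv_of_real power2_eq_square power3_eq_cube)
  qed
  have "(J \<longlongrightarrow> (LINT v|lborel. complex_of_real (exp (- 1 * v\<^sup>2)))) at_top"
    unfolding J_def
  proof (rule integral_dominated_convergence_at_top)
    show "integrable lborel (\<lambda>v::real. exp (- 1 * v\<^sup>2))"
      using has_bochner_integral_gaussian[of 1] by (simp add: has_bochner_integral_iff)
    show "(\<lambda>v. exp (Complex (- v\<^sup>2) (v ^ 3 / (3 * r ^ 3))) / Complex 1 (- v / r ^ 3)) \<in> borel_measurable lborel" for r
      unfolding Complex_eq by measurable
    have "((\<lambda>r. exp (of_real (- v\<^sup>2) + \<i> * of_real (v ^ 3 / (3 * r ^ 3))) / (of_real 1 + \<i> * of_real (- v / r ^ 3))) \<longlongrightarrow>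
        exp (of_real (- v\<^sup>2) + \<i> * of_real 0) / (of_real 1 + \<i> * of_real 0)) at_top" for v :: real
    proof (intro tendsto_intros)
      show "((\<lambda>r. v ^ 3 / (3 * r ^ 3)) \<longlongrightarrow> 0) at_top" by real_asymp
      show "((\<lambda>r. - v / r ^ 3) \<longlongrightarrow> 0) at_top" by real_asymp
    qed auto
    moreover have "exp (of_real (- v\<^sup>2) + \<i> * of_real 0) / (of_real 1 + \<i> * of_real 0) = complex_of_real (exp (- 1 * v\<^sup>2))" for v :: real
      by (simp add: exp_of_real[symmetric])
    ultimately show "AE v in lborel. ((\<lambda>r. exp (Complex (- v\<^sup>2) (v ^ 3 / (3 * r ^ 3))) / Complex 1 (- v / r ^ 3)) \<longlongrightarrow> complex_of_real (exp (- 1 * v\<^sup>2))) at_top"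
      unfolding Complex_eq by (simp only: of_real_1) simp
    have "norm (exp (Complex (- v\<^sup>2) (v ^ 3 / (3 * r ^ 3))) / Complex 1 (- v / r ^ 3)) \<le> exp (- 1 * v\<^sup>2) / 1" for v r :: real
      unfolding norm_divide norm_exp_eq_Re by (intro frac_le) (auto simp: cmod_def)
    then show "\<forall>\<^sub>F r in at_top. AE v in lborel. norm (exp (Complex (- v\<^sup>2) (v ^ 3 / (3 * r ^ 3))) / Complex 1 (- v / r ^ 3)) \<le> exp (- 1 * v\<^sup>2)"
      by simp
  qed measurable
  also have "(LINT v|lborel. complex_of_real (exp (- 1 * v\<^sup>2))) = of_real (sqrt pi)"
    using has_bochner_integral_gaussian[of 1] by (simp add: has_bochner_integral_iff del: of_real_exp)
  finally have "((\<lambda>r. Re (J r)) \<longlongrightarrow> sqrt pi) at_top"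
    using tendsto_Re by fastforce
  moreover have "1 < sqrt pi" using pi_gt3 by (intro real_less_rsqrt) auto
  ultimately have "eventually (\<lambda>r. Re (J r) > 1) at_top" by (rule order_tendstoD(1))
  then obtain r0 where r0: "\<And>r. r \<ge> r0 \<Longrightarrow> Re (J r) > 1"
    by (auto simp: eventually_at_top_linorder)
  show ?thesis
  proof (intro exI[of _ "(max 1 r0)\<^sup>2"] conjI allI impI)
    show "(max 1 r0)\<^sup>2 \<ge> 1" by (intro one_le_power) auto
    fix \<sigma> assume \<sigma>: "\<sigma> \<ge> (max 1 r0)\<^sup>2"
    define r where "r = sqrt \<sigma>"
    have r: "r \<ge> max 1 r0" unfolding r_def using \<sigma> by (intro real_le_rsqrt)
    then have r1: "r \<ge> 1" "r \<ge> r0" by auto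
    have \<sigma>r: "\<sigma> = r\<^sup>2" unfolding r_def using \<sigma> zero_le_power2[of "max 1 r0"] by (subst real_sqrt_pow2) linarith+
    \<comment> \<open>The true order is r^3, that is \<sigma> to the power 3/2. It is weakened to
      \<sigma>^2 to stay with integral powers; polynomial factors are harmless against the
      exponential gain.\<close>
    have "r ^ 3 \<le> r ^ 4" using r1 by (intro power_increasing) auto
    then have "exp (- 2 / 3 * \<sigma> ^ 3) / (4 * pi * \<sigma>\<^sup>2) \<le> exp (- 2 / 3 * \<sigma> ^ 3) / (4 * pi * r ^ 3)"
      unfolding \<sigma>r using r1 by (intro divide_left_mono mult_left_mono) (auto simp flip: power_mult)
    also have "\<dots> = exp (- 2 / 3 * \<sigma> ^ 3) / (4 * pi * r ^ 3) * 1" by simp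
    also have "\<dots> \<le> exp (- 2 / 3 * \<sigma> ^ 3) / (4 * pi * r ^ 3) * Re (J r)"
      using r0[OF r1(2)] r1 by (intro mult_left_mono) auto
    also have "\<dots> = Re (of_real (LINT u:{0<..}|lborel. airy_Ai (\<sigma>\<^sup>2 + 2 * u)))"
      unfolding \<sigma>r by (subst trace) (use r1 in \<open>auto simp: Re_complex_of_real simp del: of_real_divide of_real_mult\<close>)
    finally show "exp (- 2 / 3 * \<sigma> ^ 3) / (4 * pi * \<sigma>\<^sup>2) \<le> (LINT u:{0<..}|lborel. airy_Ai (\<sigma>\<^sup>2 + 2 * u))"
      by simp
  qed
qed

section \<open>The points of S-minus\<close>

text \<open>
  The points of \<^term>\<open>S_minus (exp w)\<close> are the values of \<open>sqrt_branch\<close> at the logarithms \<open>w + 2 * pi * \<i> * k\<close>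
  of \<open>exp w\<close>. This indexes the sets \<open>S_minus z\<close> holomorphically in \<open>w\<close>.
\<close>

definition sqrt_branch :: "complex \<Rightarrow> complex"
  where "sqrt_branch w = - csqrt (- 2 * w)"

definition log_point :: "complex \<Rightarrow> int \<Rightarrow> complex"
  where "log_point w k = w + of_int k * (2 * of_real pi * \<i>)"

lemma log_point_simps [simp]:
  "Re (log_point w k) = Re w" "Im (log_point w k) = Im w + 2 * pi * of_int k"
  by (simp_all add: log_point_def)

lemma exp_log_point [simp]: "exp (log_point w k) = exp w"
  by (auto simp: exp_eq log_point_def)

lemma sqrt_branch_sq: "(sqrt_branch w)\<^sup>2 = - 2 * w"
  by (simp add: sqrt_branch_def)

lemma Re_sqrt_branch_neg:
  assumes "Re w < 0"
  shows "Re (sqrt_branch w) < 0"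
proof -
  have "Re (csqrt (- 2 * w)) \<noteq> 0"
  proof
    assume "Re (csqrt (- 2 * w)) = 0"
    then have "Re ((csqrt (- 2 * w))\<^sup>2) \<le> 0" by (simp only: power2_eq_square) simp
    then show False using assms by simp
  qed
  then show ?thesis using csqrt_principal[of "- 2 * w"] by (simp add: sqrt_branch_def)
qed

lemma sqrt_branch_in_Q_domain: "Re w < 0 \<Longrightarrow> sqrt_branch w \<in> Q_domain"
  by (simp add: Q_domain_def Re_sqrt_branch_neg sqrt_branch_sq)

lemma sqrt_branch_nz: "Re w < 0 \<Longrightarrow> sqrt_branch w \<noteq> 0"
  using Re_sqrt_branch_neg by force

lemma exp_sqrt_branch: "exp (- (sqrt_branch w)\<^sup>2 / 2) = exp w"
  by (simp add: sqrt_branch_sq)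

lemma sqrt_branch_has_field_derivative:
  assumes "Re w < 0"
  shows "(sqrt_branch has_field_derivative - 1 / sqrt_branch w) (at w)"
proof -
  have "- 2 * w \<notin> \<real>\<^sub>\<le>\<^sub>0" using assms by (auto simp: complex_nonpos_Reals_iff)
  then show ?thesis unfolding sqrt_branch_def
    by (auto intro!: derivative_eq_intros simp: field_simps)
qed

lemma S_minus_exp:
  assumes w: "Re w < 0"
  shows "S_minus (exp w) = range (\<lambda>k. sqrt_branch (log_point w k))"
proof (intro equalityI subsetI)
  fix \<xi> assume "\<xi> \<in> S_minus (exp w)"
  then have \<xi>: "exp (- \<xi>\<^sup>2 / 2) = exp w" "Re \<xi> < 0" by (auto simp: S_minus_def)
  then obtain k :: int where k: "- \<xi>\<^sup>2 / 2 = w + (of_int (2 * k) * pi) * \<i>" by (auto simp: exp_eq)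
  have "log_point w k = - \<xi>\<^sup>2 / 2" unfolding k by (simp add: log_point_def mult_ac)
  then have "- 2 * log_point w k = (- \<xi>)\<^sup>2" by simp
  moreover have "csqrt ((- \<xi>)\<^sup>2) = - \<xi>" by (rule csqrt_square) (use \<xi> in auto)
  ultimately have "sqrt_branch (log_point w k) = \<xi>" by (simp add: sqrt_branch_def)
  then show "\<xi> \<in> range (\<lambda>k. sqrt_branch (log_point w k))" by blast
qed (use w in \<open>auto simp: S_minus_def sqrt_branch_sq intro: Re_sqrt_branch_neg\<close>)

lemma inj_sqrt_branch_log_point: "inj (\<lambda>k. sqrt_branch (log_point w k))"
proof (rule injI)
  fix k l assume "sqrt_branch (log_point w k) = sqrt_branch (log_point w l)"
  then have "- 2 * log_point w k = - 2 * log_point w l" by (metis sqrt_branch_sq)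
  then show "k = l" by (simp add: log_point_def)
qed

text \<open>With \<xi> = -\<alpha> + i \<beta>, fixing Re w puts \<xi> on the hyperbola \<alpha>^2 -
  \<beta>^2 = -2 Re w. The last bound lets decay in \<alpha> be read as decay in the height Im w of
  the logarithm, hence in the index of the point.\<close>

lemma sqrt_branch_coords:
  assumes "Re w < 0"
  defines "\<alpha> \<equiv> - Re (sqrt_branch w)" and "\<beta> \<equiv> Im (sqrt_branch w)"
  shows "\<alpha> > 0" "\<alpha>\<^sup>2 = \<beta>\<^sup>2 - 2 * Re w" "\<alpha> * \<beta> = Im w" "\<bar>Im w\<bar> \<le> \<alpha>\<^sup>2"
proof -
  show a: "\<alpha> > 0" using Re_sqrt_branch_neg[OF assms(1)] by (simp add: \<alpha>_def)
  have "Re ((sqrt_branch w)\<^sup>2) = - 2 * Re w" "Im ((sqrt_branch w)\<^sup>2) = - 2 * Im w"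
    by (simp_all add: sqrt_branch_sq)
  then show s: "\<alpha>\<^sup>2 = \<beta>\<^sup>2 - 2 * Re w" and p: "\<alpha> * \<beta> = Im w"
    by (simp_all add: \<alpha>_def \<beta>_def power2_eq_square mult.commute)
  have "\<bar>\<beta>\<bar> \<le> \<bar>\<alpha>\<bar>" unfolding abs_le_square_iff using s assms(1) by simp
  then have "\<bar>\<beta>\<bar> \<le> \<alpha>" using a by simp
  then have "\<alpha> * \<bar>\<beta>\<bar> \<le> \<alpha> * \<alpha>" using a by (intro mult_left_mono) auto
  then show "\<bar>Im w\<bar> \<le> \<alpha>\<^sup>2" using a p[symmetric] by (simp add: abs_mult power2_eq_square)
qed

text \<open>On the hyperbola (Im \<xi>)^2 is determined by Re \<xi>, so the real phase is a cubic in
  -Re \<xi> alone. Its linear coefficient vanishes for Re w = -x/(2 \<tau>), which is the origin of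
  the radius exp(-x/(2 \<tau>)).\<close>

lemma Re_cubic_phase:
  assumes "Re w < 0"
  defines "\<xi> \<equiv> sqrt_branch w"
  shows "Re (- (1/3) * of_real \<tau> * \<xi> ^ 3 + of_real x * \<xi>) =
    - (2/3) * \<tau> * (- Re \<xi>) ^ 3 - (2 * \<tau> * Re w + x) * (- Re \<xi>)"
proof -
  have b: "(Im \<xi>)\<^sup>2 = (Re \<xi>)\<^sup>2 + 2 * Re w" using sqrt_branch_coords(2)[OF assms(1)] by (simp add: \<xi>_def)
  have "Re (\<xi> ^ 3) = (Re \<xi>) ^ 3 - 3 * Re \<xi> * (Im \<xi>)\<^sup>2"
    by (simp add: power3_eq_cube power2_eq_square algebra_simps)
  also have "\<dots> = - 2 * (Re \<xi>) ^ 3 - 6 * Re \<xi> * Re w"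
    unfolding b by (simp add: power3_eq_cube power2_eq_square algebra_simps)
  finally have c: "Re (\<xi> ^ 3) = - 2 * (Re \<xi>) ^ 3 - 6 * Re \<xi> * Re w" .
  have "Re (- (1/3) * of_real \<tau> * \<xi> ^ 3 + of_real x * \<xi>) = - (1/3) * \<tau> * Re (\<xi> ^ 3) + x * Re \<xi>" by simp
  also have "\<dots> = - (2/3) * \<tau> * (- Re \<xi>) ^ 3 - (2 * \<tau> * Re w + x) * (- Re \<xi>)"
    unfolding c by (simp add: power3_eq_cube algebra_simps)
  finally show ?thesis .
qed

text \<open>The polynomial is chosen for its use with v close to \<alpha>: by |Im w| <= \<alpha>^2
  the square of 1 + \<alpha>^2 dominates 1 + (Im w)^2, whose reciprocal is summable over all
  logarithms of a point.\<close>

lemma exp_cubic_poly_bounded: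
  fixes a b :: real
  assumes "a > 0"
  shows "\<exists>C>0. \<forall>v\<ge>0. exp (- a * v ^ 3 + b * v) * (1 + v\<^sup>2)\<^sup>2 \<le> C"
proof -
  let ?f = "\<lambda>v. exp (- a * v ^ 3 + b * v) * (1 + v\<^sup>2)\<^sup>2"
  have "(?f \<longlongrightarrow> 0) at_top" using assms by real_asymp
  then have "eventually (\<lambda>v. ?f v < 1) at_top" by (rule order_tendstoD) simp
  then obtain N where N: "\<And>v. v \<ge> N \<Longrightarrow> ?f v < 1" by (auto simp: eventually_at_top_linorder)
  have "bounded (?f ` {0..N})"
    by (intro compact_imp_bounded compact_continuous_image continuous_intros) auto
  then obtain C where C: "C > 0" "\<forall>y\<in>?f ` {0..N}. norm y \<le> C" using bounded_pos by blast
  have "?f v \<le> max C 1" if "v \<ge> 0" for v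
  proof (cases "v \<le> N")
    case True
    then have "norm (?f v) \<le> C" using C that by auto
    then show ?thesis by simp
  next
    case False
    then show ?thesis using N[of v] by simp
  qed
  then show ?thesis by (intro exI[of _ "max C 1"]) auto
qed

section \<open>The diagonal of the kernel and its summability\<close>

lemma K1_diag:
  "K1 x \<tau> \<xi> \<xi> = exp (2 * (- (1/3) * of_real \<tau> * \<xi> ^ 3 + of_real x * \<xi>)) / (2 * \<xi>\<^sup>2) * exp (- Q \<xi>)"
  by (simp add: K1_def Psi_def power2_eq_square exp_add[symmetric] algebra_simps)

text \<open>An inequality of Peetre type: with y the shifted height, 4 k^2 <= (2 pi k)^2 = (y -
  \<theta>)^2 <= 2 y^2 + 2 \<theta>^2. It converts decay in y into decay in k, locally uniformly in
  \<theta>.\<close>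

lemma one_plus_square_shift_le:
  "1 + (of_int k)\<^sup>2 \<le> (1 + \<theta>\<^sup>2) * (1 + (\<theta> + 2 * pi * of_int k)\<^sup>2)"
proof -
  define y where "y = \<theta> + 2 * pi * of_int k"
  have "(2::real)\<^sup>2 \<le> (2 * pi)\<^sup>2" using pi_gt3 by (intro power_mono) auto
  then have "4 * (of_int k)\<^sup>2 \<le> (2 * pi)\<^sup>2 * (of_int k :: real)\<^sup>2" by (intro mult_right_mono) auto
  also have "\<dots> = (y - \<theta>)\<^sup>2" by (simp add: y_def power_mult_distrib)
  also have "\<dots> \<le> 2 * y\<^sup>2 + 2 * \<theta>\<^sup>2" using zero_le_power2[of "y + \<theta>"] by (simp add: power2_eq_square algebra_simps)
  finally have "4 * (of_int k)\<^sup>2 \<le> 2 * y\<^sup>2 + 2 * \<theta>\<^sup>2" .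
  moreover have "0 \<le> \<theta>\<^sup>2 * y\<^sup>2" "0 \<le> y\<^sup>2" "0 \<le> \<theta>\<^sup>2" by simp_all
  ultimately have "1 + (of_int k)\<^sup>2 \<le> 1 + y\<^sup>2 + \<theta>\<^sup>2 + \<theta>\<^sup>2 * y\<^sup>2" by linarith
  also have "\<dots> = (1 + \<theta>\<^sup>2) * (1 + y\<^sup>2)" by (simp add: algebra_simps)
  finally show ?thesis by (simp add: y_def)
qed

lemma integrable_inverse_one_plus_square_int:
  "integrable (count_space (UNIV :: int set)) (\<lambda>k. 1 / (1 + (of_int k)\<^sup>2) :: real)"
proof -
  let ?b = "\<lambda>k::int. 1 / (1 + (of_int k)\<^sup>2) :: real"
  have s: "summable (\<lambda>n::nat. norm (1 / (1 + (real n)\<^sup>2)))"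
  proof (rule summable_comparison_test')
    show "summable (\<lambda>n. 2 * inverse ((real (Suc n))\<^sup>2))"
      using inverse_squares_sums by (intro summable_mult) (auto simp: sums_iff inverse_eq_divide)
    fix n :: nat
    have "(real (Suc n))\<^sup>2 \<le> 2 * (1 + (real n)\<^sup>2)"
      using zero_le_power2[of "real n - 1"] by (simp add: power2_eq_square algebra_simps)
    then have "2 / (2 * (1 + (real n)\<^sup>2)) \<le> 2 / (real (Suc n))\<^sup>2" by (intro divide_left_mono) (auto intro!: mult_pos_pos add_pos_nonneg)
    moreover have "2 / (2 * (1 + (real n)\<^sup>2)) = 1 / (1 + (real n)\<^sup>2)"
      by (rule nonzero_divide_mult_cancel_left) simp
    ultimately show "norm (norm (1 / (1 + (real n)\<^sup>2))) \<le> 2 * inverse ((real (Suc n))\<^sup>2)"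
      by (simp only: inverse_eq_divide) simp
  qed
  have "Infinite_Set_Sum.abs_summable_on ?b (int ` UNIV)"
    using s by (subst Infinite_Set_Sum.abs_summable_on_reindex_iff[symmetric]) (auto simp: Infinite_Set_Sum.abs_summable_on_nat_iff')
  moreover have "Infinite_Set_Sum.abs_summable_on ?b ((\<lambda>n. - int n) ` UNIV)"
    using s by (subst Infinite_Set_Sum.abs_summable_on_reindex_iff[symmetric]) (auto simp: Infinite_Set_Sum.abs_summable_on_nat_iff' inj_on_def)
  ultimately have "Infinite_Set_Sum.abs_summable_on ?b (int ` UNIV \<union> (\<lambda>n. - int n) ` UNIV)" by (rule Infinite_Set_Sum.abs_summable_on_union)
  moreover have "int ` UNIV \<union> (\<lambda>n. - int n) ` UNIV = (UNIV :: int set)"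
    by (auto simp: image_def) (metis int_cases2)
  ultimately show ?thesis by (simp add: Infinite_Set_Sum.abs_summable_on_def)
qed

text \<open>The sector has opening pi/2, so two of its points span an angle of at most pi/2 and have
  a nonnegative real inner product. These are the two hypotheses on the nodes in
  \<open>norm_det_Cauchy_le\<close>.\<close>

lemma Q_domain_add_diff:
  assumes "\<xi> \<in> Q_domain" "\<eta> \<in> Q_domain"
  shows "\<xi> + \<eta> \<noteq> 0" "norm (\<xi> - \<eta>) \<le> norm (\<xi> + \<eta>)"
proof -
  have r: "Re \<xi> < 0" "Re \<eta> < 0" using assms by (auto simp: Q_domain_def)
  then show "\<xi> + \<eta> \<noteq> 0" by (metis add_neg_neg less_irrefl plus_complex.simps(1) zero_complex.simps(1))
  have "\<bar>Im \<zeta>\<bar> \<le> - Re \<zeta>" if "\<zeta> \<in> Q_domain" for \<zeta>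
  proof -
    have "(Im \<zeta>)\<^sup>2 \<le> (Re \<zeta>)\<^sup>2" "Re \<zeta> < 0" using that by (auto simp: Q_domain_def power2_eq_square)
    then show ?thesis using abs_le_square_iff[of "Im \<zeta>" "Re \<zeta>"] by simp
  qed
  then have "\<bar>Im \<xi>\<bar> \<le> - Re \<xi>" "\<bar>Im \<eta>\<bar> \<le> - Re \<eta>" using assms by auto
  then have "\<bar>Im \<xi>\<bar> * \<bar>Im \<eta>\<bar> \<le> (- Re \<xi>) * (- Re \<eta>)" using r by (intro mult_mono) auto
  then have "- (Im \<xi> * Im \<eta>) \<le> Re \<xi> * Re \<eta>" by (simp add: abs_mult[symmetric])
  then have "(norm (\<xi> - \<eta>))\<^sup>2 \<le> (norm (\<xi> + \<eta>))\<^sup>2" unfolding cmod_power2 by (simp add: power2_eq_square algebra_simps)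
  then show "norm (\<xi> - \<eta>) \<le> norm (\<xi> + \<eta>)" by (rule power2_le_imp_le) simp
qed

text \<open>Up to row and column factors the matrix is a Cauchy matrix, whose determinant is bounded
  by the product of the moduli of its diagonal entries. The factors are the same on both sides, so
  the diagonal of the kernel controls every minor.\<close>

lemma norm_det_K1_le:
  assumes "\<And>i. i < n \<Longrightarrow> v i \<in> Q_domain"
  shows "norm (Determinant.det (Matrix.mat n n (\<lambda>(i, j). K1 x \<tau> (v i) (v j)))) \<le> (\<Prod>i<n. norm (K1 x \<tau> (v i) (v i)))"
proof -
  let ?a = "\<lambda>i. exp (Psi x \<tau> (v i)) / v i" and ?b = "\<lambda>i. exp (Psi x \<tau> (v i))"
  have "Determinant.det (Matrix.mat n n (\<lambda>(i, j). K1 x \<tau> (v i) (v j))) =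
      Determinant.det (Matrix.mat n n (\<lambda>(i, j). ?a i * (1 / (v i + v j)) * ?b j))"
    by (simp add: K1_def exp_add)
  also have "\<dots> = (\<Prod>i<n. ?a i) * (\<Prod>i<n. ?b i) * Determinant.det (Matrix.mat n n (\<lambda>(i, j). 1 / (v i + v j)))"
    by (rule det_mat_scale)
  also have "norm \<dots> \<le> norm ((\<Prod>i<n. ?a i) * (\<Prod>i<n. ?b i)) * (\<Prod>i<n. 1 / norm (2 * v i))"
    unfolding norm_mult[of "_ * _" "Determinant.det _"]
    by (intro mult_left_mono norm_det_Cauchy_le) (use assms Q_domain_add_diff in auto)
  also have "\<dots> = (\<Prod>i<n. norm (K1 x \<tau> (v i) (v i)))"
  proof -
    have "K1 x \<tau> (v i) (v i) = ?a i * ?b i * (1 / (2 * v i))" for i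
      by (simp add: K1_def exp_add exp_double power2_eq_square)
    then show ?thesis by (simp only: norm_mult norm_divide norm_one prod.distrib prod_norm[symmetric])
  qed
  finally show ?thesis .
qed

lemma norm_K1_diag_le:
  assumes w: "Re w < 0"
  defines "\<xi> \<equiv> sqrt_branch w" and "r \<equiv> exp (Re w)"
  shows "norm (K1 x \<tau> \<xi> \<xi>) \<le>
    exp (- (4/3) * \<tau> * (- Re \<xi>) ^ 3 - (4 * \<tau> * Re w + 2 * x) * (- Re \<xi>)) / (4 * norm w) * exp (2 * (r / (1 - r)))"
proof -
  have "norm (exp (2 * (- (1/3) * of_real \<tau> * \<xi> ^ 3 + of_real x * \<xi>))) =
      exp (2 * Re (- (1/3) * of_real \<tau> * \<xi> ^ 3 + of_real x * \<xi>))" by (simp add: norm_exp_eq_Re)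
  also have "\<dots> = exp (- (4/3) * \<tau> * (- Re \<xi>) ^ 3 - (4 * \<tau> * Re w + 2 * x) * (- Re \<xi>))"
    unfolding \<xi>_def Re_cubic_phase[OF w] by (simp add: algebra_simps)
  finally have 1: "norm (exp (2 * (- (1/3) * of_real \<tau> * \<xi> ^ 3 + of_real x * \<xi>))) =
    exp (- (4/3) * \<tau> * (- Re \<xi>) ^ 3 - (4 * \<tau> * Re w + 2 * x) * (- Re \<xi>))" .
  have 2: "norm (2 * \<xi>\<^sup>2) = 4 * norm w" by (simp add: \<xi>_def sqrt_branch_sq norm_mult)
  have "norm (exp (- Q \<xi>)) \<le> exp (norm (- Q \<xi>))" by (rule norm_exp)
  also have "\<dots> \<le> exp (2 * (r / (1 - r)))"
    using norm_Q_le[OF sqrt_branch_in_Q_domain[OF w]] by (simp add: sqrt_branch_sq r_def \<xi>_def norm_exp_eq_Re)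
  finally have 3: "norm (exp (- Q \<xi>)) \<le> exp (2 * (r / (1 - r)))" .
  show ?thesis unfolding K1_diag norm_mult norm_divide 1 2[unfolded norm_mult]
    using 3 by (intro mult_left_mono) auto
qed

text \<open>Uniformity on a vertical strip covers all logarithms of all points of an annulus at
  once. The decay in Im w comes from the cubic term, which beats the linear one whatever its
  sign.\<close>

lemma K1_diag_locally_bounded:
  assumes "\<tau> > 0" "L0 > 0"
  shows "\<exists>C>0. \<forall>w. - L1 \<le> Re w \<and> Re w \<le> - L0 \<longrightarrow>
    norm (K1 x \<tau> (sqrt_branch w) (sqrt_branch w)) \<le> C / (1 + (Im w)\<^sup>2)"
proof -
  \<comment> \<open>An upper bound, valid in the whole strip, for the coefficient of \<alpha> in the
    doubled real phase.\<close>
  define b where "b = 4 * \<tau> * L1 + 2 * \<bar>x\<bar>"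
  obtain C0 where C0: "C0 > 0" "\<And>v. v \<ge> 0 \<Longrightarrow> exp (- (4/3 * \<tau>) * v ^ 3 + b * v) * (1 + v\<^sup>2)\<^sup>2 \<le> C0"
    using exp_cubic_poly_bounded[of "4/3 * \<tau>" b] assms by auto
  define r0 where "r0 = exp (- L0)"
  have r0: "0 < r0" "r0 < 1" using assms by (auto simp: r0_def)
  define C where "C = C0 / (4 * L0) * exp (2 * (r0 / (1 - r0)))"
  have "norm (K1 x \<tau> (sqrt_branch w) (sqrt_branch w)) \<le> C / (1 + (Im w)\<^sup>2)" if w: "- L1 \<le> Re w" "Re w \<le> - L0" for w
  proof -
    have w0: "Re w < 0" using w assms by linarith
    define \<alpha> where "\<alpha> = - Re (sqrt_branch w)"
    have \<alpha>: "\<alpha> > 0" "\<bar>Im w\<bar> \<le> \<alpha>\<^sup>2" using sqrt_branch_coords[OF w0] by (auto simp: \<alpha>_def)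
    have "\<bar>Im w\<bar>\<^sup>2 \<le> (\<alpha>\<^sup>2)\<^sup>2" using \<alpha> by (intro power_mono) auto
    moreover have "(1 + \<alpha>\<^sup>2)\<^sup>2 = 1 + 2 * \<alpha>\<^sup>2 + (\<alpha>\<^sup>2)\<^sup>2" by (simp add: power2_eq_square algebra_simps)
    ultimately have im: "1 + (Im w)\<^sup>2 \<le> (1 + \<alpha>\<^sup>2)\<^sup>2"
      using zero_le_power2[of \<alpha>] power2_abs[of "Im w"] by linarith
    have pos: "0 < 1 + (Im w)\<^sup>2" by (simp add: add_pos_nonneg)
    have "- (4 * \<tau> * Re w + 2 * x) \<le> b"
    proof -
      have "4 * \<tau> * (- Re w) \<le> 4 * \<tau> * L1" using w assms by (intro mult_left_mono) auto
      moreover have "4 * \<tau> * (- Re w) = - (4 * \<tau> * Re w)" by simp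
      moreover have "- x \<le> \<bar>x\<bar>" by simp
      ultimately show ?thesis unfolding b_def by linarith
    qed
    then have "- (4 * \<tau> * Re w + 2 * x) * \<alpha> \<le> b * \<alpha>" using \<alpha> by (intro mult_right_mono) auto
    then have "exp (- (4/3) * \<tau> * \<alpha> ^ 3 - (4 * \<tau> * Re w + 2 * x) * \<alpha>) \<le> exp (- (4/3 * \<tau>) * \<alpha> ^ 3 + b * \<alpha>)"
      by (simp add: algebra_simps)
    also have "\<dots> \<le> C0 / (1 + \<alpha>\<^sup>2)\<^sup>2"
    proof -
      have "0 < 1 + \<alpha>\<^sup>2" by (simp add: add_pos_nonneg)
      then have "0 < (1 + \<alpha>\<^sup>2)\<^sup>2" by (rule zero_less_power)
      then show ?thesis using C0(2)[of \<alpha>] \<alpha> by (simp add: pos_le_divide_eq)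
    qed
    also have "\<dots> \<le> C0 / (1 + (Im w)\<^sup>2)" by (intro divide_left_mono im mult_pos_pos less_le_trans[OF pos im] pos less_imp_le[OF C0(1)])
    finally have e: "exp (- (4/3) * \<tau> * \<alpha> ^ 3 - (4 * \<tau> * Re w + 2 * x) * \<alpha>) \<le> C0 / (1 + (Im w)\<^sup>2)" .
    have nw: "L0 \<le> norm w" using abs_Re_le_cmod[of w] w assms by linarith
    have r: "exp (Re w) \<le> r0" using w by (simp add: r0_def)
    have "exp (Re w) / (1 - exp (Re w)) \<le> r0 / (1 - r0)" using r r0 by (intro frac_le) auto
    then have q: "exp (2 * (exp (Re w) / (1 - exp (Re w)))) \<le> exp (2 * (r0 / (1 - r0)))" by simp
    have "norm (K1 x \<tau> (sqrt_branch w) (sqrt_branch w)) \<le>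
       exp (- (4/3) * \<tau> * \<alpha> ^ 3 - (4 * \<tau> * Re w + 2 * x) * \<alpha>) / (4 * norm w) * exp (2 * (exp (Re w) / (1 - exp (Re w))))"
      unfolding \<alpha>_def by (rule norm_K1_diag_le[OF w0])
    also have "\<dots> \<le> (C0 / (1 + (Im w)\<^sup>2)) / (4 * L0) * exp (2 * (r0 / (1 - r0)))"
      using e nw q assms C0 pos by (intro mult_mono frac_le divide_nonneg_nonneg) auto
    also have "\<dots> = C / (1 + (Im w)\<^sup>2)" by (simp add: C_def)
    finally show ?thesis .
  qed
  moreover have "C > 0" using C0 assms by (simp add: C_def)
  ultimately show ?thesis by blast
qed

text \<open>A function of w = ln z and not of z: the labels k of the points of
  \<open>S_minus z\<close> depend continuously on w, but are shifted when z turns around 0.\<close>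

definition fred :: "real \<Rightarrow> real \<Rightarrow> complex \<Rightarrow> complex"
  where "fred x \<tau> w = fredholm_det (count_space UNIV)
    (\<lambda>k l. K1 x \<tau> (sqrt_branch (log_point w k)) (sqrt_branch (log_point w l)))"

lemma fredholm_det_S_minus:
  "Re w < 0 \<Longrightarrow> fredholm_det (count_space (S_minus (exp w))) (K1 x \<tau>) = fred x \<tau> w"
  by (simp add: S_minus_exp fredholm_det_count_space_reindex[OF inj_sqrt_branch_log_point] fred_def)

lemma sigma_finite_count_space_int: "sigma_finite_measure (count_space (UNIV :: int set))"
  by (rule sigma_finite_measure_count_space_countable) simp

lemma holomorphic_sqrt_branch:
  "f holomorphic_on A \<Longrightarrow> (\<And>w. w \<in> A \<Longrightarrow> Re (f w) < 0) \<Longrightarrow> (\<lambda>w. sqrt_branch (f w)) holomorphic_on A"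
proof -
  assume f: "f holomorphic_on A" and neg: "\<And>w. w \<in> A \<Longrightarrow> Re (f w) < 0"
  have "- 2 * f w \<notin> \<real>\<^sub>\<le>\<^sub>0" if "w \<in> A" for w
    using neg[OF that] by (auto simp: complex_nonpos_Reals_iff)
  then show ?thesis unfolding sqrt_branch_def by (intro holomorphic_intros f)
qed

lemma holomorphic_K1:
  assumes "f holomorphic_on A" "g holomorphic_on A"
    and "\<And>w. w \<in> A \<Longrightarrow> f w \<in> Q_domain" "\<And>w. w \<in> A \<Longrightarrow> g w \<in> Q_domain"
  shows "(\<lambda>w. K1 x \<tau> (f w) (g w)) holomorphic_on A"
proof -
  have Q: "(\<lambda>w. Q (h w)) holomorphic_on A" if "h holomorphic_on A" "\<And>w. w \<in> A \<Longrightarrow> h w \<in> Q_domain" for h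
    using holomorphic_on_compose_gen[OF that(1) holomorphic_Q] that(2) by (auto simp: comp_def)
  have "f w * (f w + g w) \<noteq> 0" if "w \<in> A" for w
    using Q_domain_add_diff(1)[OF assms(3,4)[OF that]] assms(3)[OF that] by (auto simp: Q_domain_def)
  then show ?thesis unfolding K1_def Psi_def
    by (intro holomorphic_intros Q assms) auto
qed

lemma holomorphic_det:
  assumes "\<And>i j. i < n \<Longrightarrow> j < n \<Longrightarrow> f i j holomorphic_on A"
  shows "(\<lambda>w. Determinant.det (Matrix.mat n n (\<lambda>(i, j). f i j w))) holomorphic_on A"
proof -
  have "(\<lambda>w. \<Sum>p | p permutes {0..<n}. signof p * (\<Prod>i = 0..<n. f i (p i) w)) holomorphic_on A"
    by (intro holomorphic_intros assms) (auto dest: permutes_in_image)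
  moreover have "Determinant.det (Matrix.mat n n (\<lambda>(i, j). f i j w)) =
      (\<Sum>p | p permutes {0..<n}. signof p * (\<Prod>i = 0..<n. f i (p i) w))" for w
    by (subst det_def'[of _ n])
      (auto intro!: sum.cong prod.cong arg_cong2[where f = "(*)"] dest: permutes_in_image)
  ultimately show ?thesis by simp
qed

lemma norm_fred_term_le:
  assumes w: "Re w < 0" and b: "integrable (count_space UNIV) b"
    and bound: "\<And>k. norm (K1 x \<tau> (sqrt_branch (log_point w k)) (sqrt_branch (log_point w k))) \<le> b k"
  shows "norm (LINT \<kappa>|Pi\<^sub>M {..<n} (\<lambda>_. count_space UNIV). Determinant.det (Matrix.mat n n
      (\<lambda>(i, j). K1 x \<tau> (sqrt_branch (log_point w (\<kappa> i))) (sqrt_branch (log_point w (\<kappa> j)))))) \<le> (integral\<^sup>L (count_space UNIV) b) ^ n"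
proof -
  have "norm (Determinant.det (Matrix.mat n n (\<lambda>(i, j). K1 x \<tau> (sqrt_branch (log_point w (\<kappa> i))) (sqrt_branch (log_point w (\<kappa> j))))))
      \<le> 1 * (\<Prod>i<n. b (\<kappa> i))" for \<kappa>
  proof -
    have "norm (Determinant.det (Matrix.mat n n (\<lambda>(i, j). K1 x \<tau> (sqrt_branch (log_point w (\<kappa> i))) (sqrt_branch (log_point w (\<kappa> j))))))
      \<le> (\<Prod>i<n. norm (K1 x \<tau> (sqrt_branch (log_point w (\<kappa> i))) (sqrt_branch (log_point w (\<kappa> i)))))"
      by (rule norm_det_K1_le) (use w in \<open>auto intro: sqrt_branch_in_Q_domain\<close>)
    also have "\<dots> \<le> (\<Prod>i<n. b (\<kappa> i))" by (intro prod_mono) (use bound in auto)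
    finally show ?thesis by simp
  qed
  then have "norm (LINT \<kappa>|Pi\<^sub>M {..<n} (\<lambda>_. count_space UNIV). Determinant.det (Matrix.mat n n
      (\<lambda>(i, j). K1 x \<tau> (sqrt_branch (log_point w (\<kappa> i))) (sqrt_branch (log_point w (\<kappa> j)))))) \<le> 1 * (integral\<^sup>L (count_space UNIV) b) ^ n"
    by (intro norm_LINT_PiM_le[OF sigma_finite_count_space_int b])
  then show ?thesis by simp
qed

text \<open>Near a point w0 one summable sequence b bounds the diagonal entries for all w, so the
  n-th integral is at most Z^n with Z the sum of b. Z may be large; convergence rests on the factor
  1/n!, which the Cauchy determinant bound leaves intact.\<close>

lemma holomorphic_fred:
  assumes \<tau>: "\<tau> > 0"
  shows "fred x \<tau> holomorphic_on {w. Re w < 0}"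
proof -
  have "fred x \<tau> field_differentiable at w0" if w0: "Re w0 < 0" for w0
  proof -
    define L0 where "L0 = - Re w0 / 2"
    define L1 where "L1 = 1 - Re w0"
    define \<Theta> where "\<Theta> = \<bar>Im w0\<bar> + 1"
    have L0: "L0 > 0" using w0 by (simp add: L0_def)
    define S where "S = {w. - L1 < Re w \<and> Re w < - L0 \<and> \<bar>Im w\<bar> < \<Theta>}"
    have S: "open S" unfolding S_def
      by (intro open_Collect_conj open_Collect_less continuous_intros)
    have neg: "Re w < 0" if "w \<in> S" for w using that L0 by (simp add: S_def)
    obtain C where C: "C > 0" "\<And>w. - L1 \<le> Re w \<Longrightarrow> Re w \<le> - L0 \<Longrightarrow>
        norm (K1 x \<tau> (sqrt_branch w) (sqrt_branch w)) \<le> C / (1 + (Im w)\<^sup>2)"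
      using K1_diag_locally_bounded[OF \<tau> L0] by blast
    define b where "b = (\<lambda>k::int. C * (1 + \<Theta>\<^sup>2) * (1 / (1 + (of_int k)\<^sup>2)))"
    have bi: "integrable (count_space UNIV) b"
      unfolding b_def by (intro integrable_mult_right integrable_inverse_one_plus_square_int)
    have bb: "norm (K1 x \<tau> (sqrt_branch (log_point w k)) (sqrt_branch (log_point w k))) \<le> b k" if w: "w \<in> S" for w k
    proof -
      let ?t = "Im w + 2 * pi * of_int k"
      have "norm (K1 x \<tau> (sqrt_branch (log_point w k)) (sqrt_branch (log_point w k))) \<le> C / (1 + ?t\<^sup>2)"
        using C(2)[of "log_point w k"] w by (simp add: S_def)
      also have "\<dots> \<le> C * ((1 + \<Theta>\<^sup>2) / (1 + (of_int k)\<^sup>2))"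
      proof -
        have "(1 + (Im w)\<^sup>2) * (1 + ?t\<^sup>2) \<le> (1 + \<Theta>\<^sup>2) * (1 + ?t\<^sup>2)"
          using w by (intro mult_right_mono) (auto simp: S_def abs_le_square_iff[symmetric])
        then have "1 + (of_int k)\<^sup>2 \<le> (1 + \<Theta>\<^sup>2) * (1 + ?t\<^sup>2)"
          using one_plus_square_shift_le[of k "Im w"] by linarith
        then have "1 / (1 + ?t\<^sup>2) \<le> (1 + \<Theta>\<^sup>2) / (1 + (of_int k)\<^sup>2)"
          by (simp add: divide_simps add_pos_nonneg)
        then have "C * (1 / (1 + ?t\<^sup>2)) \<le> C * ((1 + \<Theta>\<^sup>2) / (1 + (of_int k)\<^sup>2))"
          using C by (intro mult_left_mono) auto
        then show ?thesis by simp
      qed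
      finally show ?thesis by (simp add: b_def)
    qed
    define Z where "Z = integral\<^sup>L (count_space UNIV) b"
    define T where "T n w = (LINT \<kappa>|Pi\<^sub>M {..<n} (\<lambda>_. count_space UNIV). Determinant.det (Matrix.mat n n
      (\<lambda>(i, j). K1 x \<tau> (sqrt_branch (log_point w (\<kappa> i))) (sqrt_branch (log_point w (\<kappa> j))))))" for n w
    have Tb: "norm (T n w) \<le> Z ^ n" if "w \<in> S" for n w
      unfolding T_def Z_def by (rule norm_fred_term_le[OF neg[OF that] bi bb[OF that]])
    have Th: "T n holomorphic_on S" for n
      unfolding T_def
    proof (rule holomorphic_on_lebesgue_integral[OF S])
      interpret sigma_finite_measure "count_space (UNIV :: int set)" by (rule sigma_finite_count_space_int)
      interpret product_sigma_finite "\<lambda>_. count_space (UNIV :: int set)" by standard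
      show "integrable (Pi\<^sub>M {..<n} (\<lambda>_. count_space UNIV)) (\<lambda>\<kappa>. \<Prod>i<n. b (\<kappa> i))"
        by (rule product_integrable_prod) (use bi in auto)
      show "(\<lambda>\<kappa>. Determinant.det (Matrix.mat n n (\<lambda>(i, j). K1 x \<tau> (sqrt_branch (log_point w (\<kappa> i)))
          (sqrt_branch (log_point w (\<kappa> j)))))) \<in> borel_measurable (Pi\<^sub>M {..<n} (\<lambda>_. count_space UNIV))" for w
        by (subst count_space_PiM_finite) auto
      fix \<kappa> :: "nat \<Rightarrow> int"
      show "(\<lambda>w. Determinant.det (Matrix.mat n n (\<lambda>(i, j). K1 x \<tau> (sqrt_branch (log_point w (\<kappa> i)))
          (sqrt_branch (log_point w (\<kappa> j)))))) holomorphic_on S"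
        by (intro holomorphic_det holomorphic_K1 holomorphic_sqrt_branch)
          (auto simp: log_point_def intro!: holomorphic_intros sqrt_branch_in_Q_domain dest!: neg)
      fix w assume w: "w \<in> S"
      have "norm (Determinant.det (Matrix.mat n n (\<lambda>(i, j). K1 x \<tau> (sqrt_branch (log_point w (\<kappa> i))) (sqrt_branch (log_point w (\<kappa> j))))))
        \<le> (\<Prod>i<n. norm (K1 x \<tau> (sqrt_branch (log_point w (\<kappa> i))) (sqrt_branch (log_point w (\<kappa> i)))))"
        by (rule norm_det_K1_le) (use neg[OF w] in \<open>auto intro: sqrt_branch_in_Q_domain\<close>)
      also have "\<dots> \<le> (\<Prod>i<n. b (\<kappa> i))" by (intro prod_mono) (use bb[OF w] in auto)
      finally show "norm (Determinant.det (Matrix.mat n n (\<lambda>(i, j). K1 x \<tau> (sqrt_branch (log_point w (\<kappa> i)))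
          (sqrt_branch (log_point w (\<kappa> j)))))) \<le> (\<Prod>i<n. b (\<kappa> i))" .
    qed
    have sZ: "summable (\<lambda>n. norm (Z ^ n / fact n))"
      using summable_norm_exp[of Z] by (simp add: divide_inverse mult.commute norm_mult)
    have gi: "integrable (count_space UNIV) (\<lambda>n. \<bar>Z\<bar> ^ n / fact n)"
      using sZ by (simp add: integrable_count_space_nat_iff power_abs)
    have tb: "norm ((- 1) ^ n / fact n * T n w) \<le> \<bar>Z\<bar> ^ n / fact n" if "w \<in> S" for n w
      using order_trans[OF Tb[OF that, of n] abs_ge_self[of "Z ^ n"]]
      by (simp add: norm_mult norm_divide norm_power power_abs divide_right_mono)
    \<comment> \<open>The series over n is read as an integral for the counting measure, so the
      lemma on holomorphic parameter integrals serves a second time.\<close>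
    have "(\<lambda>w. LINT n|count_space UNIV. (- 1) ^ n / fact n * T n w) holomorphic_on S"
      by (rule holomorphic_on_lebesgue_integral[OF S _ _ tb gi]) (auto intro!: holomorphic_intros Th)
    moreover have "(LINT n|count_space UNIV. (- 1) ^ n / fact n * T n w) = fred x \<tau> w" if "w \<in> S" for w
    proof -
      have "integrable (count_space UNIV) (\<lambda>n. (- 1) ^ n / fact n * T n w)"
        by (rule Bochner_Integration.integrable_bound[OF gi]) (use tb[OF that] in auto)
      then show ?thesis unfolding fred_def fredholm_det_def T_def by (rule integral_count_space_nat)
    qed
    ultimately have "fred x \<tau> holomorphic_on S" using holomorphic_transform by blast
    moreover have "w0 \<in> S" using w0 by (simp add: S_def L0_def L1_def \<Theta>_def)
    ultimately show ?thesis using S holomorphic_on_imp_differentiable_at by blast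
  qed
  then show ?thesis by (simp add: holomorphic_on_def field_differentiable_at_within)
qed

section \<open>The contour integral\<close>

text \<open>Normalised so that 0 <= \<theta> <= 1 is one turn of the circle of radius exp l; the
  other logarithms of the same point are reached by adding integers to \<theta>.\<close>

definition log_line :: "real \<Rightarrow> real \<Rightarrow> complex"
  where "log_line l \<theta> = of_real l + of_real \<theta> * (2 * of_real pi * \<i>)"

lemma log_line_simps [simp]: "Re (log_line l \<theta>) = l" "Im (log_line l \<theta>) = 2 * pi * \<theta>"
  by (simp_all add: log_line_def)

lemma log_point_log_line: "log_point (log_line l \<theta>) k = log_line l (\<theta> + of_int k)"
  by (simp add: log_point_def log_line_def algebra_simps)

lemma continuous_on_log_line [continuous_intros]:
  "continuous_on A f \<Longrightarrow> continuous_on A (\<lambda>x. log_line l (f x))"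
  unfolding log_line_def by (intro continuous_intros)

lemma has_vector_derivative_log_line:
  "((\<lambda>\<theta>. log_line l (\<theta> + c)) has_vector_derivative 2 * of_real pi * \<i>) (at \<theta> within A)"
proof -
  have "(complex_of_real has_vector_derivative 1) (at \<theta> within A)"
    by (simp add: has_vector_derivative_def scaleR_conv_of_real has_derivative_of_real)
  then have "((\<lambda>\<theta>. of_real l + (of_real \<theta> + of_real c) * (2 * of_real pi * \<i>)) has_vector_derivative
      0 + (1 + 0) * (2 * of_real pi * \<i>)) (at \<theta> within A)"
    by (intro derivative_intros)
  then show ?thesis by (simp add: log_line_def)
qed

lemma contour_integral_circlepath_log:
  assumes "R > 0"
  shows "contour_integral (circlepath 0 R) (\<lambda>z. h z / (2 * of_real pi * \<i> * z)) =
    integral {0..1} (\<lambda>\<theta>. h (exp (log_line (ln R) \<theta>)))"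
proof -
  have "exp (complex_of_real (ln R)) = of_real R" using assms by (simp add: exp_of_real)
  then have e: "exp (log_line (ln R) \<theta>) = circlepath 0 R \<theta>" for \<theta>
    by (simp add: log_line_def exp_add circlepath mult_ac)
  have v: "vector_derivative (circlepath 0 R) (at \<theta>) = 2 * of_real pi * \<i> * circlepath 0 R \<theta>" for \<theta>
    by (simp only: vector_derivative_circlepath) (simp add: circlepath)
  have "circlepath 0 R \<theta> \<noteq> 0" for \<theta> using assms by (simp add: circlepath)
  then show ?thesis
    unfolding contour_integral_integral e v by (intro integral_cong) simp
qed

section \<open>The prefactor of the Fredholm determinant\<close>

definition prefactor_log :: "real \<Rightarrow> real \<Rightarrow> complex \<Rightarrow> complex"
  where "prefactor_log x \<tau> z = of_real x * A1 z + of_real \<tau> * A2 z + A3 z + B z"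

lemma holomorphic_prefactor_log: "prefactor_log x \<tau> holomorphic_on ball 0 1"
  unfolding prefactor_log_def
  by (intro holomorphic_intros holomorphic_A1 holomorphic_A2 holomorphic_A3 holomorphic_B)

lemma prefactor_log_bound:
  "\<exists>C>0. \<forall>x\<ge>0. \<forall>z. norm z \<le> 1/2 \<longrightarrow> norm (prefactor_log x \<tau> z) \<le> C * (1 + x) * norm z"
proof -
  obtain C1 C2 where C1: "C1 \<ge> 0" "\<And>z. norm z \<le> 1/2 \<Longrightarrow> norm (A1 z) \<le> C1 * norm z"
    and C2: "C2 \<ge> 0" "\<And>z. norm z \<le> 1/2 \<Longrightarrow> norm (prefactor_log 0 \<tau> z) \<le> C2 * norm z"
    using holomorphic_linear_bound[OF holomorphic_A1] holomorphic_linear_bound[OF holomorphic_prefactor_log[of 0 \<tau>]]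
    by (auto simp: prefactor_log_def A_B_0)
  have "norm (prefactor_log x \<tau> z) \<le> (C1 + C2 + 1) * (1 + x) * norm z" if x: "x \<ge> 0" and z: "norm z \<le> 1/2" for x z
  proof -
    have "prefactor_log x \<tau> z = of_real x * A1 z + prefactor_log 0 \<tau> z" by (simp add: prefactor_log_def)
    then have "norm (prefactor_log x \<tau> z) \<le> norm (of_real x * A1 z) + norm (prefactor_log 0 \<tau> z)"
      by (simp add: norm_triangle_ineq)
    also have "\<dots> \<le> x * (C1 * norm z) + C2 * norm z"
      using C1(2)[OF z] C2(2)[OF z] x by (intro add_mono) (auto simp: norm_mult intro!: mult_left_mono)
    also have "\<dots> = (x * C1 + C2) * norm z" by (simp add: algebra_simps)
    also have "\<dots> \<le> ((C1 + C2 + 1) * (1 + x)) * norm z"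
      using C1(1) C2(1) x by (intro mult_right_mono) (auto simp: algebra_simps add_nonneg_nonneg)
    finally show ?thesis by simp
  qed
  then show ?thesis using C1(1) C2(1) by (intro exI[of _ "C1 + C2 + 1"]) auto
qed

lemma norm_exp_minus_one_le:
  assumes "norm (u::complex) \<le> 1"
  shows "norm (exp u - 1) \<le> 3 * norm u"
proof -
  have "norm (exp u - exp 0) \<le> 3 * norm (u - 0)"
  proof (rule field_differentiable_bound[of "cball 0 1"])
    fix z :: complex assume z: "z \<in> cball 0 1"
    have "norm (exp z) \<le> exp (norm z)" by (rule norm_exp)
    also have "\<dots> \<le> exp 1" using z by simp
    also have "\<dots> \<le> (3::real)" by (rule exp_le)
    finally show "norm (exp z) \<le> 3" .
  qed (use assms in \<open>auto intro!: derivative_eq_intros\<close>)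
  then show ?thesis by simp
qed

text \<open>The mean value property at the origin, where \<open>A1\<close>, \<open>A2\<close>,
  \<open>A3\<close> and \<open>B\<close> all vanish.\<close>

lemma mean_value_prefactor:
  assumes "0 < R" "R < 1"
  shows "integral {0..1} (\<lambda>\<theta>. exp (prefactor_log x \<tau> (exp (log_line (ln R) \<theta>)))) = 1"
proof -
  let ?h = "\<lambda>z. exp (prefactor_log x \<tau> z)"
  have h: "?h holomorphic_on ball 0 1" by (intro holomorphic_intros holomorphic_prefactor_log)
  have "((\<lambda>u. ?h u / (u - 0)) has_contour_integral (2 * of_real pi * \<i> * ?h 0)) (circlepath 0 R)"
  proof (rule Cauchy_integral_circlepath)
    show "continuous_on (cball 0 R) ?h"
      by (rule holomorphic_on_imp_continuous_on[OF holomorphic_on_subset[OF h]]) (use assms in auto)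
    show "?h holomorphic_on ball 0 R"
      by (rule holomorphic_on_subset[OF h]) (use assms in auto)
  qed (use assms in auto)
  from has_contour_integral_div[OF this, of "2 * of_real pi * \<i>"]
  have "contour_integral (circlepath 0 R) (\<lambda>z. ?h z / (2 * of_real pi * \<i> * z)) = 1"
    by (intro contour_integral_unique) (simp add: prefactor_log_def A_B_0 field_simps)
  then show ?thesis using contour_integral_circlepath_log[OF assms(1), of ?h] by simp
qed

section \<open>Independence of the radius\<close>

definition F1_integrand :: "real \<Rightarrow> real \<Rightarrow> complex \<Rightarrow> complex"
  where "F1_integrand x \<tau> w = exp (prefactor_log x \<tau> (exp w)) * fred x \<tau> w"

lemma F1_eq:
  assumes "0 < R" "R < 1"
  shows "F1 R x \<tau> = integral {0..1} (\<lambda>\<theta>. F1_integrand x \<tau> (log_line (ln R) \<theta>))"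
proof -
  have "ln R < 0" using assms by simp
  then show ?thesis
    using contour_integral_circlepath_log[OF assms(1),
        of "\<lambda>z. exp (prefactor_log x \<tau> z) * fredholm_det (count_space (S_minus z)) (K1 x \<tau>)"]
    unfolding F1_def prefactor_log_def[symmetric] F1_integrand_def
    by (simp add: fredholm_det_S_minus)
qed

lemma holomorphic_F1_integrand:
  assumes "\<tau> > 0"
  shows "F1_integrand x \<tau> holomorphic_on {w. Re w < 0}"
proof -
  have "(prefactor_log x \<tau> \<circ> exp) holomorphic_on {w. Re w < 0}"
    by (rule holomorphic_on_compose_gen[OF _ holomorphic_prefactor_log])
      (auto intro!: holomorphic_intros simp: norm_exp_eq_Re)
  then show ?thesis unfolding F1_integrand_def
    by (intro holomorphic_intros holomorphic_fred[OF assms]) (simp add: comp_def)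
qed

text \<open>Adding 2 pi i shifts all labels by one. The determinant does not notice, since it
  depends on w only through the set \<open>S_minus (exp w)\<close>.\<close>

lemma F1_integrand_periodic:
  assumes "Re w < 0"
  shows "F1_integrand x \<tau> (w + 2 * of_real pi * \<i>) = F1_integrand x \<tau> w"
proof -
  have "exp (w + 2 * of_real pi * \<i>) = exp w" by (simp add: exp_add)
  moreover from this have "fred x \<tau> (w + 2 * of_real pi * \<i>) = fred x \<tau> w"
    using fredholm_det_S_minus[of "w + 2 * of_real pi * \<i>" x \<tau>] fredholm_det_S_minus[of w x \<tau>] assms by simp
  ultimately show ?thesis by (simp add: F1_integrand_def)
qed

text \<open>
  In the variable \<open>w = ln z\<close> the integrand is holomorphic and \<open>2 * pi * \<i>\<close>-periodic on a half-plane. If \<open>G\<close> is a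
  primitive, then \<open>G (w + 2 * pi * \<i>) - G w\<close> has derivative 0.
\<close>

lemma F1_radius_independent:
  assumes "\<tau> > 0"
  shows "\<exists>c. \<forall>R\<in>{0<..<1}. F1 R x \<tau> = c"
proof -
  let ?H = "{w. Re w < 0}" and ?p = "2 * of_real pi * \<i>"
  have H: "convex ?H" "open ?H" by (auto simp: convex_halfspace_Re_lt open_halfspace_Re_lt)
  obtain G where G: "\<And>w. Re w < 0 \<Longrightarrow> (G has_field_derivative F1_integrand x \<tau> w) (at w)"
    using holomorphic_convex_primitive'[OF H holomorphic_F1_integrand[OF assms, of x]] H(2)
    by (metis at_within_open mem_Collect_eq)
  have "((\<lambda>w. G (w + ?p) - G w) has_field_derivative 0) (at w within ?H)" if w: "w \<in> ?H" for w
  proof -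
    have "((\<lambda>w. G (w + ?p)) has_field_derivative F1_integrand x \<tau> (w + ?p)) (at w)"
      using DERIV_shift[THEN iffD1, OF G[of "w + ?p"]] w by simp
    from DERIV_diff[OF this G[of w]] w F1_integrand_periodic[of w x \<tau>]
    show ?thesis by (simp add: has_field_derivative_at_within)
  qed
  from has_field_derivative_zero_constant[OF H(1) this]
  obtain c where c: "\<And>w. Re w < 0 \<Longrightarrow> G (w + ?p) - G w = c" by auto
  have "F1 R x \<tau> = c / ?p" if R: "R \<in> {0<..<1}" for R
  proof -
    have neg: "ln R < 0" using R by simp
    have "((\<lambda>\<theta>. F1_integrand x \<tau> (log_line (ln R) \<theta>)) has_integral G (log_line (ln R) 1) / ?p - G (log_line (ln R) 0) / ?p) {0..1}"
    proof (rule fundamental_theorem_of_calculus)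
      fix \<theta> :: real assume "\<theta> \<in> {0..1}"
      have "(G \<circ> (\<lambda>\<theta>. log_line (ln R) (\<theta> + 0)) has_vector_derivative ?p * F1_integrand x \<tau> (log_line (ln R) (\<theta> + 0))) (at \<theta> within {0..1})"
        by (rule field_vector_diff_chain_within[OF has_vector_derivative_log_line has_field_derivative_at_within[OF G]]) (use neg in simp)
      from has_vector_derivative_divide[OF this, of ?p]
      show "((\<lambda>\<theta>. G (log_line (ln R) \<theta>) / ?p) has_vector_derivative F1_integrand x \<tau> (log_line (ln R) \<theta>)) (at \<theta> within {0..1})"
        by (simp add: comp_def)
    qed simp
    moreover have "log_line (ln R) 1 = log_line (ln R) 0 + ?p" by (simp add: log_line_def)
    ultimately show ?thesis using c[of "log_line (ln R) 0"] neg F1_eq[of R x \<tau>] R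
      by (simp add: integral_unique diff_divide_distrib[symmetric])
  qed
  then show ?thesis by blast
qed

section \<open>The trace term\<close>

text \<open>
  The diagonal of \<^const>\<open>K1\<close> without the factor \<open>exp (- Q \<xi>)\<close>, at \<open>x = \<tau> * a\<^sup>2\<close>. The circle of radius \<open>exp (- a\<^sup>2 / 2)\<close>
  corresponds to a hyperbola through the critical point \<open>- a\<close> of the phase \<open>- \<tau> * \<xi>\<^sup>3 / 3 + x * \<xi>\<close>.
\<close>

definition main_density :: "real \<Rightarrow> real \<Rightarrow> complex \<Rightarrow> complex"
  where "main_density \<tau> a w = exp (2 * (- (1/3) * of_real \<tau> * sqrt_branch w ^ 3 + of_real (\<tau> * a\<^sup>2) * sqrt_branch w))
    / (2 * (sqrt_branch w)\<^sup>2)"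

lemma K1_diag_main_density:
  "K1 (\<tau> * a\<^sup>2) \<tau> (sqrt_branch w) (sqrt_branch w) = main_density \<tau> a w * exp (- Q (sqrt_branch w))"
  by (simp add: K1_diag main_density_def)

lemma continuous_on_main_density:
  assumes "continuous_on A f" "\<And>t. t \<in> A \<Longrightarrow> Re (f t) < 0"
  shows "continuous_on A (\<lambda>t. main_density \<tau> a (f t))"
proof -
  have "continuous_on {w. Re w < 0} sqrt_branch"
    using holomorphic_sqrt_branch[OF holomorphic_on_ident, of "{w. Re w < 0}"]
    by (simp add: holomorphic_on_imp_continuous_on)
  then have "continuous_on A (\<lambda>t. sqrt_branch (f t))"
    by (rule continuous_on_compose2) (use assms in auto)
  then show ?thesis unfolding main_density_def
    by (intro continuous_intros) (use assms sqrt_branch_nz in auto)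
qed

text \<open>With \<alpha> = a + v and v >= 0, the inequality \<alpha>^3 >= a^3 + v^3 splits off the
  saddle value exp(-(4/3) \<tau> a^3) and leaves a decay in v that does not depend on a. The factor
  (1 + a^2)^2 is the price of 1 + \<alpha>^2 <= 2 (1 + a^2) (1 + v^2), which trades decay in v for
  decay in Im w.\<close>

lemma norm_main_density_le:
  assumes \<tau>: "\<tau> > 0"
  shows "\<exists>C>0. \<forall>a\<ge>1. \<forall>w. Re w = - a\<^sup>2 / 2 \<longrightarrow>
    norm (main_density \<tau> a w) \<le> C * (1 + a\<^sup>2)\<^sup>2 * exp (- (4/3) * \<tau> * a ^ 3) / (1 + (Im w)\<^sup>2)"
proof -
  obtain C where C: "C > 0" "\<And>v. v \<ge> 0 \<Longrightarrow> exp (- (4/3 * \<tau>) * v ^ 3 + 0 * v) * (1 + v\<^sup>2)\<^sup>2 \<le> C"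
    using exp_cubic_poly_bounded[of "4/3 * \<tau>" 0] \<tau> by auto
  have "norm (main_density \<tau> a w) \<le> (4 * C) * (1 + a\<^sup>2)\<^sup>2 * exp (- (4/3) * \<tau> * a ^ 3) / (1 + (Im w)\<^sup>2)"
    if a: "a \<ge> 1" and w: "Re w = - a\<^sup>2 / 2" for a w
  proof -
    have a2: "1 \<le> a\<^sup>2" using a by (simp add: one_le_power)
    have w0: "Re w < 0" unfolding w using a2 by linarith
    define \<alpha> where "\<alpha> = - Re (sqrt_branch w)"
    define v where "v = \<alpha> - a"
    have \<alpha>: "\<alpha> > 0" "\<alpha>\<^sup>2 = (Im (sqrt_branch w))\<^sup>2 - 2 * Re w" "\<bar>Im w\<bar> \<le> \<alpha>\<^sup>2"
      using sqrt_branch_coords[OF w0] by (auto simp: \<alpha>_def)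
    have "a\<^sup>2 \<le> \<alpha>\<^sup>2" using \<alpha>(2) w by simp
    then have "a \<le> \<alpha>" by (rule power2_le_imp_le) (use \<alpha>(1) in simp)
    then have v: "v \<ge> 0" by (simp add: v_def)
    have nw: "1 / 2 \<le> norm w" using abs_Re_le_cmod[of w] w a2 by simp
    have "norm (exp (2 * (- (1/3) * of_real \<tau> * sqrt_branch w ^ 3 + of_real (\<tau> * a\<^sup>2) * sqrt_branch w))) =
        exp (2 * Re (- (1/3) * of_real \<tau> * sqrt_branch w ^ 3 + of_real (\<tau> * a\<^sup>2) * sqrt_branch w))"
      by (simp add: norm_exp_eq_Re)
    also have "\<dots> = exp (- (4/3) * \<tau> * \<alpha> ^ 3)"
      unfolding Re_cubic_phase[OF w0] w \<alpha>_def by (simp add: algebra_simps)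
    finally have "norm (main_density \<tau> a w) = exp (- (4/3) * \<tau> * \<alpha> ^ 3) / (4 * norm w)"
      unfolding main_density_def norm_divide sqrt_branch_sq by (simp add: norm_mult)
    also have "\<dots> \<le> exp (- (4/3) * \<tau> * \<alpha> ^ 3) / 1" using nw by (intro divide_left_mono) auto
    also have "\<dots> \<le> exp (- (4/3) * \<tau> * (a ^ 3 + v ^ 3))"
    proof -
      have "\<alpha> ^ 3 = a ^ 3 + v ^ 3 + 3 * a * v * \<alpha>" by (simp add: v_def power3_eq_cube algebra_simps)
      moreover have "0 \<le> 3 * a * v * \<alpha>" using a v \<alpha> by simp
      ultimately have "a ^ 3 + v ^ 3 \<le> \<alpha> ^ 3" by linarith
      then have "\<tau> * (a ^ 3 + v ^ 3) \<le> \<tau> * \<alpha> ^ 3" using \<tau> by (intro mult_left_mono) auto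
      then show ?thesis by simp
    qed
    also have "\<dots> = exp (- (4/3) * \<tau> * a ^ 3) * exp (- (4/3 * \<tau>) * v ^ 3 + 0 * v)"
      by (simp add: algebra_simps flip: exp_add)
    also have "\<dots> \<le> exp (- (4/3) * \<tau> * a ^ 3) * (4 * C * (1 + a\<^sup>2)\<^sup>2 / (1 + (Im w)\<^sup>2))"
    proof (intro mult_left_mono)
      have "\<alpha>\<^sup>2 \<le> 2 * a\<^sup>2 + 2 * v\<^sup>2" using zero_le_power2[of "v - a"] by (simp add: v_def power2_eq_square algebra_simps)
      moreover have "2 * (1 + a\<^sup>2) * (1 + v\<^sup>2) = 2 + 2 * a\<^sup>2 + 2 * v\<^sup>2 + 2 * (a\<^sup>2 * v\<^sup>2)" by (simp add: algebra_simps)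
      moreover have "0 \<le> a\<^sup>2 * v\<^sup>2" by simp
      ultimately have "1 + \<alpha>\<^sup>2 \<le> 2 * (1 + a\<^sup>2) * (1 + v\<^sup>2)" by linarith
      then have "(1 + \<alpha>\<^sup>2)\<^sup>2 \<le> (2 * (1 + a\<^sup>2) * (1 + v\<^sup>2))\<^sup>2" by (intro power_mono) auto
      also have "\<dots> = 4 * (1 + a\<^sup>2)\<^sup>2 * (1 + v\<^sup>2)\<^sup>2" by (simp only: power_mult_distrib) simp
      finally have 1: "(1 + \<alpha>\<^sup>2)\<^sup>2 \<le> 4 * (1 + a\<^sup>2)\<^sup>2 * (1 + v\<^sup>2)\<^sup>2" .
      have "\<bar>Im w\<bar>\<^sup>2 \<le> (\<alpha>\<^sup>2)\<^sup>2" using \<alpha> by (intro power_mono) auto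
      moreover have "(1 + \<alpha>\<^sup>2)\<^sup>2 = 1 + 2 * \<alpha>\<^sup>2 + (\<alpha>\<^sup>2)\<^sup>2" by (simp add: power2_eq_square algebra_simps)
      ultimately have im: "1 + (Im w)\<^sup>2 \<le> 4 * (1 + a\<^sup>2)\<^sup>2 * (1 + v\<^sup>2)\<^sup>2"
        using 1 zero_le_power2[of \<alpha>] power2_abs[of "Im w"] by linarith
      have pos: "0 < 1 + (Im w)\<^sup>2" by (simp add: add_pos_nonneg)
      let ?e = "exp (- (4/3 * \<tau>) * v ^ 3 + 0 * v)"
      have "?e * (1 + (Im w)\<^sup>2) \<le> ?e * (4 * (1 + a\<^sup>2)\<^sup>2 * (1 + v\<^sup>2)\<^sup>2)"
        using im by (intro mult_left_mono) auto
      also have "\<dots> = 4 * (1 + a\<^sup>2)\<^sup>2 * (?e * (1 + v\<^sup>2)\<^sup>2)" by (simp only: mult_ac)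
      also have "\<dots> \<le> 4 * (1 + a\<^sup>2)\<^sup>2 * C" using C(2)[OF v] by (intro mult_left_mono) auto
      finally show "?e \<le> 4 * C * (1 + a\<^sup>2)\<^sup>2 / (1 + (Im w)\<^sup>2)"
        using pos by (simp only: pos_le_divide_eq mult_ac)
    qed simp
    finally show ?thesis by (simp add: mult_ac)
  qed
  then show ?thesis using C(1) by (intro exI[of _ "4 * C"]) auto
qed

definition trace_kernel :: "real \<Rightarrow> complex \<Rightarrow> complex"
  where "trace_kernel \<sigma> z = airy_kernel (\<sigma>\<^sup>2) z / (- 2 * z)"

text \<open>
  With \<open>\<kappa>\<^sup>3 = 2 * \<tau>\<close>, the substitution \<open>z = \<kappa> * \<xi>\<close> carries twice the phase at \<open>x = \<tau> * a\<^sup>2\<close> into the Airy phase at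
  \<open>\<sigma>\<^sup>2 = (\<kappa> * a)\<^sup>2\<close>, and \<open>\<sigma>\<^sup>2 = 2 powr (2/3) * \<tau> powr (- 1/3) * x\<close>.
\<close>

context
  fixes \<tau> a \<kappa> \<sigma> :: real
  assumes \<tau>: "\<tau> > 0" and a: "a \<ge> 1" and \<kappa>: "\<kappa> > 0" "\<kappa> ^ 3 = 2 * \<tau>" and \<sigma>: "\<sigma> = \<kappa> * a"
begin

lemma \<sigma>_pos: "\<sigma> > 0"
  using \<kappa> a by (simp add: \<sigma>)

text \<open>The factor \<open>of_real \<kappa> * (- 1 / sqrt_branch w)\<close> is the derivative of
  \<kappa> \<xi> with respect to w, so \<open>main_density\<close> is the pull-back of the Airy
  trace integrand under w -> \<kappa> \<xi>.\<close>

lemma trace_kernel_sqrt_branch: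
  assumes "Re w < 0"
  shows "trace_kernel \<sigma> (of_real \<kappa> * sqrt_branch w) * (of_real \<kappa> * (- 1 / sqrt_branch w)) = main_density \<tau> a w"
proof -
  have "- ((of_real \<kappa> * sqrt_branch w) ^ 3) / 3 + of_real (\<sigma>\<^sup>2) * (of_real \<kappa> * sqrt_branch w) =
      - (of_real (\<kappa> ^ 3) * sqrt_branch w ^ 3) / 3 + of_real (\<kappa> ^ 3 * a\<^sup>2) * sqrt_branch w"
    by (simp add: \<sigma> power_mult_distrib power2_eq_square power3_eq_cube)
  also have "\<dots> = 2 * (- (1/3) * of_real \<tau> * sqrt_branch w ^ 3 + of_real (\<tau> * a\<^sup>2) * sqrt_branch w)"
    unfolding \<kappa>(2) by (simp add: algebra_simps)
  finally show ?thesis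
    using sqrt_branch_nz[OF assms] \<kappa>(1)
    by (simp add: trace_kernel_def airy_kernel_def main_density_def power2_eq_square)
qed

text \<open>On the segment of height y between the hyperbola and the vertical line, the distance c
  from the imaginary axis satisfies c^2 <= y^2 + \<sigma>^2. Hence c^3/3 <= c (y^2 + \<sigma>^2)/3,
  which leaves two thirds of the Gaussian decay; the segment has length at most |y|.\<close>

lemma trace_kernel_horizontal_bound:
  assumes G: "\<And>z. Re z < 0 \<Longrightarrow> (G has_field_derivative trace_kernel \<sigma> z) (at z)"
    and w: "Re w = - a\<^sup>2 / 2"
  defines "y \<equiv> Im (of_real \<kappa> * sqrt_branch w)"
  shows "norm (G (of_real \<kappa> * sqrt_branch w) - G (Complex (- \<sigma>) y)) \<le>
    exp (- (2/3) * \<sigma> * y\<^sup>2) / (2 * \<sigma>) * \<bar>y\<bar>"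
proof -
  define c1 where "c1 = - Re (of_real \<kappa> * sqrt_branch w)"
  have w0: "Re w < 0" using w a by simp
  have "(Re (sqrt_branch w))\<^sup>2 = (Im (sqrt_branch w))\<^sup>2 + a\<^sup>2" "Re (sqrt_branch w) < 0"
    using sqrt_branch_coords(1,2)[OF w0] w by auto
  then have c1: "c1 > 0" "c1\<^sup>2 = y\<^sup>2 + \<sigma>\<^sup>2"
    using \<kappa> by (auto simp: c1_def y_def \<sigma> power_mult_distrib mult_pos_neg algebra_simps)
  have c1\<sigma>: "\<sigma> \<le> c1" using c1 \<sigma>_pos by (intro power2_le_imp_le[of \<sigma> c1]) auto
  have "c1\<^sup>2 \<le> (\<sigma> + \<bar>y\<bar>)\<^sup>2" unfolding c1(2) using \<sigma>_pos by (simp add: power2_eq_square algebra_simps)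
  then have c1y: "c1 \<le> \<sigma> + \<bar>y\<bar>" using \<sigma>_pos by (intro power2_le_imp_le[of c1]) auto
  have z: "of_real \<kappa> * sqrt_branch w = Complex (- c1) y" by (simp add: c1_def y_def complex_eq_iff)
  have seg: "\<exists>c\<in>{\<sigma>..c1}. u = Complex (- c) y" if "u \<in> closed_segment (Complex (- c1) y) (Complex (- \<sigma>) y)" for u
    using that c1\<sigma> by (intro bexI[of _ "- Re u"]) (auto simp: closed_segment_same_Im closed_segment_eq_real_ivl complex_eq_iff)
  have "norm (G (Complex (- c1) y) - G (Complex (- \<sigma>) y)) \<le>
      (exp (- (2/3) * \<sigma> * y\<^sup>2) / (2 * \<sigma>)) * norm (Complex (- c1) y - Complex (- \<sigma>) y)"
  proof (rule field_differentiable_bound[OF convex_closed_segment])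
    fix u assume "u \<in> closed_segment (Complex (- c1) y) (Complex (- \<sigma>) y)"
    then obtain c where c: "c \<in> {\<sigma>..c1}" "u = Complex (- c) y" using seg by blast
    show "(G has_field_derivative trace_kernel \<sigma> u) (at u within closed_segment (Complex (- c1) y) (Complex (- \<sigma>) y))"
      using c \<sigma>_pos by (intro has_field_derivative_at_within[OF G]) auto
    have "c\<^sup>2 \<le> y\<^sup>2 + \<sigma>\<^sup>2" unfolding c1(2)[symmetric] using c \<sigma>_pos by (intro power_mono) auto
    then have "c * c\<^sup>2 \<le> c * (y\<^sup>2 + \<sigma>\<^sup>2)" using c \<sigma>_pos by (intro mult_left_mono) auto
    then have "c ^ 3 \<le> c * y\<^sup>2 + c * \<sigma>\<^sup>2" by (simp add: power3_eq_cube power2_eq_square algebra_simps)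
    moreover have "\<sigma> * y\<^sup>2 \<le> c * y\<^sup>2" "0 \<le> c * \<sigma>\<^sup>2" using c \<sigma>_pos by (auto intro: mult_right_mono)
    ultimately have "c ^ 3 / 3 - \<sigma>\<^sup>2 * c + - c * y\<^sup>2 \<le> - (2/3) * \<sigma> * y\<^sup>2" by (simp add: mult.commute)
    then have 1: "norm (airy_kernel (\<sigma>\<^sup>2) u) \<le> exp (- (2/3) * \<sigma> * y\<^sup>2)"
      unfolding c(2) norm_airy_kernel exp_add[symmetric] by simp
    have "- Re u \<le> norm u" using abs_Re_le_cmod[of u] by linarith
    then have "\<sigma> \<le> norm u" using c by simp
    then show "norm (trace_kernel \<sigma> u) \<le> exp (- (2/3) * \<sigma> * y\<^sup>2) / (2 * \<sigma>)"
      unfolding trace_kernel_def norm_divide using 1 \<sigma>_pos by (intro frac_le) (auto simp: norm_mult)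
  qed auto
  also have "\<dots> \<le> (exp (- (2/3) * \<sigma> * y\<^sup>2) / (2 * \<sigma>)) * \<bar>y\<bar>"
    using c1y c1\<sigma> \<sigma>_pos by (intro mult_left_mono) (auto simp: cmod_def)
  finally show ?thesis unfolding z .
qed

text \<open>From \<alpha> <= |\<beta>| + a and \<alpha> |\<beta>| = 2 pi |s| follows (|\<beta>| +
  a)^2 >= 2 pi |s|. The sign of \<beta> is that of s because \<alpha> > 0.\<close>

lemma filterlim_Im_sqrt_branch:
  assumes X: "filterlim X at_top F"
  shows "filterlim (\<lambda>n. Im (sqrt_branch (log_line (- a\<^sup>2 / 2) (X n)))) at_top F"
    and "filterlim (\<lambda>n. Im (sqrt_branch (log_line (- a\<^sup>2 / 2) (- X n)))) at_bot F"
proof -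
  have neg: "- a\<^sup>2 / 2 < 0" using a by simp
  have lower: "\<bar>Im (sqrt_branch (log_line (- a\<^sup>2 / 2) s))\<bar> \<ge> sqrt (2 * pi * \<bar>s\<bar>) - a" for s
  proof -
    define w where "w = log_line (- a\<^sup>2 / 2) s"
    define \<alpha> where "\<alpha> = - Re (sqrt_branch w)"
    define \<beta> where "\<beta> = Im (sqrt_branch w)"
    have \<alpha>: "\<alpha> > 0" "\<alpha>\<^sup>2 = \<beta>\<^sup>2 + a\<^sup>2" "\<alpha> * \<beta> = 2 * pi * s"
      using sqrt_branch_coords(1-3)[of w] neg by (auto simp: w_def \<alpha>_def \<beta>_def)
    have "\<alpha>\<^sup>2 \<le> (\<bar>\<beta>\<bar> + a)\<^sup>2" unfolding \<alpha>(2) using a by (simp add: power2_eq_square algebra_simps)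
    then have "\<alpha> \<le> \<bar>\<beta>\<bar> + a" using a by (intro power2_le_imp_le[of \<alpha>]) auto
    then have "\<alpha> * \<bar>\<beta>\<bar> \<le> (\<bar>\<beta>\<bar> + a) * (\<bar>\<beta>\<bar> + a)" using a \<alpha> by (intro mult_mono) auto
    moreover have "\<alpha> * \<bar>\<beta>\<bar> = 2 * pi * \<bar>s\<bar>" using \<alpha>(1) arg_cong[OF \<alpha>(3), of abs] by (simp add: abs_mult)
    ultimately have "2 * pi * \<bar>s\<bar> \<le> (\<bar>\<beta>\<bar> + a)\<^sup>2" by (simp add: power2_eq_square)
    then have "sqrt (2 * pi * \<bar>s\<bar>) \<le> \<bar>\<beta>\<bar> + a" using a by (intro real_le_lsqrt) auto
    then show ?thesis by (simp add: \<beta>_def w_def)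
  qed
  have sgn: "Im (sqrt_branch (log_line (- a\<^sup>2 / 2) s)) * s \<ge> 0" for s
  proof -
    let ?w = "log_line (- a\<^sup>2 / 2) s"
    have \<alpha>: "- Re (sqrt_branch ?w) > 0" "- Re (sqrt_branch ?w) * Im (sqrt_branch ?w) = 2 * pi * s"
      using sqrt_branch_coords(1,3)[of ?w] neg by auto
    have "0 \<le> (- Re (sqrt_branch ?w)) * (Im (sqrt_branch ?w))\<^sup>2" using \<alpha>(1) by (intro mult_nonneg_nonneg) auto
    also have "\<dots> = 2 * pi * (Im (sqrt_branch ?w) * s)"
      using \<alpha>(2) by (simp add: power2_eq_square mult.assoc[symmetric]) 
    finally show ?thesis using pi_gt_zero by (simp add: zero_le_mult_iff)
  qed
  have g: "filterlim (\<lambda>n. sqrt (2 * pi * \<bar>X n\<bar>) - a) at_top F"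
  proof -
    have "filterlim (\<lambda>t::real. sqrt (2 * pi * \<bar>t\<bar>) - a) at_top at_top" by real_asymp
    from filterlim_compose[OF this X] show ?thesis .
  qed
  have ev: "eventually (\<lambda>n. X n > 0) F" using X by (auto simp: filterlim_at_top_dense)
  show "filterlim (\<lambda>n. Im (sqrt_branch (log_line (- a\<^sup>2 / 2) (X n)))) at_top F"
  proof (rule filterlim_at_top_mono[OF g])
    show "eventually (\<lambda>n. sqrt (2 * pi * \<bar>X n\<bar>) - a \<le> Im (sqrt_branch (log_line (- a\<^sup>2 / 2) (X n)))) F"
      using ev
    proof eventually_elim
      case (elim n)
      then have "Im (sqrt_branch (log_line (- a\<^sup>2 / 2) (X n))) \<ge> 0"
        using sgn[of "X n"] by (simp add: zero_le_mult_iff)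
      then show ?case using lower[of "X n"] by simp
    qed
  qed
  show "filterlim (\<lambda>n. Im (sqrt_branch (log_line (- a\<^sup>2 / 2) (- X n)))) at_bot F"
    unfolding filterlim_uminus_at_bot
  proof (rule filterlim_at_top_mono[OF g])
    show "eventually (\<lambda>n. sqrt (2 * pi * \<bar>X n\<bar>) - a \<le> - Im (sqrt_branch (log_line (- a\<^sup>2 / 2) (- X n)))) F"
      using ev
    proof eventually_elim
      case (elim n)
      then have "Im (sqrt_branch (log_line (- a\<^sup>2 / 2) (- X n))) \<le> 0"
        using sgn[of "- X n"] by (simp add: mult_le_0_iff)
      then show ?case using lower[of "- X n"] by simp
    qed
  qed
qed

text \<open>Shifting \<theta> by 1 moves to the next stretch of the hyperbola, so the integrals over
  [0, 1] are increments of one primitive and their sum telescopes. The two ends are then moved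
  horizontally to the line Re z = -\<sigma>.\<close>

lemma main_term_limit:
  "(\<lambda>N. \<Sum>k\<in>{- int N..<int N}. integral {0..1} (\<lambda>\<theta>. main_density \<tau> a (log_line (- a\<^sup>2 / 2) (\<theta> + of_int k))))
    \<longlonglongrightarrow> of_real (LINT u:{0<..}|lborel. airy_Ai (\<sigma>\<^sup>2 + 2 * u))"
proof -
  let ?l = "- a\<^sup>2 / 2" and ?p = "2 * of_real pi * \<i>"
  have neg: "?l < 0" using a by simp
  have "trace_kernel \<sigma> holomorphic_on {z. Re z < 0}"
    unfolding trace_kernel_def by (intro holomorphic_intros) auto
  then obtain G where G: "\<And>z. Re z < 0 \<Longrightarrow> (G has_field_derivative trace_kernel \<sigma> z) (at z)"
    using holomorphic_convex_primitive'[of "{z. Re z < 0}" "trace_kernel \<sigma>"]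
    by (metis at_within_open mem_Collect_eq convex_halfspace_Re_lt open_halfspace_Re_lt)
  define H where "H s = G (of_real \<kappa> * sqrt_branch (log_line ?l s)) / ?p" for s
  have int: "((\<lambda>\<theta>. main_density \<tau> a (log_line ?l (\<theta> + of_int k))) has_integral H (1 + of_int k) - H (0 + of_int k)) {0..1}" for k
  proof (rule fundamental_theorem_of_calculus)
    fix \<theta> :: real assume "\<theta> \<in> {0..1}"
    let ?w = "log_line ?l (\<theta> + of_int k)"
    have w: "Re ?w < 0" using neg by simp
    have "Re (of_real \<kappa> * sqrt_branch ?w) < 0" using Re_sqrt_branch_neg[OF w] \<kappa> by (simp add: mult_pos_neg)
    from DERIV_chain2[OF G[OF this] DERIV_cmult[OF sqrt_branch_has_field_derivative[OF w], of "of_real \<kappa>"]]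
    have "((\<lambda>w. G (of_real \<kappa> * sqrt_branch w)) has_field_derivative main_density \<tau> a ?w) (at ?w)"
      unfolding trace_kernel_sqrt_branch[OF w] .
    from field_vector_diff_chain_within[OF has_vector_derivative_log_line has_field_derivative_at_within[OF this]]
    have "((\<lambda>w. G (of_real \<kappa> * sqrt_branch w)) \<circ> (\<lambda>\<theta>. log_line ?l (\<theta> + of_int k)) has_vector_derivative
        ?p * main_density \<tau> a ?w) (at \<theta> within {0..1})" .
    from has_vector_derivative_divide[OF this, of ?p]
    show "((\<lambda>\<theta>. H (\<theta> + of_int k)) has_vector_derivative main_density \<tau> a ?w) (at \<theta> within {0..1})"
      by (simp add: H_def comp_def)
  qed simp
  \<comment> \<open>The half-open range makes the unit intervals [k, k + 1] tile [-N, N]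
    exactly.\<close>
  have tele: "(\<Sum>k\<in>{- int N..<int N}. H (1 + of_int k) - H (0 + of_int k)) = H (real N) - H (- real N)" for N
  proof (induction N)
    case (Suc N)
    have "{- int (Suc N)..<int (Suc N)} = insert (- int (Suc N)) (insert (int N) {- int N..<int N})" by auto
    then show ?case using Suc by (simp add: add.commute)
  qed simp
  have sum: "(\<Sum>k\<in>{- int N..<int N}. integral {0..1} (\<lambda>\<theta>. main_density \<tau> a (log_line ?l (\<theta> + of_int k)))) = H (real N) - H (- real N)" for N
    unfolding tele[symmetric] by (intro sum.cong refl) (rule integral_unique[OF int])
  let ?z = "\<lambda>s. of_real \<kappa> * sqrt_branch (log_line ?l s)"
  have n: "filterlim (\<lambda>n. real n) at_top sequentially" by (rule filterlim_real_sequentially)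
  have up: "filterlim (\<lambda>n. Im (?z (real n))) at_top sequentially"
    using filterlim_tendsto_pos_mult_at_top[OF tendsto_const \<kappa>(1) filterlim_Im_sqrt_branch(1)[OF n]] by simp
  have dn: "filterlim (\<lambda>n. Im (?z (- real n))) at_bot sequentially"
    using filterlim_tendsto_pos_mult_at_bot[OF tendsto_const \<kappa>(1) filterlim_Im_sqrt_branch(2)[OF n]] by simp
  have hor: "(\<lambda>n. G (?z (X n)) - G (Complex (- \<sigma>) (Im (?z (X n))))) \<longlonglongrightarrow> 0"
    if "filterlim (\<lambda>n. \<bar>Im (?z (X n))\<bar>) at_top sequentially" for X :: "nat \<Rightarrow> real"
  proof (rule Lim_null_comparison)
    have "((\<lambda>y::real. exp (- (2/3) * \<sigma> * y\<^sup>2) / (2 * \<sigma>) * y) \<longlongrightarrow> 0) at_top" using \<sigma>_pos by real_asymp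
    from filterlim_compose[OF this that]
    show "(\<lambda>n. exp (- (2/3) * \<sigma> * (Im (?z (X n)))\<^sup>2) / (2 * \<sigma>) * \<bar>Im (?z (X n))\<bar>) \<longlonglongrightarrow> 0"
      by (simp only: power2_abs)
    show "eventually (\<lambda>n. norm (G (?z (X n)) - G (Complex (- \<sigma>) (Im (?z (X n))))) \<le>
        exp (- (2/3) * \<sigma> * (Im (?z (X n)))\<^sup>2) / (2 * \<sigma>) * \<bar>Im (?z (X n))\<bar>) sequentially"
      by (intro always_eventually allI trace_kernel_horizontal_bound[OF G]) simp_all
  qed
  have aup: "filterlim (\<lambda>n. \<bar>Im (?z (real n))\<bar>) at_top sequentially"
    by (rule filterlim_compose[OF filterlim_abs_real up])
  have adn: "filterlim (\<lambda>n. \<bar>Im (?z (- real n))\<bar>) at_top sequentially"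
    using filterlim_compose[OF filterlim_abs_real dn[unfolded filterlim_uminus_at_bot]] by simp
  have tint: "integrable lborel (\<lambda>y. trace_kernel \<sigma> (Complex (- \<sigma>) y))"
  proof (rule Bochner_Integration.integrable_bound)
    show "integrable lborel (\<lambda>y. 1 / (2 * \<sigma>) * norm (airy_kernel (\<sigma>\<^sup>2) (Complex (- \<sigma>) y)))"
      by (intro integrable_mult_right integrable_norm integrable_airy_kernel \<sigma>_pos)
    have "continuous_on UNIV (\<lambda>y. trace_kernel \<sigma> (Complex (- \<sigma>) y))"
      unfolding trace_kernel_def by (intro continuous_intros) (use \<sigma>_pos in \<open>auto simp: complex_eq_iff\<close>)
    then show "(\<lambda>y. trace_kernel \<sigma> (Complex (- \<sigma>) y)) \<in> borel_measurable lborel"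
      by (simp add: borel_measurable_continuous_onI)
    have "norm (trace_kernel \<sigma> (Complex (- \<sigma>) y)) \<le> 1 / (2 * \<sigma>) * norm (airy_kernel (\<sigma>\<^sup>2) (Complex (- \<sigma>) y))" for y
    proof -
      have "\<sigma> \<le> norm (Complex (- \<sigma>) y)" using abs_Re_le_cmod[of "Complex (- \<sigma>) y"] by simp
      then have "norm (airy_kernel (\<sigma>\<^sup>2) (Complex (- \<sigma>) y)) / norm (- 2 * Complex (- \<sigma>) y) \<le> norm (airy_kernel (\<sigma>\<^sup>2) (Complex (- \<sigma>) y)) / (2 * \<sigma>)"
        using \<sigma>_pos unfolding norm_mult by (intro divide_left_mono mult_pos_pos) auto
      then show ?thesis unfolding trace_kernel_def norm_divide by simp
    qed
    then show "AE y in lborel. norm (trace_kernel \<sigma> (Complex (- \<sigma>) y)) \<le> norm (1 / (2 * \<sigma>) * norm (airy_kernel (\<sigma>\<^sup>2) (Complex (- \<sigma>) y)))"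
      using \<sigma>_pos by (intro AE_I2) (simp add: abs_mult)
  qed
  have vert: "(\<lambda>n. - \<i> * (G (Complex (- \<sigma>) (Im (?z (real n)))) - G (Complex (- \<sigma>) (Im (?z (- real n))))))
      \<longlonglongrightarrow> (LINT y|lborel. trace_kernel \<sigma> (Complex (- \<sigma>) y))"
    by (rule vertical_integral_primitive[OF _ tint dn up]) (use G \<sigma>_pos in auto)
  \<comment> \<open>Here 1/(2 pi i) = -i/(2 pi): the vertical part carries the latter form, the two
    horizontal corrections the former.\<close>
  have "(\<lambda>n. - \<i> * (G (Complex (- \<sigma>) (Im (?z (real n)))) - G (Complex (- \<sigma>) (Im (?z (- real n))))) / (2 * of_real pi)
      + ((G (?z (real n)) - G (Complex (- \<sigma>) (Im (?z (real n))))) - (G (?z (- real n)) - G (Complex (- \<sigma>) (Im (?z (- real n)))))) / ?p)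
      \<longlonglongrightarrow> (LINT y|lborel. trace_kernel \<sigma> (Complex (- \<sigma>) y)) / (2 * of_real pi) + (0 - 0) / ?p"
    by (intro tendsto_intros vert hor aup adn) auto
  also have "(\<lambda>n. - \<i> * (G (Complex (- \<sigma>) (Im (?z (real n)))) - G (Complex (- \<sigma>) (Im (?z (- real n))))) / (2 * of_real pi)
      + ((G (?z (real n)) - G (Complex (- \<sigma>) (Im (?z (real n))))) - (G (?z (- real n)) - G (Complex (- \<sigma>) (Im (?z (- real n)))))) / ?p)
      = (\<lambda>n. H (real n) - H (- real n))"
    by (intro ext) (simp only: H_def, simp add: field_simps)
  finally show ?thesis
    unfolding sum airy_trace_eq[OF \<sigma>_pos] trace_kernel_def by simp
qed

end

section \<open>Comparison of the two tails\<close>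

lemma LINT_count_space_int_limit:
  fixes f :: "int \<Rightarrow> complex"
  assumes b: "integrable (count_space UNIV) b" and f: "\<And>k. norm (f k) \<le> b k"
  shows "(\<lambda>N. \<Sum>k\<in>{- int N..<int N}. f k) \<longlonglongrightarrow> (LINT k|count_space UNIV. f k)"
proof -
  have eq: "(\<Sum>k\<in>{- int N..<int N}. f k) = (LINT k|count_space UNIV. indicat_real {- int N..<int N} k *\<^sub>R f k)" for N
    by (subst lebesgue_integral_count_space_finite_support)
      (auto intro!: finite_subset[of _ "{- int N..<int N}"] sum.mono_neutral_cong_right simp: indicator_def split: if_splits)
  show ?thesis unfolding eq
  proof (rule integral_dominated_convergence[OF _ _ b])
    have "(\<lambda>N. indicat_real {- int N..<int N} k *\<^sub>R f k) \<longlonglongrightarrow> f k" for k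
    proof (rule tendsto_eventually)
      show "eventually (\<lambda>N. indicat_real {- int N..<int N} k *\<^sub>R f k = f k) sequentially"
        using eventually_gt_at_top[of "nat \<bar>k\<bar>"] by eventually_elim (auto simp: indicator_def)
    qed
    then show "AE k in count_space UNIV. (\<lambda>N. indicat_real {- int N..<int N} k *\<^sub>R f k) \<longlonglongrightarrow> f k" by simp
    show "AE k in count_space UNIV. norm (indicat_real {- int N..<int N} k *\<^sub>R f k) \<le> b k" for N
      using f order_trans[OF norm_ge_zero f] by (auto simp: indicator_def)
  qed auto
qed

text \<open>In the bound, the factor with exp(-a^2/2), called \<delta> in the proof, bounds |P - Q|
  for the exponent P of the prefactor; the factor with the saddle value, called N, bounds the sum of
  the main densities. The leading 3 is that of \<open>norm_exp_minus_one_le\<close>. The constant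
  648 is 4 * 2 * 9^2, from |exp P| <= 4, the factor 2 in \<open>fredholm_det_approx\<close> and
  |exp(-Q)| <= 9.\<close>

lemma F1_approx:
  fixes \<tau> :: real
  assumes \<tau>: "\<tau> > 0"
  defines "\<kappa> \<equiv> root 3 (2 * \<tau>)"
  shows "\<exists>C>0. \<exists>C'>0. \<forall>\<^sub>F a in at_top. \<forall>R\<in>{0<..<1}.
    norm (1 - F1 R (\<tau> * a\<^sup>2) \<tau> - of_real (LINT u:{0<..}|lborel. airy_Ai ((\<kappa> * a)\<^sup>2 + 2 * u))) \<le>
      3 * ((C' * (1 + \<tau> * a\<^sup>2) + 4) * exp (- a\<^sup>2 / 2)) * (C * (1 + a\<^sup>2)\<^sup>2 * exp (- (4/3) * \<tau> * a ^ 3))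
      + 648 * (C * (1 + a\<^sup>2)\<^sup>2 * exp (- (4/3) * \<tau> * a ^ 3))\<^sup>2"
proof -
  have \<kappa>: "\<kappa> > 0" "\<kappa> ^ 3 = 2 * \<tau>" using \<tau> by (auto simp: \<kappa>_def)
  obtain C0 where C0: "C0 > 0" "\<And>a w. a \<ge> 1 \<Longrightarrow> Re w = - a\<^sup>2 / 2 \<Longrightarrow>
      norm (main_density \<tau> a w) \<le> C0 * (1 + a\<^sup>2)\<^sup>2 * exp (- (4/3) * \<tau> * a ^ 3) / (1 + (Im w)\<^sup>2)"
    using norm_main_density_le[OF \<tau>] by blast
  obtain C' where C': "C' > 0" "\<And>x z. x \<ge> 0 \<Longrightarrow> norm z \<le> 1/2 \<Longrightarrow> norm (prefactor_log x \<tau> z) \<le> C' * (1 + x) * norm z"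
    using prefactor_log_bound by blast
  define S0 where "S0 = (LINT k|count_space UNIV. 1 / (1 + (real_of_int k)\<^sup>2))"
  \<comment> \<open>The summand 1 keeps C positive, as S0 is only known to be nonnegative.\<close>
  define C where "C = C0 * (1 + (2 * pi)\<^sup>2) * S0 + 1"
  define N where "N a = C * (1 + a\<^sup>2)\<^sup>2 * exp (- (4/3) * \<tau> * a ^ 3)" for a
  \<comment> \<open>The two summands belong to the prefactor and to Q: the 4 comes from |Q| <= 2
    r/(1 - r) <= 4 r for r = exp(-a^2/2) <= 1/2.\<close>
  define \<delta> where "\<delta> a = (C' * (1 + \<tau> * a\<^sup>2) + 4) * exp (- a\<^sup>2 / 2)" for a
  have S0: "S0 \<ge> 0" unfolding S0_def by (intro Bochner_Integration.integral_nonneg) simp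
  have C: "C > 0" unfolding C_def using C0 S0 by (intro add_nonneg_pos mult_nonneg_nonneg) auto
  have ev: "eventually (\<lambda>a. a \<ge> 2 \<and> 9 * N a \<le> 1 / 2 \<and> \<delta> a \<le> 1) at_top"
  proof (intro eventually_conj)
    show "eventually (\<lambda>a. a \<ge> 2) (at_top :: real filter)" by (rule eventually_ge_at_top)
    have "((\<lambda>a. 9 * N a) \<longlongrightarrow> 0) at_top" unfolding N_def using \<tau> C by real_asymp
    then have "eventually (\<lambda>a. 9 * N a < 1 / 2) at_top" by (rule order_tendstoD) simp
    then show "eventually (\<lambda>a. 9 * N a \<le> 1 / 2) at_top" by eventually_elim simp
    have "(\<delta> \<longlongrightarrow> 0) at_top" unfolding \<delta>_def using \<tau> C'(1) by real_asymp
    then have "eventually (\<lambda>a. \<delta> a < 1) at_top" by (rule order_tendstoD) simp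
    then show "eventually (\<lambda>a. \<delta> a \<le> 1) at_top" by eventually_elim simp
  qed
  have main: "norm (1 - F1 R (\<tau> * a\<^sup>2) \<tau> - of_real (LINT u:{0<..}|lborel. airy_Ai ((\<kappa> * a)\<^sup>2 + 2 * u))) \<le> 3 * \<delta> a * N a + 648 * (N a)\<^sup>2"
    if a: "a \<ge> 2" "9 * N a \<le> 1 / 2" "\<delta> a \<le> 1" and R: "R \<in> {0<..<1}" for a R
  proof -
    let ?l = "- a\<^sup>2 / 2" and ?x = "\<tau> * a\<^sup>2"
    define Tr where "Tr = complex_of_real (LINT u:{0<..}|lborel. airy_Ai ((\<kappa> * a)\<^sup>2 + 2 * u))"
    define r where "r = exp ?l"
    have a1: "a \<ge> 1" using a by simp
    have "2\<^sup>2 \<le> a\<^sup>2" using a by (intro power_mono) auto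
    then have l: "?l \<le> - 2" by simp
    then have neg: "?l < 0" by linarith
    have "r \<le> exp (- 1)" unfolding r_def using l by simp
    also have "\<dots> \<le> (1 / 2 :: real)" using exp_ge_add_one_self[of 1] by (simp add: exp_minus inverse_eq_divide divide_le_eq)
    finally have r: "0 < r" "r \<le> 1 / 2" by (simp_all add: r_def)
    have N0: "N a \<ge> 0" using C by (simp add: N_def)
    have \<delta>r: "\<delta> a = (C' * (1 + ?x)) * r + 4 * r" by (simp add: \<delta>_def r_def algebra_simps)
    define b where "b = (\<lambda>k::int. C0 * (1 + a\<^sup>2)\<^sup>2 * exp (- (4/3) * \<tau> * a ^ 3) * (1 + (2 * pi)\<^sup>2) * (1 / (1 + (real_of_int k)\<^sup>2)))"
    have bi: "integrable (count_space UNIV) b"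
      unfolding b_def by (intro integrable_mult_right integrable_inverse_one_plus_square_int)
    have bI: "integral\<^sup>L (count_space UNIV) b \<le> N a"
    proof -
      have "integral\<^sup>L (count_space UNIV) b = C0 * (1 + a\<^sup>2)\<^sup>2 * exp (- (4/3) * \<tau> * a ^ 3) * (1 + (2 * pi)\<^sup>2) * S0"
        unfolding b_def S0_def by (rule integral_mult_right_zero)
      also have "\<dots> = (C0 * (1 + (2 * pi)\<^sup>2) * S0) * ((1 + a\<^sup>2)\<^sup>2 * exp (- (4/3) * \<tau> * a ^ 3))" by (simp only: mult_ac)
      also have "\<dots> \<le> C * ((1 + a\<^sup>2)\<^sup>2 * exp (- (4/3) * \<tau> * a ^ 3))"
        unfolding C_def by (intro mult_right_mono) auto
      finally show ?thesis by (simp add: N_def mult.assoc)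
    qed
    define m where "m \<theta> k = main_density \<tau> a (log_line ?l (\<theta> + of_int k))" for \<theta> k
    have mb: "norm (m \<theta> k) \<le> b k" if \<theta>: "\<theta> \<in> {0..1}" for \<theta> k
    proof -
      let ?t = "2 * pi * \<theta> + 2 * pi * of_int k"
      have "(2 * pi * \<theta>)\<^sup>2 \<le> (2 * pi)\<^sup>2" using \<theta> by (intro power_mono) (auto simp: mult_le_cancel_left1)
      then have "(1 + (2 * pi * \<theta>)\<^sup>2) * (1 + ?t\<^sup>2) \<le> (1 + (2 * pi)\<^sup>2) * (1 + ?t\<^sup>2)" by (intro mult_right_mono) auto
      then have "1 + (real_of_int k)\<^sup>2 \<le> (1 + (2 * pi)\<^sup>2) * (1 + ?t\<^sup>2)"
        using one_plus_square_shift_le[of k "2 * pi * \<theta>"] by linarith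
      then have 1: "1 / (1 + ?t\<^sup>2) \<le> (1 + (2 * pi)\<^sup>2) * (1 / (1 + (real_of_int k)\<^sup>2))"
        by (simp add: divide_simps add_pos_nonneg)
      let ?M = "C0 * (1 + a\<^sup>2)\<^sup>2 * exp (- (4/3) * \<tau> * a ^ 3)"
      have "norm (m \<theta> k) \<le> ?M / (1 + (Im (log_line ?l (\<theta> + of_int k)))\<^sup>2)"
        unfolding m_def by (rule C0(2)[OF a1]) simp
      also have "\<dots> = ?M * (1 / (1 + ?t\<^sup>2))" by (simp add: distrib_left)
      also have "\<dots> \<le> ?M * ((1 + (2 * pi)\<^sup>2) * (1 / (1 + (real_of_int k)\<^sup>2)))"
        using 1 C0(1) by (intro mult_left_mono) auto
      finally show ?thesis by (simp add: b_def mult.assoc)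
    qed
    define M where "M \<theta> = (LINT k|count_space UNIV. m \<theta> k)" for \<theta>
    have Mlim: "(\<lambda>n. \<Sum>k\<in>{- int n..<int n}. m \<theta> k) \<longlonglongrightarrow> M \<theta>" if "\<theta> \<in> {0..1}" for \<theta>
      unfolding M_def by (rule LINT_count_space_int_limit[OF bi mb[OF that]])
    have mcont: "continuous_on {0..1} (\<lambda>\<theta>. m \<theta> k)" for k
      unfolding m_def by (intro continuous_on_main_density continuous_intros) (use neg in simp)
    have mint: "(\<lambda>\<theta>. m \<theta> k) integrable_on {0..1}" for k
      by (intro integrable_continuous_real mcont)
    have sint: "(\<lambda>\<theta>. \<Sum>k\<in>{- int n..<int n}. m \<theta> k) integrable_on {0..1}" for n
      by (intro integrable_sum mint) auto
    have sb: "norm (\<Sum>k\<in>{- int n..<int n}. m \<theta> k) \<le> N a" if "\<theta> \<in> {0..1}" for n \<theta>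
    proof -
      have "norm (\<Sum>k\<in>{- int n..<int n}. m \<theta> k) \<le> (\<Sum>k\<in>{- int n..<int n}. b k)"
        by (intro sum_norm_le mb[OF that])
      also have "\<dots> = (LINT k|count_space UNIV. indicat_real {- int n..<int n} k * b k)"
        by (subst lebesgue_integral_count_space_finite_support)
          (auto intro!: finite_subset[of _ "{- int n..<int n}"] sum.mono_neutral_cong_right simp: indicator_def split: if_splits)
      also have "\<dots> \<le> integral\<^sup>L (count_space UNIV) b"
      proof (rule integral_mono[OF _ bi])
        show "integrable (count_space UNIV) (\<lambda>k. indicat_real {- int n..<int n} k * b k)"
          using integrable_mult_indicator[OF _ bi, of "{- int n..<int n}"] by simp
        show "indicat_real {- int n..<int n} k * b k \<le> b k" for k
          using order_trans[OF norm_ge_zero mb[OF that, of k]] by (auto simp: indicator_def)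
      qed
      finally show ?thesis using bI by linarith
    qed
    \<comment> \<open>The partial sums are bounded by the constant \<open>N a\<close>, so the
      integral over \<theta> and the sum over k may be exchanged. With
      \<open>main_term_limit\<close> this makes the integral of M the Airy trace.\<close>
    note dc = dominated_convergence[OF sint integrable_const_ivl sb Mlim]
    have Mint: "M integrable_on {0..1}" by (rule dc(1))
    have MTr: "integral {0..1} M = Tr"
    proof (rule LIMSEQ_unique[OF dc(2)])
      show "(\<lambda>n. integral {0..1} (\<lambda>\<theta>. \<Sum>k\<in>{- int n..<int n}. m \<theta> k)) \<longlonglongrightarrow> Tr"
        using main_term_limit[OF \<tau> a1 \<kappa> refl]
        unfolding m_def[symmetric] Tr_def[symmetric] by (subst integral_sum) (use mint in auto)
    qed
    define P where "P \<theta> = prefactor_log ?x \<tau> (exp (log_line ?l \<theta>))" for \<theta>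
    have nz: "norm (exp (log_line ?l \<theta>)) = r" for \<theta> by (simp add: norm_exp_eq_Re r_def)
    have Pb: "norm (P \<theta>) \<le> C' * (1 + ?x) * r" for \<theta>
      using C'(2)[of ?x "exp (log_line ?l \<theta>)", unfolded nz] r(2) \<tau> unfolding P_def by simp
    have Pd: "norm (P \<theta>) \<le> \<delta> a" for \<theta> using Pb[of \<theta>] r by (simp add: \<delta>r)
    have eP: "norm (exp (P \<theta>)) \<le> 4" for \<theta>
    proof -
      have "norm (exp (P \<theta>)) \<le> exp (norm (P \<theta>))" by (rule norm_exp)
      also have "\<dots> \<le> exp 1" using Pd[of \<theta>] a(3) by simp
      finally show ?thesis using exp_le by linarith
    qed
    have pt: "norm (F1_integrand ?x \<tau> (log_line ?l \<theta>) - (exp (P \<theta>) - M \<theta>)) \<le> 3 * \<delta> a * N a + 648 * (N a)\<^sup>2"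
      if \<theta>: "\<theta> \<in> {0..1}" for \<theta>
    proof -
      let ?w = "log_line ?l \<theta>"
      let ?\<xi> = "\<lambda>k. sqrt_branch (log_point ?w k)"
      have Kd: "K1 ?x \<tau> (?\<xi> k) (?\<xi> k) = m \<theta> k * exp (- Q (?\<xi> k))" for k
        by (simp add: K1_diag_main_density m_def log_point_log_line)
      have Qb: "norm (Q (?\<xi> k)) \<le> 4 * r" for k
      proof -
        have "Re (log_point ?w k) < 0" using neg by simp
        from norm_Q_le[OF sqrt_branch_in_Q_domain[OF this]]
        have "norm (Q (?\<xi> k)) \<le> 2 * (r / (1 - r))" unfolding exp_sqrt_branch exp_log_point nz .
        also have "\<dots> \<le> 2 * (2 * r)" using r by (intro mult_left_mono) (auto simp: divide_le_eq algebra_simps)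
        finally show ?thesis by simp
      qed
      have eQ: "norm (exp (- Q (?\<xi> k))) \<le> 9" for k
      proof -
        have "norm (exp (- Q (?\<xi> k))) \<le> exp (norm (- Q (?\<xi> k)))" by (rule norm_exp)
        also have "\<dots> \<le> exp (1 + 1)" using Qb[of k] r by simp
        also have "\<dots> \<le> 3 * (3::real)" unfolding exp_add by (intro mult_mono exp_le) auto
        finally show ?thesis by simp
      qed
      have Kb: "norm (K1 ?x \<tau> (?\<xi> k) (?\<xi> k)) \<le> 9 * b k" for k
        unfolding Kd norm_mult using mult_mono[OF mb[OF \<theta>, of k] eQ[of k]] order_trans[OF norm_ge_zero mb[OF \<theta>, of k]]
        by (simp add: mult.commute)
      have bi9: "integrable (count_space UNIV) (\<lambda>k. 9 * b k)" using bi by (intro integrable_mult_right)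
      have b0: "0 \<le> integral\<^sup>L (count_space UNIV) b"
        using order_trans[OF norm_ge_zero mb[OF \<theta>]] by (intro Bochner_Integration.integral_nonneg)
      define T1 where "T1 = (LINT k|count_space UNIV. K1 ?x \<tau> (?\<xi> k) (?\<xi> k))"
      have "norm (fred ?x \<tau> ?w - (1 - T1)) \<le> 2 * (9 * N a)\<^sup>2"
        unfolding fred_def T1_def
      proof (rule fredholm_det_approx[OF sigma_finite_count_space_int])
        fix n
        have "norm (LINT \<kappa>|Pi\<^sub>M {..<n} (\<lambda>_. count_space UNIV). Determinant.det (Matrix.mat n n
            (\<lambda>(i, j). K1 ?x \<tau> (?\<xi> (\<kappa> i)) (?\<xi> (\<kappa> j))))) \<le> (LINT k|count_space UNIV. 9 * b k) ^ n"
          by (rule norm_fred_term_le[OF _ bi9 Kb]) (use neg in simp)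
        also have "\<dots> \<le> (9 * N a) ^ n" using bI b0 by (intro power_mono) auto
        also have "\<dots> \<le> fact n * (9 * N a) ^ n"
          using mult_right_mono[of 1 "fact n" "(9 * N a) ^ n"] N0 by simp
        finally show "norm (LINT \<kappa>|Pi\<^sub>M {..<n} (\<lambda>_. count_space UNIV). Determinant.det (Matrix.mat n n
            (\<lambda>(i, j). K1 ?x \<tau> (?\<xi> (\<kappa> i)) (?\<xi> (\<kappa> j))))) \<le> fact n * (9 * N a) ^ n" .
      qed (use N0 a(2) in auto)
      then have 1: "norm (exp (P \<theta>) * (fred ?x \<tau> ?w - (1 - T1))) \<le> 4 * (2 * (9 * N a)\<^sup>2)"
        unfolding norm_mult using eP[of \<theta>] by (intro mult_mono) auto
      have mi: "integrable (count_space UNIV) (m \<theta>)"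
        by (rule Bochner_Integration.integrable_bound[OF bi]) (use mb[OF \<theta>] in \<open>auto intro: order_trans[OF _ abs_ge_self]\<close>)
      have Ki: "integrable (count_space UNIV) (\<lambda>k. K1 ?x \<tau> (?\<xi> k) (?\<xi> k))"
        by (rule Bochner_Integration.integrable_bound[OF bi9]) (use Kb in \<open>auto intro: order_trans[OF _ abs_ge_self]\<close>)
      \<comment> \<open>Termwise the kernel diagonal is the main density times exp(-Q), so prefactor
        and Q combine into the single factor exp(P - Q) close to 1.\<close>
      have "exp (P \<theta>) * T1 - M \<theta> = (LINT k|count_space UNIV. m \<theta> k * (exp (P \<theta> - Q (?\<xi> k)) - 1))"
      proof -
        have "exp (P \<theta>) * T1 - M \<theta> = (LINT k|count_space UNIV. exp (P \<theta>) * K1 ?x \<tau> (?\<xi> k) (?\<xi> k)) - (LINT k|count_space UNIV. m \<theta> k)"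
          by (simp add: T1_def M_def)
        also have "\<dots> = (LINT k|count_space UNIV. exp (P \<theta>) * K1 ?x \<tau> (?\<xi> k) (?\<xi> k) - m \<theta> k)"
          by (rule Bochner_Integration.integral_diff[symmetric]) (use Ki mi in auto)
        also have "\<dots> = (LINT k|count_space UNIV. m \<theta> k * (exp (P \<theta> - Q (?\<xi> k)) - 1))"
          unfolding Kd by (intro Bochner_Integration.integral_cong refl) (simp add: exp_diff exp_minus field_simps)
        finally show ?thesis .
      qed
      also have "norm \<dots> \<le> (LINT k|count_space UNIV. b k * (3 * \<delta> a))"
      proof (rule norm_LINT_le)
        show "integrable (count_space UNIV) (\<lambda>k. b k * (3 * \<delta> a))" using bi by (intro integrable_mult_left)
        fix k
        have "norm (P \<theta> - Q (?\<xi> k)) \<le> norm (P \<theta>) + norm (Q (?\<xi> k))" by (rule norm_triangle_ineq4)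
        also have "\<dots> \<le> \<delta> a" using Pb[of \<theta>] Qb[of k] by (simp add: \<delta>r)
        finally have d: "norm (P \<theta> - Q (?\<xi> k)) \<le> \<delta> a" .
        then have "norm (exp (P \<theta> - Q (?\<xi> k)) - 1) \<le> 3 * norm (P \<theta> - Q (?\<xi> k))"
          using a(3) by (intro norm_exp_minus_one_le) linarith
        then have "norm (exp (P \<theta> - Q (?\<xi> k)) - 1) \<le> 3 * \<delta> a" using d by linarith
        then show "norm (m \<theta> k * (exp (P \<theta> - Q (?\<xi> k)) - 1)) \<le> b k * (3 * \<delta> a)"
          unfolding norm_mult using mb[OF \<theta>, of k] order_trans[OF norm_ge_zero mb[OF \<theta>, of k]] by (intro mult_mono) auto
      qed
      also have "\<dots> = integral\<^sup>L (count_space UNIV) b * (3 * \<delta> a)" by simp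
      also have "\<dots> \<le> N a * (3 * \<delta> a)"
        using bI order_trans[OF norm_ge_zero Pd[of \<theta>]] by (intro mult_right_mono) auto
      finally have 2: "norm (exp (P \<theta>) * T1 - M \<theta>) \<le> 3 * \<delta> a * N a" by (simp add: mult_ac)
      \<comment> \<open>exp P is removed as a whole, because its integral is known exactly. What
        remains is quadratic in the kernel or a relative error of the trace term.\<close>
      have "F1_integrand ?x \<tau> ?w - (exp (P \<theta>) - M \<theta>) = exp (P \<theta>) * (fred ?x \<tau> ?w - (1 - T1)) - (exp (P \<theta>) * T1 - M \<theta>)"
        by (simp add: F1_integrand_def P_def algebra_simps)
      also have "norm \<dots> \<le> norm (exp (P \<theta>) * (fred ?x \<tau> ?w - (1 - T1))) + norm (exp (P \<theta>) * T1 - M \<theta>)"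
        by (rule norm_triangle_ineq4)
      also have "\<dots> \<le> 4 * (2 * (9 * N a)\<^sup>2) + 3 * \<delta> a * N a" using 1 2 by (rule add_mono)
      finally show ?thesis by (simp add: power_mult_distrib)
    qed
    have R': "0 < r" "r < 1" "ln r = ?l" using r by (auto simp: r_def)
    have gint: "(\<lambda>\<theta>. F1_integrand ?x \<tau> (log_line ?l \<theta>)) integrable_on {0..1}"
    proof (rule integrable_continuous_real)
      have "continuous_on {w. Re w < 0} (F1_integrand ?x \<tau>)"
        by (intro holomorphic_on_imp_continuous_on holomorphic_F1_integrand \<tau>)
      then show "continuous_on {0..1} (\<lambda>\<theta>. F1_integrand ?x \<tau> (log_line ?l \<theta>))"
        by (rule continuous_on_compose2) (use neg in \<open>auto intro!: continuous_intros\<close>)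
    qed
    have Pint: "(\<lambda>\<theta>. exp (P \<theta>)) integrable_on {0..1}"
    proof (rule integrable_continuous_real)
      have "continuous_on (ball 0 1) (prefactor_log ?x \<tau>)"
        by (intro holomorphic_on_imp_continuous_on holomorphic_prefactor_log)
      then have "continuous_on {0..1} P" unfolding P_def
        by (rule continuous_on_compose2) (use nz R' in \<open>auto intro!: continuous_intros\<close>)
      then show "continuous_on {0..1} (\<lambda>\<theta>. exp (P \<theta>))" by (intro continuous_intros)
    qed
    obtain c where c: "\<And>R. R \<in> {0<..<1} \<Longrightarrow> F1 R ?x \<tau> = c" using F1_radius_independent[OF \<tau>] by blast
    have "F1 R ?x \<tau> = F1 r ?x \<tau>" using c[OF R] c[of r] R' by simp
    also have "\<dots> = integral {0..1} (\<lambda>\<theta>. F1_integrand ?x \<tau> (log_line ?l \<theta>))"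
      using F1_eq[OF R'(1,2), of ?x \<tau>] unfolding R'(3) .
    finally have F: "F1 R ?x \<tau> = integral {0..1} (\<lambda>\<theta>. F1_integrand ?x \<tau> (log_line ?l \<theta>))" .
    have one: "integral {0..1} (\<lambda>\<theta>. exp (P \<theta>)) = 1"
      using mean_value_prefactor[OF R'(1,2), of ?x \<tau>] unfolding R'(3) P_def .
    have "integral {0..1} (\<lambda>\<theta>. F1_integrand ?x \<tau> (log_line ?l \<theta>) - (exp (P \<theta>) - M \<theta>)) = F1 R ?x \<tau> - (1 - Tr)"
      using gint Pint Mint by (simp add: integral_diff integrable_diff F one MTr)
    moreover have "norm (integral {0..1} (\<lambda>\<theta>. F1_integrand ?x \<tau> (log_line ?l \<theta>) - (exp (P \<theta>) - M \<theta>)))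
        \<le> integral {0..1} (\<lambda>\<theta>::real. 3 * \<delta> a * N a + 648 * (N a)\<^sup>2)"
      using gint Pint Mint pt by (intro integral_norm_bound_integral integrable_diff) auto
    ultimately have "norm (F1 R ?x \<tau> - (1 - Tr)) \<le> 3 * \<delta> a * N a + 648 * (N a)\<^sup>2" by simp
    moreover have "norm (1 - F1 R ?x \<tau> - Tr) = norm (F1 R ?x \<tau> - (1 - Tr))"
      by (subst norm_minus_commute) (simp add: algebra_simps)
    ultimately show ?thesis by (simp add: Tr_def)
  qed
  show ?thesis
  proof (rule exI[of _ C], rule conjI[OF C], rule exI[of _ C'], rule conjI[OF C'(1)])
    show "\<forall>\<^sub>F a in at_top. \<forall>R\<in>{0<..<1}.
      norm (1 - F1 R (\<tau> * a\<^sup>2) \<tau> - of_real (LINT u:{0<..}|lborel. airy_Ai ((\<kappa> * a)\<^sup>2 + 2 * u))) \<le>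
      3 * ((C' * (1 + \<tau> * a\<^sup>2) + 4) * exp (- a\<^sup>2 / 2)) * (C * (1 + a\<^sup>2)\<^sup>2 * exp (- (4/3) * \<tau> * a ^ 3))
      + 648 * (C * (1 + a\<^sup>2)\<^sup>2 * exp (- (4/3) * \<tau> * a ^ 3))\<^sup>2"
      using ev unfolding N_def[symmetric] \<delta>_def[symmetric] by (rule eventually_mono) (use main in blast)
  qed
qed

text \<open>All errors are measured against \<open>e a / q a\<close>, a lower bound for the GOE tail
  in which \<open>e a\<close> is the saddle value. One factor \<open>e a\<close> cancels from every
  term, so \<open>V a\<close> is a polynomial times exp(-a^2/2) plus a polynomial times
  \<open>e a\<close>. Both are eventually below exp(-sqrt \<tau> a), which is exp(-sqrt x) at a =
  sqrt(x/\<tau>).\<close>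

lemma F1_relative_error:
  fixes \<tau> :: real
  assumes \<tau>: "\<tau> > 0"
  defines "\<kappa> \<equiv> root 3 (2 * \<tau>)"
  shows "\<forall>\<^sub>F a in at_top. F_GOE ((\<kappa> * a)\<^sup>2) \<noteq> 1 \<and> (\<forall>R\<in>{0<..<1}.
    norm ((1 - F1 R (\<tau> * a\<^sup>2) \<tau>) / of_real (1 - F_GOE ((\<kappa> * a)\<^sup>2)) - 1) \<le> exp (- sqrt \<tau> * a))"
proof -
  have \<kappa>: "\<kappa> > 0" "\<kappa> ^ 3 = 2 * \<tau>" using \<tau> by (auto simp: \<kappa>_def)
  define e where "e a = exp (- (4/3) * \<tau> * a ^ 3)" for a
  define Tr where "Tr a = (LINT u:{0<..}|lborel. airy_Ai ((\<kappa> * a)\<^sup>2 + 2 * u))" for a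
  obtain C C' where C: "C > 0" "C' > 0" and F1: "\<forall>\<^sub>F a in at_top. \<forall>R\<in>{0<..<1}.
    norm (1 - F1 R (\<tau> * a\<^sup>2) \<tau> - of_real (Tr a)) \<le>
      3 * ((C' * (1 + \<tau> * a\<^sup>2) + 4) * exp (- a\<^sup>2 / 2)) * (C * (1 + a\<^sup>2)\<^sup>2 * e a) + 648 * (C * (1 + a\<^sup>2)\<^sup>2 * e a)\<^sup>2"
    using F1_approx[OF \<tau>] unfolding Tr_def e_def \<kappa>_def by blast
  obtain \<sigma>0 where \<sigma>0: "\<sigma>0 \<ge> 1" "\<And>\<sigma>. \<sigma> \<ge> \<sigma>0 \<Longrightarrow>
      exp (- 2 / 3 * \<sigma> ^ 3) / (4 * pi * \<sigma>\<^sup>2) \<le> (LINT u:{0<..}|lborel. airy_Ai (\<sigma>\<^sup>2 + 2 * u))"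
    using airy_trace_lower_bound by blast
  \<comment> \<open>Twice the denominator 4 pi \<sigma>^2 in the lower bound of the trace: half of
    that bound is given up to absorb the difference between the trace and the GOE tail, which is at
    most the square of \<open>e a\<close>.\<close>
  define q where "q a = 8 * pi * (\<kappa> * a)\<^sup>2" for a
  define V where "V a = q a * (3 * ((C' * (1 + \<tau> * a\<^sup>2) + 4) * exp (- a\<^sup>2 / 2)) * (C * (1 + a\<^sup>2)\<^sup>2)
      + (648 * (C * (1 + a\<^sup>2)\<^sup>2)\<^sup>2 + 1) * e a)" for a
  have "filterlim (\<lambda>a. \<kappa> * a) at_top at_top" using \<kappa>(1) by real_asymp
  then have ev1: "eventually (\<lambda>a. \<kappa> * a \<ge> \<sigma>0) at_top" by (simp add: filterlim_at_top)
  have "((\<lambda>a. q a * e a) \<longlongrightarrow> 0) at_top" unfolding q_def e_def using \<tau> \<kappa>(1) by real_asymp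
  then have ev2: "eventually (\<lambda>a. q a * e a < 1) at_top" by (rule order_tendstoD) simp
  have ev3: "eventually (\<lambda>a. V a * exp (sqrt \<tau> * a) < 1) at_top"
  proof -
    define s where "s = sqrt \<tau>"
    have s: "s > 0" using \<tau> by (simp add: s_def)
    have "((\<lambda>a. V a * exp (s * a)) \<longlongrightarrow> 0) at_top"
      unfolding V_def q_def e_def using \<tau> \<kappa>(1) C s by real_asymp
    then have "eventually (\<lambda>a. V a * exp (s * a) < 1) at_top" by (rule order_tendstoD) simp
    then show ?thesis by (simp add: s_def)
  qed
  show ?thesis
    using F1 ev1 ev2 ev3 eventually_gt_at_top[of 0]
  proof eventually_elim
    case (elim a)
    have \<sigma>: "\<kappa> * a \<ge> 1" using elim(2) \<sigma>0(1) by linarith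
    have cube: "(\<kappa> * a) ^ 3 = 2 * \<tau> * a ^ 3" using \<kappa>(2) by (simp add: power_mult_distrib)
    have e0: "e a > 0" by (simp add: e_def)
    have q0: "q a > 0" unfolding q_def using \<kappa>(1) elim(5) by (intro mult_pos_pos zero_less_power) auto
    have ee: "exp (- 4 / 3 * (\<kappa> * a) ^ 3) = (e a)\<^sup>2" unfolding cube e_def by (simp add: power2_eq_square flip: exp_add)
    have ee': "exp (- 2 / 3 * (\<kappa> * a) ^ 3) = e a" unfolding cube e_def by simp
    define G where "G = 1 - F_GOE ((\<kappa> * a)\<^sup>2)"
    have 1: "\<bar>Tr a - G\<bar> \<le> (e a)\<^sup>2"
      using F_GOE_approx[OF \<sigma>] unfolding ee by (simp add: G_def Tr_def abs_minus_commute)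
    have "e a / (4 * pi * (\<kappa> * a)\<^sup>2) \<le> Tr a" using \<sigma>0(2)[OF elim(2)] unfolding ee' by (simp add: Tr_def)
    then have 2: "2 * (e a / q a) \<le> Tr a" by (simp add: q_def)
    have "(e a)\<^sup>2 \<le> e a / q a"
    proof -
      have "e a * (q a * e a) \<le> e a * 1" using elim(3) e0 by (intro mult_left_mono) auto
      then show ?thesis using q0 by (simp add: pos_le_divide_eq power2_eq_square mult_ac)
    qed
    then have G: "e a / q a \<le> G" using 1 2 by linarith
    have eq0: "0 < e a / q a" using e0 q0 by simp
    then have G0: "G > 0" using G by linarith
    have "norm ((1 - F1 R (\<tau> * a\<^sup>2) \<tau>) / of_real G - 1) \<le> exp (- sqrt \<tau> * a)" if R: "R \<in> {0<..<1}" for R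
    proof -
      let ?F = "1 - F1 R (\<tau> * a\<^sup>2) \<tau>"
      let ?U = "3 * ((C' * (1 + \<tau> * a\<^sup>2) + 4) * exp (- a\<^sup>2 / 2)) * (C * (1 + a\<^sup>2)\<^sup>2 * e a) + 648 * (C * (1 + a\<^sup>2)\<^sup>2 * e a)\<^sup>2"
      have "norm (?F - of_real G) \<le> norm (?F - of_real (Tr a)) + norm (complex_of_real (Tr a) - of_real G)"
        using dist_triangle[of ?F "of_real G" "of_real (Tr a)"] unfolding dist_norm .
      also have "norm (complex_of_real (Tr a) - of_real G) = \<bar>Tr a - G\<bar>"
        by (simp only: of_real_diff[symmetric] norm_of_real)
      finally have "norm (?F - of_real G) \<le> norm (?F - of_real (Tr a)) + \<bar>Tr a - G\<bar>" .
      moreover have "norm (?F - of_real (Tr a)) \<le> ?U" using elim(1) R by blast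
      ultimately have n: "norm (?F - of_real G) \<le> ?U + (e a)\<^sup>2" using 1 by linarith
      have "?F / of_real G - 1 = (?F - of_real G) / of_real G" using G0 by (simp add: diff_divide_distrib)
      then have "norm (?F / of_real G - 1) = norm (?F - of_real G) / G" using G0 by (simp add: norm_divide)
      also have "\<dots> \<le> (?U + (e a)\<^sup>2) / (e a / q a)"
        using n G eq0 order_trans[OF norm_ge_zero n] by (intro frac_le) auto
      also have "?U + (e a)\<^sup>2 = V a * (e a / q a)"
        unfolding V_def using q0 by (simp add: power2_eq_square algebra_simps)
      also have "V a * (e a / q a) / (e a / q a) = V a" using e0 q0 by simp
      also have "V a \<le> exp (- sqrt \<tau> * a)" 
      proof -
        have "V a \<le> 1 / exp (sqrt \<tau> * a)" using elim(4) by (simp add: pos_le_divide_eq)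
        then show ?thesis by (simp add: exp_minus inverse_eq_divide)
      qed
      finally show ?thesis .
    qed
    then show ?case using G0 by (simp add: G_def)
  qed
qed

theorem theorem8p3:
  fixes \<tau> :: real
  assumes "\<tau> > 0"
  shows "\<exists>c>0. \<exists>E :: real \<Rightarrow> complex.
    E \<in> O[at_top](\<lambda>x. of_real (exp (- c * sqrt x))) \<and>
    (\<forall>\<^sub>F x in at_top. \<forall>R\<in>{0<..<1}.
      1 - F1 R x \<tau> = of_real (1 - F_GOE (2 powr (2/3) * \<tau> powr (- (1/3)) * x)) * (1 + E x))"
proof -
  define \<kappa> where "\<kappa> = root 3 (2 * \<tau>)"
  let ?s = "\<lambda>x. 2 powr (2/3) * \<tau> powr (- (1/3)) * x"
  \<comment> \<open>The radius 1/2 is an arbitrary representative, as the integral is the same for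
    every R. A vanishing denominator would make the quotient 0, but it is excluded for large
    x.\<close>
  define E where "E x = (1 - F1 (1/2) x \<tau>) / of_real (1 - F_GOE (?s x)) - 1" for x
  have "filterlim (\<lambda>x. sqrt (x / \<tau>)) at_top at_top" using assms by real_asymp
  from eventually_compose_filterlim[OF F1_relative_error[OF assms] this]
  have ev: "\<forall>\<^sub>F x in at_top. F_GOE (?s x) \<noteq> 1 \<and> norm (E x) \<le> exp (- 1 * sqrt x)"
    using eventually_gt_at_top[of 0]
  proof eventually_elim
    case (elim x)
    have x: "\<tau> * (sqrt (x / \<tau>))\<^sup>2 = x" using elim(2) assms by simp
    have "\<kappa> = (2 * \<tau>) powr (1/3)" using assms by (simp add: \<kappa>_def root_powr_inverse)
    then have "\<kappa>\<^sup>2 = (2 * \<tau>) powr (2/3)" using assms by (simp add: powr_power)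
    then have "\<kappa>\<^sup>2 / \<tau> = 2 powr (2/3) * (\<tau> powr (2/3) / \<tau> powr 1)" using assms by (simp add: powr_mult)
    also have "\<tau> powr (2/3) / \<tau> powr 1 = \<tau> powr (- (1/3))" unfolding powr_diff[symmetric] by simp
    finally have k: "\<kappa>\<^sup>2 / \<tau> = 2 powr (2/3) * \<tau> powr (- (1/3))" .
    have "(\<kappa> * sqrt (x / \<tau>))\<^sup>2 = \<kappa>\<^sup>2 * (x / \<tau>)"
      using elim(2) assms by (simp add: power_mult_distrib)
    also have "\<dots> = \<kappa>\<^sup>2 / \<tau> * x" by simp
    finally have s: "(\<kappa> * sqrt (x / \<tau>))\<^sup>2 = ?s x" unfolding k .
    have "sqrt \<tau> * sqrt (x / \<tau>) = sqrt x" using elim(2) assms by (simp add: real_sqrt_divide)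
    then show ?case using elim(1) unfolding \<kappa>_def[symmetric] x s by (auto simp: E_def)
  qed
  show ?thesis
  \<comment> \<open>The rate c = 1 is what the substitution a = sqrt(x/\<tau>) makes of exp(-sqrt
    \<tau> a).\<close>
  proof (intro exI[of _ "1::real"] exI[of _ E] conjI)
    show "E \<in> O[at_top](\<lambda>x. of_real (exp (- 1 * sqrt x)))"
      by (rule bigoI[where c = 1]) (use ev in \<open>auto elim!: eventually_mono\<close>)
    show "\<forall>\<^sub>F x in at_top. \<forall>R\<in>{0<..<1}. 1 - F1 R x \<tau> = of_real (1 - F_GOE (?s x)) * (1 + E x)"
      using ev
    proof eventually_elim
      case (elim x)
      obtain c where "\<And>R. R \<in> {0<..<1} \<Longrightarrow> F1 R x \<tau> = c" using F1_radius_independent[OF assms] by blast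
      then have F: "F1 R x \<tau> = F1 (1/2) x \<tau>" if "R \<in> {0<..<1}" for R using that by simp
      have nz: "complex_of_real (1 - F_GOE (?s x)) \<noteq> 0"
        using elim by (simp only: of_real_eq_0_iff) simp
      have "1 + E x = (1 - F1 (1/2) x \<tau>) / of_real (1 - F_GOE (?s x))" unfolding E_def by simp
      then have "of_real (1 - F_GOE (?s x)) * (1 + E x) = 1 - F1 (1/2) x \<tau>"
        by (simp only: times_divide_eq_right nonzero_mult_div_cancel_left[OF nz])
      with F show ?case by metis
    qed
  qed simp
qed

end
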